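(* Let $F_{14}:=(6,\{02,05,12,15\})$. Then $\lambda_{F_{14}}=10/81$. Furthermore, the $F_{14}$-problem is perfectly $B$-stable with $B:=(3,\{12\})$, and the unique (up to automorphisms of $B$) maximiser of $p(F_{14},B(\boldsymbol x))$ over $\boldsymbol x\in\mathbb S_3$ is $\boldsymbol x=(1/3,1/3,1/3)$.
   Context: All graphs are finite and simple. $(m,E)$ denotes the graph or pattern with vertex set $\{0,\dots,m-1\}$ and edge set $E$; $ij$ abbreviates $\{i,j\}$ ($ii$ is a loop). For graphs $F,G$ with $\kappa\le n$ vertices, $p(F,G)$ is the number of $\kappa$-subsets of $V(G)$ inducing a subgraph isomorphic to $F$, divided by $\binom n\kappa$; $p(F,n)$ is the maximum of $p(F,G)$ over $n$-vertex graphs $G$; $\lambda_F=\lim_{n\to\infty}p(F,n)$ (the limit exists). A pattern is a graph in which loops are allowed; its automorphisms are the bijections of the vertex set preserving edges, non-edges, loops and non-loops. For a pattern $B$ on $\{0,\dots,m-1\}$ and disjoint (possibly empty) sets $V_0,\dots,V_{m-1}$, the blowup $B(V_0,\dots,V_{m-1})$ is the simple graph on $\bigcup V_i$ in which distinct $x\in V_i$, $y\in V_j$ are adjacent iff $\{i,j\}\in E(B)$ (so $V_i$ is a clique if $i$ has a loop and independent otherwise); $B()$ is the family of all blowups. $\mathbb S_m=\{\boldsymbol x\in\mathbb R^m:x_i\ge0,\sum x_i=1\}$, and $p(F,B(\boldsymbol x))$ is the limit as $n\to\infty$ of $p(F,B(V_0,\dots,V_{m-1}))$ with $|V_i|=(x_i+o(1))n$.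 $\delta_{\mathrm{edit}}(G,B())$ is the minimum number of vertex pairs whose adjacency must be changed to turn $G$ into a graph isomorphic to a blowup of $B$ (of the same order). The $F$-problem is perfectly $B$-stable if there is $C>0$ such that every graph $G$ with $n\ge C$ vertices satisfies $\delta_{\mathrm{edit}}(G,B())\le C\,(p(F,n)-p(F,G))\,n^2$. *)

theory Defs
  imports Complex_Main "HOL-Library.Disjoint_Sets"
begin

text \<open>One type serves for simple graphs and for patterns. Edges are unordered pairs
  \<open>{x, y}\<close>; a loop at \<open>x\<close> is \<open>{x, x} = {x}\<close>.\<close>

datatype 'a ugraph = Graph (verts: "'a set") (edges: "'a set set")

definition simple_graph :: "'a ugraph \<Rightarrow> bool" where
  "simple_graph G \<longleftrightarrow> finite (verts G) \<and> (\<forall>e\<in>edges G. e \<subseteq> verts G \<and> card e = 2)"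

definition nat_graph :: "nat \<Rightarrow> nat set set \<Rightarrow> nat ugraph" where
  "nat_graph m E = Graph {0..<m} E"

text \<open>The case \<open>x = y\<close> says that loops and non-loops are preserved.\<close>

definition is_iso :: "('a \<Rightarrow> 'b) \<Rightarrow> 'a ugraph \<Rightarrow> 'b ugraph \<Rightarrow> bool" where
  "is_iso f F G \<longleftrightarrow> bij_betw f (verts F) (verts G) \<and>
     (\<forall>x\<in>verts F. \<forall>y\<in>verts F. {x, y} \<in> edges F \<longleftrightarrow> {f x, f y} \<in> edges G)"

definition isomorphic :: "'a ugraph \<Rightarrow> 'b ugraph \<Rightarrow> bool" where
  "isomorphic F G \<longleftrightarrow> (\<exists>f. is_iso f F G)"

definition automorphism :: "('a \<Rightarrow> 'a) \<Rightarrow> 'a ugraph \<Rightarrow> bool" where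
  "automorphism f B \<longleftrightarrow> is_iso f B B"

definition induced_subgraph :: "'a ugraph \<Rightarrow> 'a set \<Rightarrow> 'a ugraph" where
  "induced_subgraph G S = Graph S {e \<in> edges G. e \<subseteq> S}"

text \<open>If \<open>G\<close> has fewer vertices than \<open>F\<close>, the binomial coefficient, and hence the density, is 0.\<close>

definition ind_density :: "'a ugraph \<Rightarrow> 'b ugraph \<Rightarrow> real" where
  "ind_density F G =
     real (card {S. S \<subseteq> verts G \<and> card S = card (verts F) \<and> isomorphic (induced_subgraph G S) F})
     / real (card (verts G) choose card (verts F))"

text \<open>Every finite graph is isomorphic to one whose vertices are natural numbers. Infinitely many
  graphs are considered here, but they yield only finitely many densities.\<close>

definition max_density :: "'a ugraph \<Rightarrow> nat \<Rightarrow> real" where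
  "max_density F n =
     Max {ind_density F G | G :: nat ugraph. simple_graph G \<and> card (verts G) = n}"

definition inducibility :: "'a ugraph \<Rightarrow> real" where
  "inducibility F = lim (max_density F)"

definition blowup_parts :: "'b ugraph \<Rightarrow> ('b \<Rightarrow> 'a set) \<Rightarrow> bool" where
  "blowup_parts B V \<longleftrightarrow>
     (\<forall>i\<in>verts B. finite (V i)) \<and> disjoint_family_on V (verts B)"

definition blowup :: "'b ugraph \<Rightarrow> ('b \<Rightarrow> 'a set) \<Rightarrow> 'a ugraph" where
  "blowup B V = Graph (\<Union>i\<in>verts B. V i)
     {{x, y} | x y i j. i \<in> verts B \<and> j \<in> verts B \<and> x \<in> V i \<and> y \<in> V j \<and>
        x \<noteq> y \<and> {i, j} \<in> edges B}"

definition blowups :: "'b ugraph \<Rightarrow> nat ugraph set" where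
  "blowups B = {blowup B V | V. blowup_parts B V}"

definition edit_distance :: "'a ugraph \<Rightarrow> 'b ugraph \<Rightarrow> nat" where
  "edit_distance G B = (LEAST k. \<exists>G'. simple_graph G' \<and> verts G' = verts G \<and>
     (\<exists>H\<in>blowups B. isomorphic G' H) \<and>
     k = card ((edges G - edges G') \<union> (edges G' - edges G)))"

definition perfectly_stable :: "'a ugraph \<Rightarrow> 'b ugraph \<Rightarrow> bool" where
  "perfectly_stable F B \<longleftrightarrow> (\<exists>C::real. C > 0 \<and>
     (\<forall>(G :: nat ugraph) n. simple_graph G \<and> card (verts G) = n \<and> real n \<ge> C \<longrightarrow>
        real (edit_distance G B) \<le> C * (max_density F n - ind_density F G) * (real n)\<^sup>2))"

text \<open>Vectors indexed by \<open>I\<close> are functions vanishing outside \<open>I\<close>.\<close>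

definition prob_simplex :: "'b set \<Rightarrow> ('b \<Rightarrow> real) set" where
  "prob_simplex I = {x. (\<forall>i\<in>I. x i \<ge> 0) \<and> (\<forall>i. i \<notin> I \<longrightarrow> x i = 0) \<and> sum x I = 1}"

text \<open>\<open>has_blowup_density F B x L\<close>: whenever \<open>|V\<^sub>i| = (x\<^sub>i + o(1)) n\<close> for all \<open>i\<close>, the density of \<open>F\<close>
  in the blowup tends to \<open>L\<close>.\<close>

definition has_blowup_density ::
  "'a ugraph \<Rightarrow> 'b ugraph \<Rightarrow> ('b \<Rightarrow> real) \<Rightarrow> real \<Rightarrow> bool" where
  "has_blowup_density F B x L \<longleftrightarrow> (\<forall>V :: nat \<Rightarrow> 'b \<Rightarrow> nat set.
     (\<forall>n. blowup_parts B (V n)) \<and>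
     (\<forall>i\<in>verts B. (\<lambda>n. real (card (V n i)) / real n) \<longlonglongrightarrow> x i)
     \<longrightarrow> (\<lambda>n. ind_density F (blowup B (V n))) \<longlonglongrightarrow> L)"

definition blowup_density :: "'a ugraph \<Rightarrow> 'b ugraph \<Rightarrow> ('b \<Rightarrow> real) \<Rightarrow> real" where
  "blowup_density F B x = (THE L. has_blowup_density F B x L)"

definition maximiser :: "'a ugraph \<Rightarrow> 'b ugraph \<Rightarrow> ('b \<Rightarrow> real) \<Rightarrow> bool" where
  "maximiser F B x \<longleftrightarrow> x \<in> prob_simplex (verts B) \<and>
     (\<forall>y\<in>prob_simplex (verts B). blowup_density F B y \<le> blowup_density F B x)"

definition unique_maximiser_up_to_aut :: "'a ugraph \<Rightarrow> 'b ugraph \<Rightarrow> ('b \<Rightarrow> real) \<Rightarrow> bool" where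
  "unique_maximiser_up_to_aut F B x \<longleftrightarrow> maximiser F B x \<and>
     (\<forall>y. maximiser F B y \<longrightarrow> (\<exists>f. automorphism f B \<and> (\<forall>i\<in>verts B. y i = x (f i))))"

definition F14 :: "nat ugraph" where
  "F14 = nat_graph 6 {{0, 2}, {0, 5}, {1, 2}, {1, 5}}"

definition B14 :: "nat ugraph" where
  "B14 = nat_graph 3 {{1, 2}}"

end

theory Submission
  imports Defs "HOL-Combinatorics.Multiset_Permutations"
begin

text \<open>\<open>F14\<close> is a 4-cycle together with two isolated vertices, and a blowup of \<open>B14\<close> consists of an
independent part \<open>V\<^sub>0\<close> and a complete bipartite graph between \<open>V\<^sub>1\<close> and \<open>V\<^sub>2\<close>. A copy of \<open>F14\<close> in
such a blowup is a set with two vertices in each part, so its density tends to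
\<open>90 (x\<^sub>0 x\<^sub>1 x\<^sub>2)\<^sup>2\<close>, which is largest, and equal to \<open>10/81\<close>, exactly at \<open>x\<^sub>0 = x\<^sub>1 = x\<^sub>2 = 1/3\<close>.

The upper bound is a sum-of-squares argument on six vertices. The integer \<open>margin\<close> of an ordered
6-tuple is 4, minus 1458 if the tuple is a labelled copy of \<open>F14\<close>, minus 1 if the pair \<open>cd\<close>
contradicts the partition suggested by the edge \<open>ab\<close>, minus certain products \<open>l(x) l(y)\<close>, where
\<open>l\<close> is a linear form in the ways in which a vertex (or a pair) attaches to a common root. For any
six vertices the margins of their 720 orderings add up to a nonnegative number; this is a finite
statement (\<open>margin_sum_nonneg\<close>). Summed over all tuples of a large graph, the products become the
squares \<open>(\<Sum>x. l x)\<^sup>2\<close>, which can be discarded. Every copy has 16 labellings, so \<open>certificate\<close> reads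
\<open>23328 N + n\<^sup>2 W \<le> 4 n\<^sup>6 + O(n\<^sup>5)\<close>, where \<open>N\<close> counts copies and \<open>W\<close> the contradicting
pairs \<open>cd\<close>, summed over all edges \<open>ab\<close>. As \<open>4 * 720 / 23328 = 10/81\<close>, this is the bound on the density.
It is sharp because all the linear forms sum to zero in the balanced blowup.

The same inequality gives stability. In a nearly extremal graph \<open>W\<close> is small, so some
edge \<open>ab\<close> suggests a partition that is contradicted by few pairs (\<open>near_extremal_partition\<close>).
This is only an approximate statement, with an error from the \<open>O(n\<^sup>5)\<close>. It is made exact by
\<open>local_stability\<close>: starting from a partition with the fewest wrong pairs, correct the graph step by
step until it is a blowup, and check that the number of copies grows by at least a constant times
\<open>n\<^sup>4\<close> for each corrected pair. There are two kinds of steps. If some vertex \<open>v\<close> is in many wrong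
pairs, all its pairs are corrected; since \<open>v\<close> fits none of the three parts, it was in
fewer copies than a typical vertex by a constant factor (\<open>profile_bound\<close>). Otherwise one wrong pair is corrected; this
destroys few copies because no copy has exactly one wrong pair (\<open>labelled_copy_not_one_wrong_pair\<close>),
and it creates of order \<open>n\<^sup>4\<close> copies. Comparing the final blowup with \<open>max_density\<close> gives perfect stability.\<close>

section \<open>The certificate polynomial and its finite verification\<close>

text \<open>Adjacency of the parts of \<open>B14\<close>. The numbers 1 and 2 are written with \<open>Suc\<close> because the
definition is evaluated by rewriting.\<close>

definition part_edge :: "nat \<Rightarrow> nat \<Rightarrow> bool" where
  "part_edge i j \<longleftrightarrow> i = Suc 0 \<and> j = Suc (Suc 0) \<or> i = Suc (Suc 0) \<and> j = Suc 0"

text \<open>In a blowup of \<open>B14\<close> with an edge \<open>ab\<close>, where \<open>a\<close> is in part 1 and \<open>b\<close> in part 2, this is the part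
of \<open>u\<close>. In particular \<open>a\<close> and \<open>b\<close> are put into their own parts.\<close>

definition side :: "('a \<Rightarrow> 'a \<Rightarrow> bool) \<Rightarrow> 'a \<Rightarrow> 'a \<Rightarrow> 'a \<Rightarrow> nat" where
  "side E a b u = (if E u b then Suc 0 else if E u a then Suc (Suc 0) else 0)"

text \<open>The 4-cycle is \<open>a b c d\<close>, and \<open>e\<close> and \<open>f\<close> are isolated.\<close>

definition labelled_copy :: "('a \<Rightarrow> 'a \<Rightarrow> bool) \<Rightarrow> 'a \<Rightarrow> 'a \<Rightarrow> 'a \<Rightarrow> 'a \<Rightarrow> 'a \<Rightarrow> 'a \<Rightarrow> bool" where
  "labelled_copy E a b c d e f \<longleftrightarrow> E a b \<and> E a d \<and> E c b \<and> E c d \<and> \<not> E a c \<and> \<not> E b d \<and>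
     \<not> E a e \<and> \<not> E b e \<and> \<not> E c e \<and> \<not> E d e \<and>
     \<not> E a f \<and> \<not> E b f \<and> \<not> E c f \<and> \<not> E d f \<and> \<not> E e f"

definition misplaced :: "('a \<Rightarrow> 'a \<Rightarrow> bool) \<Rightarrow> 'a \<Rightarrow> 'a \<Rightarrow> 'a \<Rightarrow> 'a \<Rightarrow> bool" where
  "misplaced E a b c d \<longleftrightarrow> E a b \<and> E c d \<noteq> part_edge (side E a b c) (side E a b d)"

text \<open>A linear form in the ways in which a vertex \<open>v\<close> extends a star with centre \<open>a\<close> and a leaf \<open>b\<close> to
a blowup of \<open>B14\<close>: as a further leaf (coefficient \<open>x\<close>), as a twin of the centre (\<open>y\<close>), or as an
isolated vertex (\<open>z\<close>). In the balanced blowup each case holds for a third of the vertices, so a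
form with \<open>x + y + z = 0\<close> sums to zero there.\<close>

definition ext_form :: "('a \<Rightarrow> 'a \<Rightarrow> bool) \<Rightarrow> 'a \<Rightarrow> 'a \<Rightarrow> 'a \<Rightarrow> 'a \<Rightarrow> int \<Rightarrow> int \<Rightarrow> int \<Rightarrow> 'a \<Rightarrow> int" where
  "ext_form E a b c d x y z v =
     (if E v a then if E v b \<or> E v c \<or> E v d then 0 else x
      else if E v b then if E v c = E a c \<and> E v d = E a d then y else 0
      else if E v c \<or> E v d then 0 else z)"

text \<open>The root consists of a star with centre \<open>a\<close> and isolated vertices; \<open>b\<close> is a leaf, and \<open>c\<close> and \<open>d\<close>
may be leaves or isolated.\<close>

definition star :: "('a \<Rightarrow> 'a \<Rightarrow> bool) \<Rightarrow> 'a \<Rightarrow> 'a \<Rightarrow> 'a \<Rightarrow> 'a \<Rightarrow> bool" where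
  "star E a b c d \<longleftrightarrow> E a b \<and> \<not> E b c \<and> \<not> E b d \<and> \<not> E c d"

text \<open>A positive semidefinite quadratic form for each number of leaves, 3, 2 or 1. The case where \<open>d\<close> but
not \<open>c\<close> is a second leaf is the same root in another order, and is left out to count it once. The
coefficients here and in \<open>pair_weight\<close> are a rounded solution of the semidefinite program for six
vertices; equality on the blowups of \<open>B14\<close> fixes them up to a few parameters, which were chosen to give
small integers.\<close>

definition star_part :: "('a \<Rightarrow> 'a \<Rightarrow> bool) \<Rightarrow> 'a \<Rightarrow> 'a \<Rightarrow> 'a \<Rightarrow> 'a \<Rightarrow> 'a \<Rightarrow> 'a \<Rightarrow> int" where
  "star_part E a b c d e f =
    (let sq = (\<lambda>x y z. ext_form E a b c d x y z e * ext_form E a b c d x y z f) in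
     if star E a b c d
     then if E a c
          then if E a d then 12 * sq 1 1 (- 2) + 36 * sq 1 0 (- 1) + 28 * sq 0 1 (- 1)
               else 128 * sq 1 (- 1) 0 + 248 * sq 1 0 (- 1) + 248 * sq 0 1 (- 1)
          else if E a d then 0
               else 418 * sq 1 (- 1) 0 + 14 * sq 1 1 (- 2)
     else 0)"

text \<open>The root is a nonadjacent pair \<open>ab\<close>, extended by a pair \<open>cd\<close> at least one of whose vertices is
adjacent to neither \<open>a\<close> nor \<open>b\<close>. In the balanced blowup the sum over all pairs \<open>cd\<close> is zero: the
weights 2 and -7 occur with proportions 7/9 and 2/9 if \<open>a, b\<close> are in part 0; the weights 2, -1 and -3
with 4/9, 2/9 and 2/9 if they are in the same other part (1/9 of the pairs get weight 0); and
2, 1 and -5 with the same proportions if exactly one of them is in part 0.\<close>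

definition pair_weight :: "('a \<Rightarrow> 'a \<Rightarrow> bool) \<Rightarrow> 'a \<Rightarrow> 'a \<Rightarrow> 'a \<Rightarrow> 'a \<Rightarrow> int" where
  "pair_weight E a b c d =
    (if E c a \<or> E c b
     then if E d a \<or> E d b then 0
          else if E c a \<and> E c b then if E c d then - 3 else - 1
          else if E c d then - 5 else 1
     else if E d a \<or> E d b
          then if E d a \<and> E d b then if E c d then - 3 else - 1
               else if E c d then - 5 else 1
          else if E c d then - 7 else 2)"

definition pair_part :: "('a \<Rightarrow> 'a \<Rightarrow> bool) \<Rightarrow> 'a \<Rightarrow> 'a \<Rightarrow> 'a \<Rightarrow> 'a \<Rightarrow> 'a \<Rightarrow> 'a \<Rightarrow> int" where
  "pair_part E a b c d e f = (if E a b then 0 else pair_weight E a b c d * pair_weight E a b e f)"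

definition margin :: "('a \<Rightarrow> 'a \<Rightarrow> bool) \<Rightarrow> 'a \<Rightarrow> 'a \<Rightarrow> 'a \<Rightarrow> 'a \<Rightarrow> 'a \<Rightarrow> 'a \<Rightarrow> int" where
  "margin E a b c d e f =
     4 - (if labelled_copy E a b c d e f then 1458 else 0) - (if misplaced E a b c d then 1 else 0)
       - star_part E a b c d e f - pair_part E a b c d e f"

fun picks :: "'a list \<Rightarrow> ('a \<times> 'a list) list" where
  "picks [] = []"
| "picks (x # xs) = (x, xs) # map (\<lambda>(y, ys). (y, x # ys)) (picks xs)"

text \<open>The sum of \<open>h\<close> over all orderings of \<open>n\<close> of the elements of the list, in a form that can be
evaluated.\<close>

fun sum_orders :: "nat \<Rightarrow> ('a list \<Rightarrow> int) \<Rightarrow> 'a list \<Rightarrow> int" where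
  "sum_orders 0 h xs = h []"
| "sum_orders (Suc n) h xs = sum_list (map (\<lambda>(y, ys). sum_orders n (\<lambda>zs. h (y # zs)) ys) (picks xs))"

fun on_list :: "('a \<Rightarrow> 'a \<Rightarrow> 'a \<Rightarrow> 'a \<Rightarrow> 'a \<Rightarrow> 'a \<Rightarrow> int) \<Rightarrow> 'a list \<Rightarrow> int" where
  "on_list h [a, b, c, d, e, f] = h a b c d e f"
| "on_list h _ = 0"

definition edge_loss :: "('a \<Rightarrow> 'a \<Rightarrow> bool) \<Rightarrow> 'a \<Rightarrow> 'a \<Rightarrow> 'a \<Rightarrow> 'a \<Rightarrow> 'a \<Rightarrow> 'a \<Rightarrow> int" where
  "edge_loss E a b c d e f =
     (if labelled_copy E a b c d e f then 1458 else 0)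
     + (if E c d = part_edge (side E a b c) (side E a b d) then 0 else 1)
     + (if E b c then 0 else if E b d then 0 else if E c d then 0 else
        let sq = (\<lambda>x y z. ext_form E a b c d x y z e * ext_form E a b c d x y z f) in
        if E a c
          then if E a d then 12 * sq 1 1 (- 2) + 36 * sq 1 0 (- 1) + 28 * sq 0 1 (- 1)
               else 128 * sq 1 (- 1) 0 + 248 * sq 1 0 (- 1) + 248 * sq 0 1 (- 1)
          else if E a d then 0
               else 418 * sq 1 (- 1) 0 + 14 * sq 1 1 (- 2))"

text \<open>The sum of the margins over the 24 orderings of \<open>p, q, r, s\<close>. An edge \<open>ab\<close> lets one exchange the last
two vertices, and a nonedge has only three essentially different pairings; using this keeps the
evaluation short.\<close>

fun block :: "('a \<Rightarrow> 'a \<Rightarrow> bool) \<Rightarrow> 'a \<Rightarrow> 'a \<Rightarrow> 'a list \<Rightarrow> int" where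
  "block E a b [p, q, r, s] =
    (if E a b then 96 - 2 *
       (edge_loss E a b p q r s + edge_loss E a b p r q s + edge_loss E a b p s q r +
        edge_loss E a b q p r s + edge_loss E a b q r p s + edge_loss E a b q s p r +
        edge_loss E a b r p q s + edge_loss E a b r q p s + edge_loss E a b r s p q +
        edge_loss E a b s p q r + edge_loss E a b s q p r + edge_loss E a b s r p q)
     else 96 - 8 *
       (pair_weight E a b p q * pair_weight E a b r s + pair_weight E a b p r * pair_weight E a b q s +
        pair_weight E a b p s * pair_weight E a b q r))"
| "block E a b _ = 0"

definition sum_blocks :: "('a \<Rightarrow> 'a \<Rightarrow> bool) \<Rightarrow> 'a list \<Rightarrow> int" where
  "sum_blocks E xs =
     sum_list (map (\<lambda>(a, ys). sum_list (map (\<lambda>(b, zs). block E a b zs) (picks ys))) (picks xs))"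

datatype ix = I0 | I1 | I2 | I3 | I4 | I5
text \<open>A vertex of a concrete graph carries its own row of the adjacency matrix, so that adjacency is decided
in a single rewriting step.\<close>

datatype vertex = Vertex ix bool bool bool bool bool bool

fun adj6 :: "vertex \<Rightarrow> vertex \<Rightarrow> bool" where
  "adj6 (Vertex _ a _ _ _ _ _) (Vertex I0 _ _ _ _ _ _) = a"
| "adj6 (Vertex _ _ b _ _ _ _) (Vertex I1 _ _ _ _ _ _) = b"
| "adj6 (Vertex _ _ _ c _ _ _) (Vertex I2 _ _ _ _ _ _) = c"
| "adj6 (Vertex _ _ _ _ d _ _) (Vertex I3 _ _ _ _ _ _) = d"
| "adj6 (Vertex _ _ _ _ _ e _) (Vertex I4 _ _ _ _ _ _) = e"
| "adj6 (Vertex _ _ _ _ _ _ f) (Vertex I5 _ _ _ _ _ _) = f"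

definition vertices6 where
  "vertices6 b01 b02 b12 b03 b13 b23 b04 b14 b24 b34 b05 b15 b25 b35 b45 =
    [Vertex I0 False b01 b02 b03 b04 b05, Vertex I1 b01 False b12 b13 b14 b15,
     Vertex I2 b02 b12 False b23 b24 b25, Vertex I3 b03 b13 b23 False b34 b35,
     Vertex I4 b04 b14 b24 b34 False b45, Vertex I5 b05 b15 b25 b35 b45 False]"

text \<open>Lexicographic order, with \<open>False\<close> below \<open>True\<close>. It is used to restrict the verification to
one or a few orderings of each six-vertex graph.\<close>

fun lex_le :: "bool list \<Rightarrow> bool list \<Rightarrow> bool" where
  "lex_le (x # xs) (y # ys) = (if x = y then lex_le xs ys else y)"
| "lex_le _ _ = True"

text \<open>A quantifier over the two truth values that rewriting expands one branch at a time.\<close>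

definition both :: "(bool \<Rightarrow> bool) \<Rightarrow> bool" where
  "both P \<longleftrightarrow> P False \<and> P True"

text \<open>The finite core of the upper bound. Vertices are added one at a time, and a partial graph is pursued
only if swapping two consecutive vertices does not make the adjacency matrix lexicographically smaller;
325 of the 32768 labelled graphs are left. Disjunctions are used instead of implications because rewriting
does not evaluate their second half before the first is false.\<close>

lemma sum_blocks_check:
 "both (\<lambda>b01. both (\<lambda>b02. both (\<lambda>b12. 
    \<not> (lex_le [b02] [b12] \<and>
      lex_le [b01] [b02]) \<or>
    both (\<lambda>b03. both (\<lambda>b13. both (\<lambda>b23. 
    \<not> (lex_le [b02, b03] [b12, b13] \<and>
      lex_le [b01, b13] [b02, b23] \<and>
      lex_le [b02, b12] [b03, b13]) \<or>
    both (\<lambda>b04. both (\<lambda>b14. both (\<lambda>b24. both (\<lambda>b34. 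
    \<not> (lex_le [b02, b03, b04] [b12, b13, b14] \<and>
      lex_le [b01, b13, b14] [b02, b23, b24] \<and>
      lex_le [b02, b12, b24] [b03, b13, b34] \<and>
      lex_le [b03, b13, b23] [b04, b14, b24]) \<or>
    both (\<lambda>b05. both (\<lambda>b15. both (\<lambda>b25. both (\<lambda>b35. both (\<lambda>b45. 
    \<not> (lex_le [b02, b03, b04, b05] [b12, b13, b14, b15] \<and>
      lex_le [b01, b13, b14, b15] [b02, b23, b24, b25] \<and>
      lex_le [b02, b12, b24, b25] [b03, b13, b34, b35] \<and>
      lex_le [b03, b13, b23, b35] [b04, b14, b24, b45] \<and>
      lex_le [b04, b14, b24, b34] [b05, b15, b25, b35]) \<or>
    0 \<le> sum_blocks adj6 (vertices6 b01 b02 b12 b03 b13 b23 b04 b14 b24 b34 b05 b15 b25 b35 b45))))))))))))))))"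
  by code_simp

lemma both_iff: "both P \<longleftrightarrow> (\<forall>b. P b)"
  by (metis (full_types) both_def)

text \<open>The conditions at the earlier stages of the enumeration are truncations of those at the last stage.\<close>

lemma sum_blocks_nonneg:
  assumes "lex_le [b02, b03, b04, b05] [b12, b13, b14, b15]"
    and "lex_le [b01, b13, b14, b15] [b02, b23, b24, b25]"
    and "lex_le [b02, b12, b24, b25] [b03, b13, b34, b35]"
    and "lex_le [b03, b13, b23, b35] [b04, b14, b24, b45]"
    and "lex_le [b04, b14, b24, b34] [b05, b15, b25, b35]"
  shows "0 \<le> sum_blocks adj6 (vertices6 b01 b02 b12 b03 b13 b23 b04 b14 b24 b34 b05 b15 b25 b35 b45)"
proof -
  have three: "lex_le [b02] [b12] \<and> lex_le [b01] [b02]"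
    using assms(1,2) by (auto split: if_splits)
  have four: "lex_le [b02, b03] [b12, b13] \<and> lex_le [b01, b13] [b02, b23] \<and> lex_le [b02, b12] [b03, b13]"
    using assms(1,2,3) by (auto split: if_splits)
  have five: "lex_le [b02, b03, b04] [b12, b13, b14] \<and> lex_le [b01, b13, b14] [b02, b23, b24] \<and>
      lex_le [b02, b12, b24] [b03, b13, b34] \<and> lex_le [b03, b13, b23] [b04, b14, b24]"
    using assms(1,2,3,4) by (auto split: if_splits)
  show ?thesis
    by (rule sum_blocks_check[unfolded both_iff imp_conv_disj[symmetric],
          THEN spec[of _ b01], THEN spec[of _ b02], THEN spec[of _ b12], THEN mp, OF three,
          THEN spec[of _ b03], THEN spec[of _ b13], THEN spec[of _ b23], THEN mp, OF four,
          THEN spec[of _ b04], THEN spec[of _ b14], THEN spec[of _ b24], THEN spec[of _ b34],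
          THEN mp, OF five,
          THEN spec[of _ b05], THEN spec[of _ b15], THEN spec[of _ b25], THEN spec[of _ b35],
          THEN spec[of _ b45], THEN mp])
       (use assms in blast)
qed

text \<open>Reading a list as a binary number turns the lexicographic order into an order on numbers, so that a
least ordering exists.\<close>

fun bits_val :: "bool list \<Rightarrow> nat" where
  "bits_val [] = 0"
| "bits_val (b # bs) = of_bool b * 2 ^ length bs + bits_val bs"

lemma bits_val_less: "bits_val bs < 2 ^ length bs"
  by (induction bs) auto

lemma lex_le_if_bits_val_le:
  "length xs = length ys \<Longrightarrow> bits_val xs \<le> bits_val ys \<Longrightarrow> lex_le xs ys"
proof (induction xs ys rule: list_induct2)
  case (Cons x xs y ys)
  then show ?case
    using bits_val_less[of ys] bits_val_less[of xs] by (cases x; cases y) auto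
qed auto

definition code6 :: "('a \<Rightarrow> 'a \<Rightarrow> bool) \<Rightarrow> 'a \<Rightarrow> 'a \<Rightarrow> 'a \<Rightarrow> 'a \<Rightarrow> 'a \<Rightarrow> 'a \<Rightarrow> bool list" where
  "code6 E a b c d e f = [E a b, E a c, E b c, E a d, E b d, E c d, E a e, E b e, E c e, E d e,
     E a f, E b f, E c f, E d f, E e f]"

text \<open>Take the ordering of \<open>S\<close> whose adjacency matrix, read column by column, is lexicographically least.
Exchanging two consecutive vertices swaps their rows and changes nothing else, so the row of the first
of them cannot be the larger one.\<close>

lemma ordered_enumeration:
  fixes E :: "'a \<Rightarrow> 'a \<Rightarrow> bool"
  assumes "card S = 6" and sym: "\<And>x y. E x y = E y x"
  obtains a b c d e f where "S = {a, b, c, d, e, f}" "distinct [a, b, c, d, e, f]"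
    "lex_le [E a c, E a d, E a e, E a f] [E b c, E b d, E b e, E b f]"
    "lex_le [E a b, E b d, E b e, E b f] [E a c, E c d, E c e, E c f]"
    "lex_le [E a c, E b c, E c e, E c f] [E a d, E b d, E d e, E d f]"
    "lex_le [E a d, E b d, E c d, E d f] [E a e, E b e, E c e, E e f]"
    "lex_le [E a e, E b e, E c e, E d e] [E a f, E b f, E c f, E d f]"
proof -
  have fin: "finite S" using assms(1) card.infinite by fastforce
  define val where "val xs = (case xs of [a, b, c, d, e, f] \<Rightarrow> bits_val (code6 E a b c d e f) | _ \<Rightarrow> 0)" for xs
  have ne: "permutations_of_set S \<noteq> {}" using fin by simp
  obtain xs where xs: "xs \<in> permutations_of_set S" and min: "\<And>ys. ys \<in> permutations_of_set S \<Longrightarrow> val xs \<le> val ys"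
    using ne ex_has_least_nat[of "\<lambda>xs. xs \<in> permutations_of_set S" _ val] by blast
  have len: "length xs = 6" using xs assms(1) length_finite_permutations_of_set by metis
  then obtain a b c d e f where abc: "xs = [a, b, c, d, e, f]"
    by (auto simp: length_Suc_conv eval_nat_numeral)
  have S: "S = {a, b, c, d, e, f}" and dist: "distinct [a, b, c, d, e, f]"
    using permutations_of_setD[OF xs] abc by auto
  have swap: "lex_le (code6 E a b c d e f) (code6 E a' b' c' d' e' f')"
    if "set [a', b', c', d', e', f'] = S" "distinct [a', b', c', d', e', f']" for a' b' c' d' e' f'
    using min[OF permutations_of_setI[OF that]] by (intro lex_le_if_bits_val_le) (auto simp: code6_def val_def abc)
  show thesis
  proof (rule that[OF S dist])
    show "lex_le [E a c, E a d, E a e, E a f] [E b c, E b d, E b e, E b f]"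
    proof -
      have "lex_le (code6 E a b c d e f) (code6 E b a c d e f)"
        by (rule swap) (use S dist in auto)
      then show ?thesis
        by (auto simp: code6_def sym[of b a] split: if_splits)
    qed
    show "lex_le [E a b, E b d, E b e, E b f] [E a c, E c d, E c e, E c f]"
    proof -
      have "lex_le (code6 E a b c d e f) (code6 E a c b d e f)"
        by (rule swap) (use S dist in auto)
      then show ?thesis
        by (auto simp: code6_def sym[of c b] split: if_splits)
    qed
    show "lex_le [E a c, E b c, E c e, E c f] [E a d, E b d, E d e, E d f]"
    proof -
      have "lex_le (code6 E a b c d e f) (code6 E a b d c e f)"
        by (rule swap) (use S dist in auto)
      then show ?thesis
        by (auto simp: code6_def sym[of d c] split: if_splits)
    qed
    show "lex_le [E a d, E b d, E c d, E d f] [E a e, E b e, E c e, E e f]"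
    proof -
      have "lex_le (code6 E a b c d e f) (code6 E a b c e d f)"
        by (rule swap) (use S dist in auto)
      then show ?thesis
        by (auto simp: code6_def sym[of e d] split: if_splits)
    qed
    show "lex_le [E a e, E b e, E c e, E d e] [E a f, E b f, E c f, E d f]"
    proof -
      have "lex_le (code6 E a b c d e f) (code6 E a b c d f e)"
        by (rule swap) (use S dist in auto)
      then show ?thesis
        by (auto simp: code6_def sym[of f e] split: if_splits)
    qed
  qed
qed

lemma map_fst_picks: "map fst (picks xs) = xs"
  by (induction xs) (auto simp: comp_def case_prod_beta)

lemma picks_rest:
  "(y, ys) \<in> set (picks xs) \<Longrightarrow> distinct xs \<Longrightarrow> distinct ys \<and> set ys = set xs - {y} \<and> Suc (length ys) = length xs"
proof (induction xs arbitrary: y ys)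
  case (Cons x xs)
  show ?case
  proof (cases "(y, ys) = (x, xs)")
    case False
    then obtain zs where zs: "(y, zs) \<in> set (picks xs)" "ys = x # zs" using Cons.prems by auto
    have "y \<in> set xs" using map_fst_picks[of xs] zs(1) by (metis fst_conv image_eqI list.set_map)
    then show ?thesis using Cons.IH[OF zs(1)] Cons.prems(2) zs(2) by auto
  qed (use Cons.prems in auto)
qed auto

lemma sum_permutations_of_set_step:
  fixes h :: "'a list \<Rightarrow> 'b :: comm_monoid_add"
  assumes "finite A" "A \<noteq> {}"
  shows "(\<Sum>ys\<in>permutations_of_set A. h ys) = (\<Sum>y\<in>A. \<Sum>zs\<in>permutations_of_set (A - {y}). h (y # zs))"
proof -
  have "(\<Sum>ys\<in>permutations_of_set A. h ys) = (\<Sum>y\<in>A. \<Sum>ys\<in>(#) y ` permutations_of_set (A - {y}). h ys)"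
    unfolding permutations_of_set_nonempty[OF assms(2)]
    by (rule sum.UNION_disjoint) (use assms in auto)
  also have "\<dots> = (\<Sum>y\<in>A. \<Sum>zs\<in>permutations_of_set (A - {y}). h (y # zs))"
    by (simp add: sum.reindex comp_def)
  finally show ?thesis .
qed

lemma sum_orders_eq:
  "distinct xs \<Longrightarrow> length xs = n \<Longrightarrow> sum_orders n h xs = (\<Sum>ys\<in>permutations_of_set (set xs). h ys)"
proof (induction n arbitrary: h xs)
  case (Suc n)
  define G where "G y = (\<Sum>zs\<in>permutations_of_set (set xs - {y}). h (y # zs))" for y
  have "sum_orders (Suc n) h xs = sum_list (map (\<lambda>p. G (fst p)) (picks xs))"
    unfolding sum_orders.simps
  proof (intro arg_cong[where f = sum_list] map_cong refl)
    fix p assume p: "p \<in> set (picks xs)"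
    obtain y ys where py: "p = (y, ys)" by (cases p)
    have "distinct ys" "set ys = set xs - {y}" "length ys = n"
      using picks_rest[of y ys xs] p py Suc.prems by auto
    then show "(case p of (y, ys) \<Rightarrow> sum_orders n (\<lambda>zs. h (y # zs)) ys) = G (fst p)"
      using Suc.IH[of ys "\<lambda>zs. h (y # zs)"] by (simp add: py G_def)
  qed
  also have "\<dots> = sum_list (map G (map fst (picks xs)))" by (simp add: comp_def)
  also have "\<dots> = (\<Sum>y\<in>set xs. G y)"
    using Suc.prems(1) by (simp add: map_fst_picks sum_list_distinct_conv_sum_set)
  also have "\<dots> = (\<Sum>ys\<in>permutations_of_set (set xs). h ys)"
    unfolding G_def by (rule sum_permutations_of_set_step[symmetric]) (use Suc.prems in auto)
  finally show ?case .
qed auto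

lemma sum_list_picks_cong:
  assumes "distinct xs"
    and "\<And>y ys. y \<in> set xs \<Longrightarrow> distinct ys \<Longrightarrow> set ys = set xs - {y} \<Longrightarrow> Suc (length ys) = length xs \<Longrightarrow> G y ys = H y ys"
  shows "sum_list (map (\<lambda>(y, ys). G y ys) (picks xs)) = sum_list (map (\<lambda>(y, ys). H y ys) (picks xs))"
proof (intro arg_cong[where f = sum_list] map_cong refl)
  fix p assume p: "p \<in> set (picks xs)"
  obtain y ys where py: "p = (y, ys)" by (cases p)
  have "y \<in> set xs" using p map_fst_picks[of xs] py by (metis fst_conv image_eqI list.set_map)
  then show "(case p of (y, ys) \<Rightarrow> G y ys) = (case p of (y, ys) \<Rightarrow> H y ys)"
    using assms(2) picks_rest[of y ys xs] p py assms(1) by simp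
qed

lemma margin_edge: "E a b \<Longrightarrow> margin E a b c d e f = 4 - edge_loss E a b c d e f"
  by (simp add: margin_def edge_loss_def misplaced_def star_part_def star_def pair_part_def Let_def)

lemma margin_nonedge:
  "\<not> E a b \<Longrightarrow> margin E a b c d e f = 4 - pair_weight E a b c d * pair_weight E a b e f"
  by (simp add: margin_def labelled_copy_def misplaced_def star_part_def star_def pair_part_def Let_def)

lemma edge_loss_commute:
  assumes "E e f = E f e"
  shows "edge_loss E a b c d e f = edge_loss E a b c d f e"
proof -
  have "labelled_copy E a b c d e f = labelled_copy E a b c d f e"
    using assms by (auto simp: labelled_copy_def)
  then show ?thesis by (simp add: edge_loss_def Let_def mult.commute)
qed

lemma pair_weight_commute:
  assumes "E c d = E d c"
  shows "pair_weight E a b c d = pair_weight E a b d c"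
  using assms by (auto simp: pair_weight_def)

lemma sum_orders_4: "sum_orders (Suc (Suc (Suc (Suc 0)))) h [p, q, r, s] =
   h [p, q, r, s] + h [p, q, s, r] + h [p, r, q, s] + h [p, r, s, q] + h [p, s, q, r] + h [p, s, r, q] +
   h [q, p, r, s] + h [q, p, s, r] + h [q, r, p, s] + h [q, r, s, p] + h [q, s, p, r] + h [q, s, r, p] +
   h [r, p, q, s] + h [r, p, s, q] + h [r, q, p, s] + h [r, q, s, p] + h [r, s, p, q] + h [r, s, q, p] +
   h [s, p, q, r] + h [s, p, r, q] + h [s, q, p, r] + h [s, q, r, p] + h [s, r, p, q] + h [s, r, q, p]"
  by simp

lemma block_eq:
  assumes sym: "\<And>x y. x \<in> set zs \<Longrightarrow> y \<in> set zs \<Longrightarrow> E x y = E y x" and "length zs = 4"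
  shows "block E a b zs = sum_orders 4 (\<lambda>ws. on_list (margin E) (a # b # ws)) zs"
proof -
  obtain p q r s where zs: "zs = [p, q, r, s]"
    using assms(2) by (auto simp: length_Suc_conv eval_nat_numeral)
  have 4: "(4::nat) = Suc (Suc (Suc (Suc 0)))" by simp
  show ?thesis
  proof (cases "E a b")
    case True
    have c: "edge_loss E a b x y z w = edge_loss E a b x y w z" if "z \<in> set zs" "w \<in> set zs" for x y z w
      using sym[OF that] by (rule edge_loss_commute)
    show ?thesis
      unfolding zs 4 sum_orders_4
      using True c[of s r p q] c[of s q p r] c[of r q p s] c[of s r q p] c[of s p q r] c[of r p q s]
        c[of s q r p] c[of s p r q] c[of q p r s] c[of r q s p] c[of r p s q] c[of q p s r]
      by (simp add: margin_edge zs)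
  next
    case False
    have c: "pair_weight E a b x y = pair_weight E a b y x" if "x \<in> set zs" "y \<in> set zs" for x y
      using sym[OF that] by (rule pair_weight_commute)
    show ?thesis
      unfolding zs 4 sum_orders_4
      using False c[of q p] c[of r p] c[of s p] c[of r q] c[of s q] c[of s r]
      by (simp add: margin_nonedge mult.commute zs)
  qed
qed

lemma sum_blocks_eq:
  assumes sym: "\<And>x y. x \<in> set xs \<Longrightarrow> y \<in> set xs \<Longrightarrow> E x y = E y x"
    and "distinct xs" "length xs = 6"
  shows "sum_blocks E xs = (\<Sum>ys\<in>permutations_of_set (set xs). on_list (margin E) ys)"
proof -
  have "sum_blocks E xs = sum_list (map (\<lambda>(a, ys). sum_list (map (\<lambda>(b, zs).
      sum_orders 4 (\<lambda>ws. on_list (margin E) (a # b # ws)) zs) (picks ys))) (picks xs))"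
    unfolding sum_blocks_def
    by (intro sum_list_picks_cong assms block_eq) (use assms in auto)
  also have "\<dots> = sum_orders (Suc (Suc 4)) (on_list (margin E)) xs"
    unfolding sum_orders.simps ..
  finally show ?thesis using sum_orders_eq[of xs 6] assms by simp
qed

text \<open>Six vertices of any graph can be replaced by the concrete vertices that carry the same adjacency matrix.\<close>

lemma sum_permutations_transport:
  fixes E :: "'a \<Rightarrow> 'a \<Rightarrow> bool" and R :: "('a \<Rightarrow> 'a \<Rightarrow> bool) \<Rightarrow> 'a list \<Rightarrow> int"
    and Q :: "(vertex \<Rightarrow> vertex \<Rightarrow> bool) \<Rightarrow> vertex list \<Rightarrow> int"
  assumes dist: "distinct [a, b, c, d, e, f]"
    and sym: "\<And>x y. E x y = E y x" and irr: "\<And>x. \<not> E x x"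
    and QR: "\<And>p zs. (\<And>i j. i \<in> set zs \<Longrightarrow> j \<in> set zs \<Longrightarrow> adj6 i j = E (p i) (p j)) \<Longrightarrow> R E (map p zs) = Q adj6 zs"
  shows "(\<Sum>xs\<in>permutations_of_set {a, b, c, d, e, f}. R E xs) =
    (\<Sum>zs\<in>permutations_of_set (set (vertices6 (E a b) (E a c) (E b c) (E a d) (E b d) (E c d) (E a e) (E b e) (E c e) (E d e)
      (E a f) (E b f) (E c f) (E d f) (E e f))). Q adj6 zs)"
proof -
  define vs where "vs = vertices6 (E a b) (E a c) (E b c) (E a d) (E b d) (E c d) (E a e) (E b e) (E c e) (E d e)
      (E a f) (E b f) (E c f) (E d f) (E e f)"
  define p where "p = (\<lambda>v. case v of Vertex i _ _ _ _ _ _ \<Rightarrow>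
    (case i of I0 \<Rightarrow> a | I1 \<Rightarrow> b | I2 \<Rightarrow> c | I3 \<Rightarrow> d | I4 \<Rightarrow> e | I5 \<Rightarrow> f))"
  have inj: "inj_on p (set vs)"
    using dist by (auto simp: p_def inj_on_def vs_def vertices6_def)
  have img: "{a, b, c, d, e, f} = p ` set vs"
    by (simp add: p_def vs_def vertices6_def insert_commute)
  have adj: "adj6 i j = E (p i) (p j)" if "i \<in> set vs" "j \<in> set vs" for i j
    using that unfolding vs_def vertices6_def
    by (auto simp: p_def irr sym)
  have "(\<Sum>xs\<in>permutations_of_set {a, b, c, d, e, f}. R E xs) =
    (\<Sum>xs\<in>map p ` permutations_of_set (set vs). R E xs)"
    unfolding img by (subst permutations_of_set_image_inj[OF inj]) simp
  also have "\<dots> = (\<Sum>zs\<in>permutations_of_set (set vs). R E (map p zs))"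
  proof (subst sum.reindex)
    show "inj_on (map p) (permutations_of_set (set vs))"
    proof (rule inj_onI)
      fix xs ys assume "xs \<in> permutations_of_set (set vs)" "ys \<in> permutations_of_set (set vs)" "map p xs = map p ys"
      then show "xs = ys" using inj permutations_of_setD(1) by (metis inj_on_map_eq_map sup.idem)
    qed
  qed (simp add: comp_def)
  also have "\<dots> = (\<Sum>zs\<in>permutations_of_set (set vs). Q adj6 zs)"
    by (intro sum.cong refl QR adj) (auto dest: permutations_of_setD)
  finally show ?thesis unfolding vs_def .
qed

lemma adj6_sym:
  "x \<in> set (vertices6 b01 b02 b12 b03 b13 b23 b04 b14 b24 b34 b05 b15 b25 b35 b45) \<Longrightarrow>
   y \<in> set (vertices6 b01 b02 b12 b03 b13 b23 b04 b14 b24 b34 b05 b15 b25 b35 b45) \<Longrightarrow> adj6 x y = adj6 y x"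
  by (auto simp: vertices6_def)

lemma vertices6_distinct: "distinct (vertices6 b01 b02 b12 b03 b13 b23 b04 b14 b24 b34 b05 b15 b25 b35 b45)"
  "length (vertices6 b01 b02 b12 b03 b13 b23 b04 b14 b24 b34 b05 b15 b25 b35 b45) = 6"
  by (simp_all add: vertices6_def)

lemma on_list_cong:
  assumes "\<And>a b c d e f. {a, b, c, d, e, f} \<subseteq> set zs \<Longrightarrow> h (p a) (p b) (p c) (p d) (p e) (p f) = k a b c d e f"
  shows "on_list h (map p zs) = on_list k zs"
  using assms by (induction k zs rule: on_list.induct) auto

lemmas margin_unfold = margin_def labelled_copy_def misplaced_def side_def star_part_def star_def ext_form_def
  pair_part_def pair_weight_def Let_def

text \<open>Any six vertices have an ordering among those that were verified.\<close>

lemma margin_sum_nonneg: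
  fixes E :: "'a \<Rightarrow> 'a \<Rightarrow> bool"
  assumes "card S = 6" and sym: "\<And>x y. E x y = E y x" and irr: "\<And>x. \<not> E x x"
  shows "0 \<le> (\<Sum>xs\<in>permutations_of_set S. on_list (margin E) xs)"
proof -
  obtain a b c d e f where S: "S = {a, b, c, d, e, f}" and dist: "distinct [a, b, c, d, e, f]"
    and ord: "lex_le [E a c, E a d, E a e, E a f] [E b c, E b d, E b e, E b f]"
    "lex_le [E a b, E b d, E b e, E b f] [E a c, E c d, E c e, E c f]"
    "lex_le [E a c, E b c, E c e, E c f] [E a d, E b d, E d e, E d f]"
    "lex_le [E a d, E b d, E c d, E d f] [E a e, E b e, E c e, E e f]"
    "lex_le [E a e, E b e, E c e, E d e] [E a f, E b f, E c f, E d f]"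
    using ordered_enumeration[of S E, OF assms(1) sym] by metis
  let ?vs = "vertices6 (E a b) (E a c) (E b c) (E a d) (E b d) (E c d) (E a e) (E b e) (E c e) (E d e)
      (E a f) (E b f) (E c f) (E d f) (E e f)"
  have "(\<Sum>xs\<in>permutations_of_set S. on_list (margin E) xs) =
    (\<Sum>zs\<in>permutations_of_set (set ?vs). on_list (margin adj6) zs)"
    unfolding S
  proof (rule sum_permutations_transport[OF dist sym irr, where R = "\<lambda>E. on_list (margin E)" and Q = "\<lambda>E. on_list (margin E)"])
    fix p :: "vertex \<Rightarrow> 'a" and zs
    assume "\<And>i j. i \<in> set zs \<Longrightarrow> j \<in> set zs \<Longrightarrow> adj6 i j = E (p i) (p j)"
    then show "on_list (margin E) (map p zs) = on_list (margin adj6) zs"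
      by (intro on_list_cong) (simp add: margin_unfold split del: if_split cong: if_cong)
  qed
  also have "\<dots> = sum_blocks adj6 ?vs"
    by (rule sum_blocks_eq[symmetric]) (rule adj6_sym vertices6_distinct; assumption?)+
  also have "0 \<le> \<dots>" by (rule sum_blocks_nonneg[OF ord])
  finally show ?thesis .
qed

lemma labelled_copy_count_self:
  "sum_orders 6 (on_list (\<lambda>a b c d e f. if labelled_copy adj6 a b c d e f then 1 else 0))
     (vertices6 True False True True False True False False False False False False False False False) = 16"
  by code_simp

text \<open>The automorphism group of \<open>F14\<close> has order 16.\<close>

lemma labelled_copy_sum:
  fixes E :: "'a \<Rightarrow> 'a \<Rightarrow> bool"
  assumes "labelled_copy E a b c d e f" and dist: "distinct [a, b, c, d, e, f]"
    and sym: "\<And>x y. E x y = E y x" and irr: "\<And>x. \<not> E x x"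
  shows "(\<Sum>xs\<in>permutations_of_set {a, b, c, d, e, f}.
           on_list (\<lambda>a b c d e f. if labelled_copy E a b c d e f then 1 else 0) xs) = 16"
proof -
  let ?vs = "vertices6 (E a b) (E a c) (E b c) (E a d) (E b d) (E c d) (E a e) (E b e) (E c e) (E d e)
      (E a f) (E b f) (E c f) (E d f) (E e f)"
  have "(\<Sum>xs\<in>permutations_of_set {a, b, c, d, e, f}.
           on_list (\<lambda>a b c d e f. if labelled_copy E a b c d e f then 1 else 0) xs) =
    (\<Sum>zs\<in>permutations_of_set (set ?vs). on_list (\<lambda>a b c d e f. if labelled_copy adj6 a b c d e f then 1 else 0) zs)"
  proof (rule sum_permutations_transport[OF dist sym irr,
      where R = "\<lambda>E. on_list (\<lambda>a b c d e f. if labelled_copy E a b c d e f then 1 else 0)"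
        and Q = "\<lambda>E. on_list (\<lambda>a b c d e f. if labelled_copy E a b c d e f then 1 else 0)"])
    fix p :: "vertex \<Rightarrow> 'a" and zs
    assume "\<And>i j. i \<in> set zs \<Longrightarrow> j \<in> set zs \<Longrightarrow> adj6 i j = E (p i) (p j)"
    then show "on_list (\<lambda>a b c d e f. if labelled_copy E a b c d e f then 1 else 0) (map p zs) =
        on_list (\<lambda>a b c d e f. if labelled_copy adj6 a b c d e f then 1 else 0) zs"
      by (intro on_list_cong) (simp add: labelled_copy_def split del: if_split cong: if_cong)
  qed
  also have "\<dots> = sum_orders 6 (on_list (\<lambda>a b c d e f. if labelled_copy adj6 a b c d e f then 1 else 0)) ?vs"
    by (rule sum_orders_eq[symmetric]) (rule vertices6_distinct)+
  also have "?vs = vertices6 True False True True False True False False False False False False False False False"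
    using assms(1) sym unfolding labelled_copy_def by auto
  finally show ?thesis using labelled_copy_count_self by simp
qed

section \<open>From six vertices to large graphs\<close>

definition tuples :: "'a set \<Rightarrow> nat \<Rightarrow> 'a list set" where
  "tuples V k = {xs. set xs \<subseteq> V \<and> length xs = k}"

lemma finite_tuples: "finite V \<Longrightarrow> finite (tuples V k)"
  unfolding tuples_def by (rule finite_lists_length_eq)

lemma tuples_0: "tuples V 0 = {[]}"
  by (auto simp: tuples_def)

lemma tuples_Suc: "tuples V (Suc k) = (\<lambda>(x, xs). x # xs) ` (V \<times> tuples V k)"
  by (auto simp: tuples_def length_Suc_conv image_iff)

lemma sum_tuples_Suc:
  "(\<Sum>xs\<in>tuples V (Suc k). f xs) = (\<Sum>x\<in>V. \<Sum>xs\<in>tuples V k. f (x # xs))"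
  unfolding tuples_Suc
  by (subst sum.reindex) (auto simp: inj_on_def sum.cartesian_product case_prod_beta comp_def)

lemma sum_tuples_6:
  "(\<Sum>xs\<in>tuples V 6. on_list h xs) =
   (\<Sum>a\<in>V. \<Sum>b\<in>V. \<Sum>c\<in>V. \<Sum>d\<in>V. \<Sum>e\<in>V. \<Sum>f\<in>V. h a b c d e f)"
  by (simp add: eval_nat_numeral sum_tuples_Suc tuples_0)

text \<open>The error term of the whole argument: only \<open>O(n\<^sup>5)\<close> of the \<open>n\<^sup>6\<close> tuples repeat a vertex. Such
a tuple repeats its first entry later or has a repetition in its tail.\<close>

lemma card_repeating_tuples:
  assumes "finite V"
  shows "card {xs \<in> tuples V k. \<not> distinct xs} \<le> k * k * card V ^ (k - 1)"
proof (induction k)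
  case 0
  then show ?case by (simp add: tuples_0)
next
  case (Suc k)
  let ?n = "card V"
  have "{xs \<in> tuples V (Suc k). \<not> distinct xs} \<subseteq>
      (\<Union>ys\<in>tuples V k. (\<lambda>x. x # ys) ` set ys) \<union>
      (\<lambda>(x, ys). x # ys) ` (V \<times> {ys \<in> tuples V k. \<not> distinct ys})" (is "_ \<subseteq> ?A \<union> ?B")
  proof
    fix xs assume xs: "xs \<in> {xs \<in> tuples V (Suc k). \<not> distinct xs}"
    then obtain x ys where x: "xs = x # ys" "x \<in> V" "ys \<in> tuples V k" by (auto simp: tuples_Suc)
    show "xs \<in> ?A \<union> ?B"
    proof (cases "x \<in> set ys")
      case True
      then show ?thesis using x by blast
    next
      case False
      then have "\<not> distinct ys" using xs x(1) by simp
      then show ?thesis using x by (auto simp: image_iff)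
    qed
  qed
  then have "card {xs \<in> tuples V (Suc k). \<not> distinct xs} \<le> card (?A \<union> ?B)"
    using assms by (intro card_mono) (auto simp: finite_tuples)
  also have "\<dots> \<le> card ?A + card ?B" by (rule card_Un_le)
  also have "card ?A \<le> (\<Sum>ys\<in>tuples V k. card ((\<lambda>x. x # ys) ` set ys))"
    by (intro card_UN_le finite_tuples assms)
  also have "\<dots> \<le> (\<Sum>ys\<in>tuples V k. k)"
    by (intro sum_mono order.trans[OF card_image_le]) (auto simp: tuples_def card_length)
  also have "\<dots> = k * ?n ^ k"
    using assms by (simp add: tuples_def card_lists_length_eq)
  also have "card ?B \<le> card (V \<times> {ys \<in> tuples V k. \<not> distinct ys})"
    using assms by (intro card_image_le) (auto simp: finite_tuples)
  also have "\<dots> \<le> ?n * (k * k * ?n ^ (k - 1))"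
    using Suc by (simp add: card_cartesian_product)
  also have "k * ?n ^ k + ?n * (k * k * ?n ^ (k - 1)) \<le> Suc k * Suc k * ?n ^ (Suc k - 1)"
    by (cases k) (auto simp: algebra_simps)
  finally show ?case by simp
qed

lemma sum_distinct_tuples:
  fixes f :: "'a list \<Rightarrow> int"
  assumes "finite V"
  shows "(\<Sum>xs | xs \<in> tuples V k \<and> distinct xs. f xs) =
    (\<Sum>S | S \<subseteq> V \<and> card S = k. \<Sum>xs\<in>permutations_of_set S. f xs)"
proof -
  have eq: "{xs. xs \<in> tuples V k \<and> distinct xs} = (\<Union>S\<in>{S. S \<subseteq> V \<and> card S = k}. permutations_of_set S)"
    by (auto simp: tuples_def permutations_of_set_def distinct_card)
  show ?thesis unfolding eq
  proof (rule sum.UNION_disjoint)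
    show "finite {S. S \<subseteq> V \<and> card S = k}"
      by (rule finite_subset[of _ "Pow V"]) (use assms in auto)
  qed (auto dest: permutations_of_setD(1))
qed

definition copies :: "'a set \<Rightarrow> ('a \<Rightarrow> 'a \<Rightarrow> bool) \<Rightarrow> 'a set set" where
  "copies V E = {S. S \<subseteq> V \<and> card S = 6 \<and>
     (\<exists>a b c d e f. S = {a, b, c, d, e, f} \<and> labelled_copy E a b c d e f)}"

text \<open>The ordered pairs whose adjacency has to be changed to turn \<open>E\<close> into the blowup with classes \<open>cl\<close>.
Every edit is counted twice.\<close>

definition wrong :: "'a set \<Rightarrow> ('a \<Rightarrow> 'a \<Rightarrow> bool) \<Rightarrow> ('a \<Rightarrow> nat) \<Rightarrow> ('a \<times> 'a) set" where
  "wrong V E cl = {(u, v) \<in> V \<times> V. E u v \<noteq> part_edge (cl u) (cl v)}"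

lemma distinct_if_card_6: "card {a, b, c, d, e, f} = 6 \<Longrightarrow> distinct [a, b, c, d, e, f]"
  by (rule card_distinct) (simp del: distinct.simps)

lemma finite_copies: "finite V \<Longrightarrow> finite (copies V E)"
  unfolding copies_def by (rule finite_subset[of _ "Pow V"]) auto

abbreviation labelled_copy_ind :: "('a \<Rightarrow> 'a \<Rightarrow> bool) \<Rightarrow> 'a \<Rightarrow> 'a \<Rightarrow> 'a \<Rightarrow> 'a \<Rightarrow> 'a \<Rightarrow> 'a \<Rightarrow> int" where
  "labelled_copy_ind E a b c d e f \<equiv> (if labelled_copy E a b c d e f then 1 else 0)"

lemma on_list_ge:
  "(\<And>a b c d e f. l \<le> h a b c d e f) \<Longrightarrow> l \<le> 0 \<Longrightarrow> l \<le> on_list h xs"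
  by (induction h xs rule: on_list.induct) auto

text \<open>Only the labellings by distinct vertices are counted on the left.\<close>

lemma copies_le_labelled:
  fixes E :: "'a \<Rightarrow> 'a \<Rightarrow> bool"
  assumes "finite V" and sym: "\<And>x y. E x y = E y x" and irr: "\<And>x. \<not> E x x"
  shows "16 * int (card (copies V E)) \<le> (\<Sum>xs\<in>tuples V 6. on_list (labelled_copy_ind E) xs)"
proof -
  have nonneg: "0 \<le> on_list (labelled_copy_ind E) xs" for xs
    by (rule on_list_ge) auto
  have "16 * int (card (copies V E)) = (\<Sum>S\<in>copies V E. \<Sum>xs\<in>permutations_of_set S. on_list (labelled_copy_ind E) xs)"
  proof -
    have "(\<Sum>xs\<in>permutations_of_set S. on_list (labelled_copy_ind E) xs) = 16" if S_copy: "S \<in> copies V E" for S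
    proof -
      obtain a b c d e f where S: "S = {a, b, c, d, e, f}" "labelled_copy E a b c d e f" "card S = 6"
        using S_copy unfolding copies_def mem_Collect_eq by (elim conjE exE) (rule that)
      show ?thesis unfolding S(1)
        by (rule labelled_copy_sum[OF S(2) distinct_if_card_6[OF S(3)[unfolded S(1)]] sym irr])
    qed
    then show ?thesis by simp
  qed
  also have "\<dots> \<le> (\<Sum>S | S \<subseteq> V \<and> card S = 6. \<Sum>xs\<in>permutations_of_set S. on_list (labelled_copy_ind E) xs)"
    by (rule sum_mono2) (use assms nonneg in \<open>auto simp: copies_def intro!: sum_nonneg\<close>)
  also have "\<dots> = (\<Sum>xs | xs \<in> tuples V 6 \<and> distinct xs. on_list (labelled_copy_ind E) xs)"
    by (rule sum_distinct_tuples[symmetric]) fact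
  also have "\<dots> \<le> (\<Sum>xs\<in>tuples V 6. on_list (labelled_copy_ind E) xs)"
    by (rule sum_mono2) (use assms nonneg in \<open>auto simp: finite_tuples\<close>)
  finally show ?thesis .
qed

text \<open>The double sum over \<open>e\<close> and \<open>f\<close> turns each product of a form with itself into a square.\<close>

lemma star_part_sum_nonneg: "0 \<le> (\<Sum>e\<in>V. \<Sum>f\<in>V. star_part E a b c d e f)"
  by (cases "star E a b c d"; cases "E a c"; cases "E a d")
    (simp_all add: star_part_def Let_def sum.distrib sum_distrib_left[symmetric] sum_distrib_right[symmetric]
      add_nonneg_nonneg)

lemma pair_part_sum_nonneg: "0 \<le> (\<Sum>c\<in>V. \<Sum>d\<in>V. \<Sum>e\<in>V. \<Sum>f\<in>V. pair_part E a b c d e f)"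
proof -
  have "(\<Sum>c\<in>V. \<Sum>d\<in>V. \<Sum>e\<in>V. \<Sum>f\<in>V. pair_weight E a b c d * pair_weight E a b e f) =
      (\<Sum>c\<in>V. \<Sum>d\<in>V. pair_weight E a b c d)\<^sup>2"
    by (simp only: power2_eq_square sum_distrib_left[symmetric] sum_distrib_right[symmetric])
  then show ?thesis by (cases "E a b") (simp_all add: pair_part_def)
qed

lemma margin_lower_bound: "- 5000 \<le> margin E a b c d e f"
proof -
  have ext_form: "\<bar>ext_form E a b c d x y z v\<bar> \<le> 2" if "\<bar>x\<bar> \<le> 2" "\<bar>y\<bar> \<le> 2" "\<bar>z\<bar> \<le> 2" for x y z v
    using that by (auto simp: ext_form_def)
  have prod: "ext_form E a b c d x y z e * ext_form E a b c d x y z f \<le> 4"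
    if "\<bar>x\<bar> \<le> 2" "\<bar>y\<bar> \<le> 2" "\<bar>z\<bar> \<le> 2" for x y z
  proof -
    have "\<bar>ext_form E a b c d x y z e\<bar> * \<bar>ext_form E a b c d x y z f\<bar> \<le> 2 * 2"
      using ext_form[OF that] by (intro mult_mono) auto
    then show ?thesis
      using abs_mult[of "ext_form E a b c d x y z e" "ext_form E a b c d x y z f"] by linarith
  qed
  have "star_part E a b c d e f \<le> 3000"
    using prod[of 1 1 "-2"] prod[of 1 0 "-1"] prod[of 0 1 "-1"] prod[of 1 "-1" 0]
    by (simp add: star_part_def Let_def)
  moreover have "pair_part E a b c d e f \<le> 49"
  proof -
    have w: "\<bar>pair_weight E a b x y\<bar> \<le> 7" for x y by (simp add: pair_weight_def)
    have "\<bar>pair_weight E a b c d\<bar> * \<bar>pair_weight E a b e f\<bar> \<le> 7 * 7"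
      by (intro mult_mono w) auto
    then have "pair_weight E a b c d * pair_weight E a b e f \<le> 49"
      using abs_mult[of "pair_weight E a b c d" "pair_weight E a b e f"] by linarith
    then show ?thesis by (simp add: pair_part_def)
  qed
  ultimately show ?thesis by (simp add: margin_def)
qed

lemma labelled_le_edges:
  assumes "finite V"
  shows "(\<Sum>xs\<in>tuples V 6. on_list (labelled_copy_ind E) xs) \<le>
    int (card V) ^ 4 * (\<Sum>a\<in>V. \<Sum>b\<in>V. if E a b then 1 else 0)"
proof -
  have "(\<Sum>xs\<in>tuples V 6. on_list (labelled_copy_ind E) xs) \<le>
    (\<Sum>a\<in>V. \<Sum>b\<in>V. \<Sum>c\<in>V. \<Sum>d\<in>V. \<Sum>e\<in>V. \<Sum>f\<in>V. if E a b then 1 else 0)"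
    unfolding sum_tuples_6 by (intro sum_mono) (auto simp: labelled_copy_def)
  then show ?thesis
    by (simp add: sum_distrib_left power4_eq_xxxx mult.assoc)
qed

lemma sum6_linear:
  fixes s m t p :: "'a \<Rightarrow> 'a \<Rightarrow> 'a \<Rightarrow> 'a \<Rightarrow> 'a \<Rightarrow> 'a \<Rightarrow> int"
  shows "(\<Sum>a\<in>V. \<Sum>b\<in>V. \<Sum>c\<in>V. \<Sum>d\<in>V. \<Sum>e\<in>V. \<Sum>f\<in>V.
      4 - 1458 * s a b c d e f - m a b c d e f - t a b c d e f - p a b c d e f) =
    4 * int (card V) ^ 6 - 1458 * (\<Sum>a\<in>V. \<Sum>b\<in>V. \<Sum>c\<in>V. \<Sum>d\<in>V. \<Sum>e\<in>V. \<Sum>f\<in>V. s a b c d e f)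
      - (\<Sum>a\<in>V. \<Sum>b\<in>V. \<Sum>c\<in>V. \<Sum>d\<in>V. \<Sum>e\<in>V. \<Sum>f\<in>V. m a b c d e f)
      - (\<Sum>a\<in>V. \<Sum>b\<in>V. \<Sum>c\<in>V. \<Sum>d\<in>V. \<Sum>e\<in>V. \<Sum>f\<in>V. t a b c d e f)
      - (\<Sum>a\<in>V. \<Sum>b\<in>V. \<Sum>c\<in>V. \<Sum>d\<in>V. \<Sum>e\<in>V. \<Sum>f\<in>V. p a b c d e f)"
  by (simp only: sum_subtractf sum_distrib_left[symmetric] sum_constant) (simp add: eval_nat_numeral)

text \<open>The tuples with distinct entries contribute a nonnegative amount by \<open>margin_sum_nonneg\<close>, and the others
at least \<open>-5000\<close> each. Removing the squares leaves the asserted inequality.\<close>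

lemma certificate:
  fixes E :: "'a \<Rightarrow> 'a \<Rightarrow> bool"
  assumes "finite V" and sym: "\<And>x y. E x y = E y x" and irr: "\<And>x. \<not> E x x"
  defines "n \<equiv> int (card V)"
  shows "23328 * int (card (copies V E)) +
    n\<^sup>2 * (\<Sum>a\<in>V. \<Sum>b\<in>V. if E a b then int (card (wrong V E (side E a b))) else 0)
    \<le> 4 * n ^ 6 + 180000 * n ^ 5"
proof -
  have part: "(\<Sum>xs\<in>tuples V 6. on_list (margin E) xs) =
     (\<Sum>xs | xs \<in> tuples V 6 \<and> distinct xs. on_list (margin E) xs) +
     (\<Sum>xs | xs \<in> tuples V 6 \<and> \<not> distinct xs. on_list (margin E) xs)"
    using assms(1) by (subst sum.union_disjoint[symmetric]) (auto simp: finite_tuples intro!: sum.cong)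
  have "(\<Sum>xs | xs \<in> tuples V 6 \<and> distinct xs. on_list (margin E) xs) \<ge> 0"
    unfolding sum_distinct_tuples[OF assms(1)]
    by (intro sum_nonneg margin_sum_nonneg sym irr) auto
  moreover have "(\<Sum>xs | xs \<in> tuples V 6 \<and> \<not> distinct xs. on_list (margin E) xs) \<ge> - 180000 * n ^ 5"
  proof -
    have low: "- 5000 \<le> on_list (margin E) xs" for xs
      by (rule on_list_ge) (auto simp: margin_lower_bound)
    have "- 180000 * n ^ 5 \<le> - 5000 * int (card {xs \<in> tuples V 6. \<not> distinct xs})"
    proof -
      have "card {xs \<in> tuples V 6. \<not> distinct xs} \<le> 36 * card V ^ 5"
        using card_repeating_tuples[OF assms(1), of 6] by simp
      then have "int (card {xs \<in> tuples V 6. \<not> distinct xs}) \<le> int (36 * card V ^ 5)"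
        by (rule of_nat_mono)
      then have "int (card {xs \<in> tuples V 6. \<not> distinct xs}) \<le> 36 * n ^ 5"
        by (simp add: n_def)
      then show ?thesis by simp
    qed
    also have "\<dots> \<le> (\<Sum>xs | xs \<in> tuples V 6 \<and> \<not> distinct xs. on_list (margin E) xs)"
      using sum_mono[of "{xs \<in> tuples V 6. \<not> distinct xs}" "\<lambda>_. - 5000" "on_list (margin E)"] low by simp
    finally show ?thesis .
  qed
  ultimately have lower: "- 180000 * n ^ 5 \<le> (\<Sum>xs\<in>tuples V 6. on_list (margin E) xs)"
    using part by linarith
  have mis: "(\<Sum>a\<in>V. \<Sum>b\<in>V. \<Sum>c\<in>V. \<Sum>d\<in>V. \<Sum>e\<in>V. \<Sum>f\<in>V. if misplaced E a b c d then 1 else 0) =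
     n\<^sup>2 * (\<Sum>a\<in>V. \<Sum>b\<in>V. if E a b then int (card (wrong V E (side E a b))) else 0)"
  proof -
    have "(\<Sum>c\<in>V. \<Sum>d\<in>V. if misplaced E a b c d then 1 else (0::int)) =
        (if E a b then int (card (wrong V E (side E a b))) else 0)" for a b
    proof (cases "E a b")
      case True
      have "wrong V E (side E a b) =
          {p \<in> V \<times> V. misplaced E a b (fst p) (snd p)}"
        using True by (auto simp: wrong_def misplaced_def)
      then have "int (card (wrong V E (side E a b))) =
          (\<Sum>p\<in>V \<times> V. if misplaced E a b (fst p) (snd p) then 1 else 0)"
        using assms(1) by (simp add: sum.If_cases Int_def)
      then show ?thesis using True by (simp add: sum.cartesian_product case_prod_beta)
    qed (simp add: misplaced_def)
    then show ?thesis
      by (simp add: n_def power2_eq_square sum_distrib_left[symmetric] mult.assoc)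
  qed
  have "(\<Sum>xs\<in>tuples V 6. on_list (margin E) xs) = 4 * n ^ 6
      - 1458 * (\<Sum>xs\<in>tuples V 6. on_list (labelled_copy_ind E) xs)
      - n\<^sup>2 * (\<Sum>a\<in>V. \<Sum>b\<in>V. if E a b then int (card (wrong V E (side E a b))) else 0)
      - (\<Sum>a\<in>V. \<Sum>b\<in>V. \<Sum>c\<in>V. \<Sum>d\<in>V. \<Sum>e\<in>V. \<Sum>f\<in>V. star_part E a b c d e f)
      - (\<Sum>a\<in>V. \<Sum>b\<in>V. \<Sum>c\<in>V. \<Sum>d\<in>V. \<Sum>e\<in>V. \<Sum>f\<in>V. pair_part E a b c d e f)"
  proof -
    have "(\<Sum>xs\<in>tuples V 6. on_list (margin E) xs) =
      (\<Sum>a\<in>V. \<Sum>b\<in>V. \<Sum>c\<in>V. \<Sum>d\<in>V. \<Sum>e\<in>V. \<Sum>f\<in>V. 4 - 1458 * labelled_copy_ind E a b c d e f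
        - (if misplaced E a b c d then 1 else 0) - star_part E a b c d e f - pair_part E a b c d e f)"
      unfolding sum_tuples_6 by (intro sum.cong refl) (simp add: margin_def)
    then show ?thesis
      unfolding mis[symmetric] sum_tuples_6 unfolding n_def sum6_linear .
  qed
  moreover have "0 \<le> (\<Sum>a\<in>V. \<Sum>b\<in>V. \<Sum>c\<in>V. \<Sum>d\<in>V. \<Sum>e\<in>V. \<Sum>f\<in>V. star_part E a b c d e f)"
    by (intro sum_nonneg star_part_sum_nonneg)
  moreover have "0 \<le> (\<Sum>a\<in>V. \<Sum>b\<in>V. \<Sum>c\<in>V. \<Sum>d\<in>V. \<Sum>e\<in>V. \<Sum>f\<in>V. pair_part E a b c d e f)"
    by (intro sum_nonneg pair_part_sum_nonneg)
  moreover note copies_le_labelled[of V E, OF assms(1) sym irr] lower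
  ultimately show ?thesis by linarith
qed

lemma edges_ge_copies:
  fixes E :: "'a \<Rightarrow> 'a \<Rightarrow> bool"
  assumes "finite V" and sym: "\<And>x y. E x y = E y x" and irr: "\<And>x. \<not> E x x"
  shows "16 * int (card (copies V E)) \<le> int (card V) ^ 4 * (\<Sum>a\<in>V. \<Sum>b\<in>V. if E a b then 1 else 0)"
  using copies_le_labelled[of V E, OF assms] labelled_le_edges[OF assms(1), of E] by linarith

text \<open>If all edges suggested bad partitions, then the sum in \<open>certificate\<close> would be large, because a graph
with many copies of \<open>F14\<close> has many edges.\<close>

lemma near_extremal_partition:
  fixes E :: "'a \<Rightarrow> 'a \<Rightarrow> bool" and \<delta> :: real
  assumes "finite V" and sym: "\<And>x y. E x y = E y x" and irr: "\<And>x. \<not> E x x"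
  defines "n \<equiv> real (card V)"
  assumes "n > 0" and "0 \<le> \<delta>" "\<delta> \<le> 1" and near: "23328 * real (card (copies V E)) \<ge> (4 - \<delta>) * n ^ 6"
  shows "\<exists>cl. range cl \<subseteq> {0, 1, 2} \<and> real (card (wrong V E cl)) \<le> 486 * (\<delta> * n\<^sup>2 + 180000 * n)"
proof (rule ccontr)
  assume neg: "\<not> ?thesis"
  define B where "B = 486 * (\<delta> * n\<^sup>2 + 180000 * n)"
  define e where "e = real_of_int (\<Sum>a\<in>V. \<Sum>b\<in>V. if E a b then 1 else 0)"
  have big: "real (card (wrong V E (side E a b))) > B" for a b
  proof -
    have "range (side E a b) \<subseteq> {0, 1, 2}" by (auto simp: side_def)
    then show ?thesis using neg unfolding B_def by (meson not_le)
  qed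
  have c: "23328 * real (card (copies V E)) +
    n\<^sup>2 * (\<Sum>a\<in>V. \<Sum>b\<in>V. if E a b then real (card (wrong V E (side E a b))) else 0)
    \<le> 4 * n ^ 6 + 180000 * n ^ 5"
    using certificate[of V E, OF assms(1) sym irr]
    unfolding n_def of_int_le_iff[where 'a = real, symmetric]
    by (simp add: if_distrib[of real_of_int] cong: if_cong)
  have ed: "16 * real (card (copies V E)) \<le> n ^ 4 * e"
    using edges_ge_copies[of V E, OF assms(1) sym irr]
    unfolding n_def e_def of_int_le_iff[where 'a = real, symmetric] by simp
  have "3 * n ^ 6 \<le> (4 - \<delta>) * n ^ 6" using assms by (intro mult_right_mono) auto
  then have "n ^ 6 * (48 / 23328) \<le> n ^ 4 * e" using ed near by simp
  then have "n ^ 4 * (n\<^sup>2 / 486) \<le> n ^ 4 * e" by (simp add: eval_nat_numeral)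
  then have e: "n\<^sup>2 / 486 \<le> e"
    using \<open>n > 0\<close> by (simp only: mult_le_cancel_left_pos zero_less_power)
  then have epos: "e > 0" using \<open>n > 0\<close> by (meson divide_pos_pos less_le_trans zero_less_numeral zero_less_power)
  have "e * B < (\<Sum>a\<in>V. \<Sum>b\<in>V. if E a b then real (card (wrong V E (side E a b))) else 0)"
  proof -
    have ex: "\<exists>a\<in>V. \<exists>b\<in>V. E a b"
    proof (rule ccontr)
      assume "\<not> ?thesis"
      then have "e = 0" by (simp add: e_def)
      then show False using epos by simp
    qed
    then obtain a0 b0 where ab: "a0 \<in> V" "b0 \<in> V" "E a0 b0" by blast
    have "e * B = (\<Sum>a\<in>V. \<Sum>b\<in>V. if E a b then B else 0)"
      by (simp add: e_def sum_distrib_right if_distrib[of real_of_int] cong: if_cong)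
        (intro sum.cong refl, simp add: sum_distrib_right)
    also have "\<dots> < (\<Sum>a\<in>V. \<Sum>b\<in>V. if E a b then real (card (wrong V E (side E a b))) else 0)"
    proof (rule sum_strict_mono_ex1[OF assms(1)])
      show "\<exists>a\<in>V. (\<Sum>b\<in>V. if E a b then B else 0) < (\<Sum>b\<in>V. if E a b then real (card (wrong V E (side E a b))) else 0)"
      proof (rule bexI[OF _ ab(1)], rule sum_strict_mono_ex1[OF assms(1)])
        show "\<exists>b\<in>V. (if E a0 b then B else 0) < (if E a0 b then real (card (wrong V E (side E a0 b))) else 0)"
          using ab big by (intro bexI[of _ b0]) auto
      qed (auto intro: less_imp_le big)
    qed (intro ballI sum_mono, simp add: less_imp_le big)
    finally show ?thesis .
  qed
  then have "n\<^sup>2 * (e * B) < n\<^sup>2 * (\<Sum>a\<in>V. \<Sum>b\<in>V. if E a b then real (card (wrong V E (side E a b))) else 0)"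
    using \<open>n > 0\<close> by simp
  then have "n\<^sup>2 * (e * B) < \<delta> * n ^ 6 + 180000 * n ^ 5" using c near by (simp add: algebra_simps)
  moreover have "\<delta> * n ^ 6 + 180000 * n ^ 5 = n\<^sup>2 * (n\<^sup>2 / 486 * B)"
    by (simp add: B_def field_simps eval_nat_numeral)
  ultimately have "n\<^sup>2 * (e * B) < n\<^sup>2 * (n\<^sup>2 / 486 * B)" by linarith
  then have "e * B < n\<^sup>2 / 486 * B"
    using \<open>n > 0\<close> by (simp only: mult_less_cancel_left_pos zero_less_power)
  (* Together with e >= n^2/486 this contradicts the previous inequality. *)
  moreover have "B \<ge> 0" using assms by (simp add: B_def)
  ultimately show False using e mult_right_mono[of "n\<^sup>2 / 486" e B] by linarith
qed

section \<open>Copies in blowups\<close>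

abbreviation blow :: "('a \<Rightarrow> nat) \<Rightarrow> 'a \<Rightarrow> 'a \<Rightarrow> bool" where
  "blow cl u v \<equiv> part_edge (cl u) (cl v)"

lemma part_edge_commute: "part_edge i j = part_edge j i"
  by (auto simp: part_edge_def)

lemma part_edge_irrefl: "\<not> part_edge i i"
  by (auto simp: part_edge_def)

definition cell :: "'a set \<Rightarrow> ('a \<Rightarrow> nat) \<Rightarrow> nat \<Rightarrow> 'a set" where
  "cell V cl i = {v \<in> V. cl v = i}"

definition two_subsets :: "'a set \<Rightarrow> 'a set set" where
  "two_subsets X = {P. P \<subseteq> X \<and> card P = 2}"

definition join3 :: "'a set set \<Rightarrow> 'a set set \<Rightarrow> 'a set set \<Rightarrow> 'a set set" where
  "join3 P Q R = (\<lambda>(X, Y, Z). X \<union> Y \<union> Z) ` (P \<times> Q \<times> R)"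

lemma join3I: "X \<in> P \<Longrightarrow> Y \<in> Q \<Longrightarrow> Z \<in> R \<Longrightarrow> X \<union> Y \<union> Z \<in> join3 P Q R"
  unfolding join3_def by (rule image_eqI[of _ _ "(X, Y, Z)"]) auto

lemma join3E:
  assumes "S \<in> join3 P Q R"
  obtains X Y Z where "S = X \<union> Y \<union> Z" "X \<in> P" "Y \<in> Q" "Z \<in> R"
  using assms unfolding join3_def by auto

lemma card_join3_le: "finite P \<Longrightarrow> finite Q \<Longrightarrow> finite R \<Longrightarrow> card (join3 P Q R) \<le> card P * card Q * card R"
  unfolding join3_def
  by (rule order.trans[OF card_image_le]) (auto simp: card_cartesian_product mult.assoc)

lemma card_join3:
  assumes "P \<subseteq> Pow A" "Q \<subseteq> Pow B" "R \<subseteq> Pow C" "A \<inter> B = {}" "A \<inter> C = {}" "B \<inter> C = {}"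
  shows "card (join3 P Q R) = card P * card Q * card R"
proof -
  have "inj_on (\<lambda>(X, Y, Z). X \<union> Y \<union> Z) (P \<times> Q \<times> R)"
  proof (rule inj_onI, clarify)
    fix X Y Z X' Y' Z'
    assume mem: "X \<in> P" "Y \<in> Q" "Z \<in> R" "X' \<in> P" "Y' \<in> Q" "Z' \<in> R"
      and eq: "X \<union> Y \<union> Z = X' \<union> Y' \<union> Z'"
    have sub: "X \<subseteq> A" "Y \<subseteq> B" "Z \<subseteq> C" "X' \<subseteq> A" "Y' \<subseteq> B" "Z' \<subseteq> C"
      using mem assms by auto
    have cut: "(X \<union> Y \<union> Z) \<inter> A = X" "(X' \<union> Y' \<union> Z') \<inter> A = X'"
      "(X \<union> Y \<union> Z) \<inter> B = Y" "(X' \<union> Y' \<union> Z') \<inter> B = Y'"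
      "(X \<union> Y \<union> Z) \<inter> C = Z" "(X' \<union> Y' \<union> Z') \<inter> C = Z'"
      using sub assms(4-6) by blast+
    show "X = X' \<and> (Y, Z) = (Y', Z')"
      using trans[OF cut(1)[symmetric, unfolded eq] cut(2)] trans[OF cut(3)[symmetric, unfolded eq] cut(4)]
        trans[OF cut(5)[symmetric, unfolded eq] cut(6)] by blast
  qed
  then show ?thesis
    unfolding join3_def by (simp add: card_image card_cartesian_product mult.assoc)
qed

lemma two_subsets_iff: "P \<in> two_subsets X \<longleftrightarrow> (\<exists>x y. P = {x, y} \<and> x \<in> X \<and> y \<in> X \<and> x \<noteq> y)"
  by (auto simp: two_subsets_def card_2_iff)

lemma two_subsetsI: "x \<in> X \<Longrightarrow> y \<in> X \<Longrightarrow> x \<noteq> y \<Longrightarrow> {x, y} \<in> two_subsets X"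
  unfolding two_subsets_iff by blast

lemma two_subsets_Pow: "two_subsets X \<subseteq> Pow X"
  by (auto simp: two_subsets_def)

lemma finite_two_subsets: "finite X \<Longrightarrow> finite (two_subsets X)"
  unfolding two_subsets_def by (rule finite_subset[of _ "Pow X"]) auto

lemma card_two_subsets: "finite X \<Longrightarrow> card (two_subsets X) = card X choose 2"
  unfolding two_subsets_def by (rule n_subsets)

lemma card_two_subsets_containing:
  assumes "finite X" "v \<in> X"
  shows "card {P \<in> two_subsets X. v \<in> P} = card X - 1"
proof -
  have "{P \<in> two_subsets X. v \<in> P} = (\<lambda>w. {v, w}) ` (X - {v})"
  proof (intro equalityI subsetI)
    fix P assume "P \<in> {P \<in> two_subsets X. v \<in> P}"
    then obtain x y where P: "P = {x, y}" "x \<in> X" "y \<in> X" "x \<noteq> y" "v = x \<or> v = y"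
      unfolding two_subsets_iff mem_Collect_eq by (elim conjE exE) (rule that, auto)
    from P(5) show "P \<in> (\<lambda>w. {v, w}) ` (X - {v})"
    proof
      assume "v = x"
      then show ?thesis using P by (intro image_eqI[of _ _ y]) simp_all
    next
      assume "v = y"
      then show ?thesis using P by (intro image_eqI[of _ _ x]) (simp_all add: insert_commute)
    qed
  next
    fix P assume "P \<in> (\<lambda>w. {v, w}) ` (X - {v})"
    then obtain w where "w \<in> X" "w \<noteq> v" "P = {v, w}" by blast
    then show "P \<in> {P \<in> two_subsets X. v \<in> P}"
      using assms by (simp add: two_subsetsI)
  qed
  moreover have "inj_on (\<lambda>w. {v, w}) (X - {v})" by (auto simp: inj_on_def doubleton_eq_iff)
  ultimately show ?thesis using assms by (simp add: card_image)
qed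

lemma copies_cong:
  assumes "\<And>u v. u \<in> S \<Longrightarrow> v \<in> S \<Longrightarrow> E u v = F u v"
  shows "S \<in> copies V E \<longleftrightarrow> S \<in> copies V F"
proof -
  have "labelled_copy E a b c d e f = labelled_copy F a b c d e f" if "S = {a, b, c, d, e, f}" for a b c d e f
  proof -
    have "a \<in> S" "b \<in> S" "c \<in> S" "d \<in> S" "e \<in> S" "f \<in> S" using that by simp_all
    then show ?thesis by (simp only: labelled_copy_def assms)
  qed
  then show ?thesis
    unfolding copies_def mem_Collect_eq by (intro conj_cong iff_exI refl)
qed

lemma part_edge_simps:
  "part_edge (Suc 0) j \<longleftrightarrow> j = 2" "part_edge 2 j \<longleftrightarrow> j = Suc 0"
  "part_edge j (Suc 0) \<longleftrightarrow> j = 2" "part_edge j 2 \<longleftrightarrow> j = Suc 0"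
  "\<not> part_edge 0 j" "\<not> part_edge j 0"
  by (auto simp: part_edge_def)

lemma labelled_copy_blow:
  assumes "cl e \<in> {0, 1, 2}" "cl f \<in> {0, 1, 2}"
  shows "labelled_copy (blow cl) a b c d e f \<longleftrightarrow>
    cl e = 0 \<and> cl f = 0 \<and>
    (cl a = 1 \<and> cl c = 1 \<and> cl b = 2 \<and> cl d = 2 \<or> cl a = 2 \<and> cl c = 2 \<and> cl b = 1 \<and> cl d = 1)"
proof
  assume sq: "labelled_copy (blow cl) a b c d e f"
  then have "part_edge (cl a) (cl b)" by (simp add: labelled_copy_def)
  then consider "cl a = Suc 0" "cl b = 2" | "cl a = 2" "cl b = Suc 0"
    by (auto simp: part_edge_def)
  then show "cl e = 0 \<and> cl f = 0 \<and>
    (cl a = 1 \<and> cl c = 1 \<and> cl b = 2 \<and> cl d = 2 \<or> cl a = 2 \<and> cl c = 2 \<and> cl b = 1 \<and> cl d = 1)"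
    by cases (use sq assms in \<open>simp_all add: labelled_copy_def part_edge_simps\<close>)
qed (auto simp: labelled_copy_def part_edge_simps)

text \<open>A copy has two vertices in each part. The edge \<open>ab\<close> of its 4-cycle puts \<open>a\<close> and \<open>b\<close> into parts 1 and
2 in some order, which determines the part of every other vertex.\<close>

lemma copies_blow:
  assumes "cl ` V \<subseteq> {0, 1, 2}"
  shows "copies V (blow cl) =
    join3 (two_subsets (cell V cl 0)) (two_subsets (cell V cl 1)) (two_subsets (cell V cl 2))"
    (is "_ = ?R")
proof
  show "copies V (blow cl) \<subseteq> ?R"
  proof
    fix S assume "S \<in> copies V (blow cl)"
    then obtain a b c d e f where S: "S = {a, b, c, d, e, f}" "S \<subseteq> V" "card S = 6"
        and sq: "labelled_copy (blow cl) a b c d e f"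
      unfolding copies_def mem_Collect_eq by (elim conjE exE) (rule that)
    have dist: "distinct [a, b, c, d, e, f]" using distinct_if_card_6[OF S(3)[unfolded S(1)]] .
    have V: "a \<in> V" "b \<in> V" "c \<in> V" "d \<in> V" "e \<in> V" "f \<in> V" using S(1,2) by auto
    have cls: "cl e = 0" "cl f = 0"
      "cl a = 1 \<and> cl c = 1 \<and> cl b = 2 \<and> cl d = 2 \<or> cl a = 2 \<and> cl c = 2 \<and> cl b = 1 \<and> cl d = 1"
      using sq labelled_copy_blow[of cl e f a b c d] assms V by blast+
    have ef: "{e, f} \<in> two_subsets (cell V cl 0)"
      using V dist cls by (intro two_subsetsI) (auto simp: cell_def)
    from cls(3) show "S \<in> ?R"
    proof
      assume *: "cl a = 1 \<and> cl c = 1 \<and> cl b = 2 \<and> cl d = 2"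
      have "{e, f} \<union> {a, c} \<union> {b, d} \<in> ?R"
        using V dist * by (intro join3I ef two_subsetsI) (auto simp: cell_def)
      also have "{e, f} \<union> {a, c} \<union> {b, d} = S" unfolding S(1) by auto
      finally show ?thesis .
    next
      assume *: "cl a = 2 \<and> cl c = 2 \<and> cl b = 1 \<and> cl d = 1"
      have "{e, f} \<union> {b, d} \<union> {a, c} \<in> ?R"
        using V dist * by (intro join3I ef two_subsetsI) (auto simp: cell_def)
      also have "{e, f} \<union> {b, d} \<union> {a, c} = S" unfolding S(1) by auto
      finally show ?thesis .
    qed
  qed
next
  show "?R \<subseteq> copies V (blow cl)"
  proof
    fix S assume "S \<in> ?R"
    then obtain X Y Z where XYZ: "S = X \<union> Y \<union> Z" "X \<in> two_subsets (cell V cl 0)"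
      "Y \<in> two_subsets (cell V cl 1)" "Z \<in> two_subsets (cell V cl 2)"
      by (rule join3E)
    obtain e f where ef: "X = {e, f}" "e \<in> cell V cl 0" "f \<in> cell V cl 0" "e \<noteq> f"
      using XYZ(2) unfolding two_subsets_iff by blast
    obtain a c where ac: "Y = {a, c}" "a \<in> cell V cl 1" "c \<in> cell V cl 1" "a \<noteq> c"
      using XYZ(3) unfolding two_subsets_iff by blast
    obtain b d where bd: "Z = {b, d}" "b \<in> cell V cl 2" "d \<in> cell V cl 2" "b \<noteq> d"
      using XYZ(4) unfolding two_subsets_iff by blast
    have S: "S = {e, f} \<union> {a, c} \<union> {b, d}" using XYZ(1) ef ac bd by simp
    note m = ef(2-) ac(2-) bd(2-)
    have S': "S = {a, b, c, d, e, f}" unfolding S by auto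
    have "distinct [a, b, c, d, e, f]" using m by (auto simp: cell_def)
    from distinct_card[OF this] have "card S = 6" unfolding S' by simp
    moreover have "labelled_copy (blow cl) a b c d e f" using m by (simp add: cell_def labelled_copy_def part_edge_simps)
    moreover have "S \<subseteq> V" using m unfolding S by (auto simp: cell_def)
    ultimately show "S \<in> copies V (blow cl)"
      using S' unfolding copies_def mem_Collect_eq by (intro conjI exI)
  qed
qed

lemma cell_disjoint: "i \<noteq> j \<Longrightarrow> cell V cl i \<inter> cell V cl j = {}"
  by (auto simp: cell_def)

lemma finite_cell: "finite V \<Longrightarrow> finite (cell V cl i)"
  by (auto simp: cell_def)

lemma card_copies_blow:
  assumes "finite V" "cl ` V \<subseteq> {0, 1, 2}"
  shows "card (copies V (blow cl)) =
    (card (cell V cl 0) choose 2) * (card (cell V cl 1) choose 2) * (card (cell V cl 2) choose 2)"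
  unfolding copies_blow[OF assms(2)]
  by (subst card_join3[OF two_subsets_Pow two_subsets_Pow two_subsets_Pow])
     (simp_all add: cell_disjoint card_two_subsets finite_cell assms)

lemma supersets_join3:
  assumes "cl ` V \<subseteq> {0, 1, 2}" "T \<subseteq> V"
  shows "{S \<in> copies V (blow cl). T \<subseteq> S} =
    join3 {P \<in> two_subsets (cell V cl 0). T \<inter> cell V cl 0 \<subseteq> P}
      {P \<in> two_subsets (cell V cl 1). T \<inter> cell V cl 1 \<subseteq> P}
      {P \<in> two_subsets (cell V cl 2). T \<inter> cell V cl 2 \<subseteq> P}" (is "_ = join3 ?P ?Q ?R")
proof
  have T: "T = (T \<inter> cell V cl 0) \<union> (T \<inter> cell V cl 1) \<union> (T \<inter> cell V cl 2)"
    using assms by (auto simp: cell_def)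
  show "join3 ?P ?Q ?R \<subseteq> {S \<in> copies V (blow cl). T \<subseteq> S}"
  proof
    fix S assume "S \<in> join3 ?P ?Q ?R"
    then obtain X Y Z where S: "S = X \<union> Y \<union> Z" "X \<in> ?P" "Y \<in> ?Q" "Z \<in> ?R"
      by (rule join3E)
    have "S \<in> copies V (blow cl)"
      unfolding copies_blow[OF assms(1)] S(1) using S(2-4) by (intro join3I) auto
    moreover have "T \<subseteq> S" using T S by auto
    ultimately show "S \<in> {S \<in> copies V (blow cl). T \<subseteq> S}" by simp
  qed
  show "{S \<in> copies V (blow cl). T \<subseteq> S} \<subseteq> join3 ?P ?Q ?R"
  proof
    fix S assume "S \<in> {S \<in> copies V (blow cl). T \<subseteq> S}"
    then have TS: "T \<subseteq> S" and "S \<in> copies V (blow cl)" by auto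
    then obtain X Y Z where S: "S = X \<union> Y \<union> Z" and X: "X \<in> two_subsets (cell V cl 0)"
      and Y: "Y \<in> two_subsets (cell V cl 1)" and Z: "Z \<in> two_subsets (cell V cl 2)"
      unfolding copies_blow[OF assms(1)] by (elim join3E)
    have sub: "X \<subseteq> cell V cl 0" "Y \<subseteq> cell V cl 1" "Z \<subseteq> cell V cl 2"
      using X Y Z two_subsets_Pow by blast+
    have disj: "cell V cl 0 \<inter> cell V cl 1 = {}" "cell V cl 0 \<inter> cell V cl 2 = {}" "cell V cl 1 \<inter> cell V cl 2 = {}"
      by (simp_all add: cell_disjoint)
    have "T \<inter> cell V cl 0 \<subseteq> X" using TS sub disj unfolding S by blast
    moreover have "T \<inter> cell V cl 1 \<subseteq> Y" using TS sub disj unfolding S by blast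
    moreover have "T \<inter> cell V cl 2 \<subseteq> Z" using TS sub disj unfolding S by blast
    ultimately show "S \<in> join3 ?P ?Q ?R" unfolding S using X Y Z by (intro join3I) auto
  qed
qed

lemma card_supersets_join3:
  assumes "finite V" "cl ` V \<subseteq> {0, 1, 2}" "T \<subseteq> V"
  shows "card {S \<in> copies V (blow cl). T \<subseteq> S} =
    card {P \<in> two_subsets (cell V cl 0). T \<inter> cell V cl 0 \<subseteq> P} *
    card {P \<in> two_subsets (cell V cl 1). T \<inter> cell V cl 1 \<subseteq> P} *
    card {P \<in> two_subsets (cell V cl 2). T \<inter> cell V cl 2 \<subseteq> P}"
proof -
  have Pow: "{P \<in> two_subsets X. R P} \<subseteq> Pow X" for X :: "'a set" and R
    using two_subsets_Pow by blast
  show ?thesis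
    unfolding supersets_join3[OF assms(2,3)]
    by (rule card_join3[OF Pow Pow Pow]) (simp_all add: cell_disjoint)
qed

lemma card_supersets_le:
  assumes "finite V" "T \<subseteq> V" "card T = t" "t \<le> 6"
  shows "card {S. S \<subseteq> V \<and> card S = 6 \<and> T \<subseteq> S} \<le> card V ^ (6 - t)"
proof -
  have "card {S. S \<subseteq> V \<and> card S = 6 \<and> T \<subseteq> S} \<le> card {R. R \<subseteq> V \<and> card R = 6 - t}"
  proof (rule card_inj_on_le[of "\<lambda>S. S - T"])
    show "inj_on (\<lambda>S. S - T) {S. S \<subseteq> V \<and> card S = 6 \<and> T \<subseteq> S}"
      by (rule inj_on_inverseI[of _ "\<lambda>R. R \<union> T"]) blast
    show "(\<lambda>S. S - T) ` {S. S \<subseteq> V \<and> card S = 6 \<and> T \<subseteq> S} \<subseteq> {R. R \<subseteq> V \<and> card R = 6 - t}"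
      using assms by (auto simp: card_Diff_subset finite_subset)
    show "finite {R. R \<subseteq> V \<and> card R = 6 - t}"
      by (rule finite_subset[of _ "Pow V"]) (use assms in auto)
  qed
  also have "\<dots> = card V choose (6 - t)" by (rule n_subsets) fact
  also have "\<dots> \<le> card V ^ (6 - t)"
  proof (cases "6 - t \<le> card V")
    case False
    then have "card V choose (6 - t) = 0" by (intro binomial_eq_0) linarith
    then show ?thesis by (simp only: zero_le)
  qed (rule binomial_le_pow)
  finally show ?thesis .
qed

lemma part_edge_twin: "part_edge i k \<Longrightarrow> part_edge j k \<Longrightarrow> i = j"
  by (auto simp: part_edge_def)

text \<open>Each adjacency in a copy can be recovered from the others. The vertices \<open>a\<close> and \<open>c\<close> have two common
neighbours \<open>b\<close> and \<open>d\<close>, at most one of which is affected by a wrong pair, so they are in the same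
class, and so are \<open>b\<close> and \<open>d\<close>. Hence the pairs \<open>ab, ad, cb, cd\<close> behave alike, and at
most one of them being wrong means that none is. The same holds for \<open>ae, ce\<close> and its analogues, and then
\<open>e\<close> is in class 0, so that \<open>ef\<close> is right as well.\<close>

lemma labelled_copy_not_one_wrong_pair:
  assumes sq: "labelled_copy E a b c d e f" and dist: "distinct [a, b, c, d, e, f]"
    and cl: "cl e \<in> {0, 1, 2}"
    and one: "\<And>u v u' v'. {u, v, u', v'} \<subseteq> {a, b, c, d, e, f} \<Longrightarrow> {u, v} \<noteq> {u', v'} \<Longrightarrow>
      E u v = blow cl u v \<or> E u' v' = blow cl u' v'"
    and uv: "u = a \<and> v \<in> {b, c, d, e, f} \<or> u = b \<and> v \<in> {c, d, e, f} \<or> u = c \<and> v \<in> {d, e, f} \<or>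
      u = d \<and> v \<in> {e, f} \<or> u = e \<and> v = f"
    and sym: "\<And>x y. E x y = E y x"
  shows "E u v = blow cl u v"
proof -
  have E: "E a b" "E a d" "E c b" "E c d" "\<not> E a c" "\<not> E b d" "\<not> E a e" "\<not> E b e" "\<not> E c e"
    "\<not> E d e" "\<not> E a f" "\<not> E b f" "\<not> E c f" "\<not> E d f" "\<not> E e f"
    using sq by (simp_all add: labelled_copy_def)
  have ne: "a \<noteq> b" "a \<noteq> c" "a \<noteq> d" "a \<noteq> e" "a \<noteq> f" "b \<noteq> c" "b \<noteq> d" "b \<noteq> e" "b \<noteq> f" "c \<noteq> d"
    "c \<noteq> e" "c \<noteq> f" "d \<noteq> e" "d \<noteq> f" "e \<noteq> f"
    using dist by simp_all
  note comm = part_edge_commute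
  have o1: "blow cl a b \<or> blow cl a d" "blow cl a b \<or> blow cl c d" "blow cl c b \<or> blow cl a d" "blow cl c b \<or> blow cl c d"
    "blow cl a b \<or> blow cl c b" "blow cl a d \<or> blow cl c d"
    using one[of a b a d] one[of a b c d] one[of c b a d] one[of c b c d] one[of a b c b] one[of a d c d] E ne
    by (simp_all add: doubleton_eq_iff)
  have ac: "cl a = cl c"
    using o1 part_edge_twin[of "cl a" "cl b" "cl c"] part_edge_twin[of "cl a" "cl d" "cl c"] by blast
  have bd: "cl b = cl d"
    using o1 part_edge_twin[of "cl b" "cl a" "cl d"] part_edge_twin[of "cl b" "cl c" "cl d"]
      comm[of "cl a" "cl b"] comm[of "cl a" "cl d"] comm[of "cl c" "cl b"] comm[of "cl c" "cl d"] by blast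
  have ab: "blow cl a b" using o1(1) bd by simp
  have o2: "\<not> blow cl a e \<or> \<not> blow cl c e" "\<not> blow cl b e \<or> \<not> blow cl d e"
    "\<not> blow cl a f \<or> \<not> blow cl c f" "\<not> blow cl b f \<or> \<not> blow cl d f"
    using one[of a e c e] one[of b e d e] one[of a f c f] one[of b f d f] E ne
    by (simp_all add: doubleton_eq_iff)
  have ae: "\<not> blow cl a e" "\<not> blow cl b e" "\<not> blow cl a f" "\<not> blow cl b f"
    using o2 ac bd by simp_all
  have "cl e = 0" using ae(1,2) ab cl by (auto simp: part_edge_def)
  then have ef: "\<not> blow cl e f" by (simp add: part_edge_simps)
  have nn: "\<not> blow cl a c" "\<not> blow cl b d" using ac bd by (simp_all add: part_edge_irrefl)
  note all = ab ae ef nn ac bd E comm[of "cl c" "cl b"]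
  consider "u = a" "v \<in> {b, c, d, e, f}" | "u = b" "v \<in> {c, d, e, f}" | "u = c" "v \<in> {d, e, f}"
    | "u = d" "v \<in> {e, f}" | "u = e" "v = f" using uv by blast
  then show ?thesis
  proof cases
    case 1 then show ?thesis using all by (elim insertE) simp_all
  next
    case 2 then show ?thesis using all sym[of b c] comm[of "cl b" "cl c"] by (elim insertE) simp_all
  next
    case 3 then show ?thesis using all by (elim insertE) simp_all
  next
    case 4 then show ?thesis using all by (elim insertE) simp_all
  next
    case 5 then show ?thesis using all by simp
  qed
qed

section \<open>Correcting a single pair\<close>

text \<open>The class \<open>j\<close> is a parameter because the number of wrong pairs at \<open>v\<close> is compared with what it would
be if \<open>v\<close> were in another class.\<close>

definition wdeg :: "'a set \<Rightarrow> ('a \<Rightarrow> 'a \<Rightarrow> bool) \<Rightarrow> ('a \<Rightarrow> nat) \<Rightarrow> 'a \<Rightarrow> nat \<Rightarrow> nat" where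
  "wdeg V E cl v j = card {u \<in> V - {v}. E v u \<noteq> part_edge j (cl u)}"

text \<open>On every other 6-set through \<open>v\<close>, correcting the pairs at \<open>v\<close> makes the graph agree with the blowup.\<close>

definition bad_at :: "'a set \<Rightarrow> ('a \<Rightarrow> 'a \<Rightarrow> bool) \<Rightarrow> ('a \<Rightarrow> nat) \<Rightarrow> 'a \<Rightarrow> 'a set set" where
  "bad_at V E cl v = {S. S \<subseteq> V \<and> card S = 6 \<and> v \<in> S \<and>
     (\<exists>p q. (p, q) \<in> wrong V E cl \<and> p \<in> S \<and> q \<in> S \<and> p \<noteq> v \<and> q \<noteq> v)}"

definition bad_over :: "'a set \<Rightarrow> ('a \<Rightarrow> 'a \<Rightarrow> bool) \<Rightarrow> ('a \<Rightarrow> nat) \<Rightarrow> 'a \<Rightarrow> 'a \<Rightarrow> 'a set set" where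
  "bad_over V E cl x y = {S. S \<subseteq> V \<and> card S = 6 \<and> x \<in> S \<and> y \<in> S \<and>
     (\<exists>p q. (p, q) \<in> wrong V E cl \<and> p \<in> S \<and> q \<in> S \<and> {p, q} \<noteq> {x, y})}"

definition six_over :: "'a set \<Rightarrow> 'a set \<Rightarrow> 'a set set" where
  "six_over V T = {S. S \<subseteq> V \<and> card S = 6 \<and> T \<subseteq> S}"

lemma finite_six_over: "finite V \<Longrightarrow> finite (six_over V T)"
  unfolding six_over_def by (rule finite_subset[of _ "Pow V"]) auto

lemma finite_wrong: "finite V \<Longrightarrow> finite (wrong V E cl)"
  unfolding wrong_def by (rule finite_subset[of _ "V \<times> V"]) auto

lemma wrong_neq: "(\<And>x. \<not> E x x) \<Longrightarrow> (p, q) \<in> wrong V E cl \<Longrightarrow> p \<noteq> q"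
  by (auto simp: wrong_def part_edge_irrefl)

lemma wrong_sym: "(\<And>x y. E x y = E y x) \<Longrightarrow> (p, q) \<in> wrong V E cl \<Longrightarrow> (q, p) \<in> wrong V E cl"
  using part_edge_commute[of "cl p" "cl q"] by (simp add: wrong_def)

lemma card_UN_six_over:
  assumes "finite V" "finite I" "\<And>i. i \<in> I \<Longrightarrow> T i \<subseteq> V \<and> card (T i) = t" "t \<le> 6"
  shows "card (\<Union>i\<in>I. six_over V (T i)) \<le> card I * card V ^ (6 - t)"
proof -
  have "card (\<Union>i\<in>I. six_over V (T i)) \<le> (\<Sum>i\<in>I. card (six_over V (T i)))"
    by (rule card_UN_le) fact
  also have "\<dots> \<le> (\<Sum>i\<in>I. card V ^ (6 - t))"
    unfolding six_over_def by (intro sum_mono card_supersets_le) (use assms in auto)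
  finally show ?thesis by simp
qed

lemma card_bad_at:
  assumes "finite V" "v \<in> V" "\<And>x. \<not> E x x"
  shows "card (bad_at V E cl v) \<le> card (wrong V E cl) * card V ^ 3"
proof -
  let ?I = "{p \<in> wrong V E cl. fst p \<noteq> v \<and> snd p \<noteq> v}"
  have finI: "finite ?I" using finite_wrong[OF assms(1)] by simp
  have "bad_at V E cl v \<subseteq> (\<Union>p\<in>?I. six_over V {v, fst p, snd p})"
    unfolding bad_at_def six_over_def by fastforce
  then have "card (bad_at V E cl v) \<le> card (\<Union>p\<in>?I. six_over V {v, fst p, snd p})"
    by (rule card_mono[rotated]) (use finI finite_six_over assms in blast)
  also have "\<dots> \<le> card ?I * card V ^ (6 - 3)"
  proof (rule card_UN_six_over[OF assms(1) finI])
    fix p assume p: "p \<in> ?I"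
    obtain x y where xy: "p = (x, y)" by (cases p)
    have "x \<noteq> y" "x \<in> V" "y \<in> V" "x \<noteq> v" "y \<noteq> v"
      using p wrong_neq[of E x y V cl] assms(3) unfolding xy by (auto simp: wrong_def)
    then show "{v, fst p, snd p} \<subseteq> V \<and> card {v, fst p, snd p} = 3"
      using assms(2) by (simp add: xy)
  qed simp
  also have "\<dots> \<le> card (wrong V E cl) * card V ^ 3"
    by (simp add: card_mono finite_wrong assms)
  finally show ?thesis .
qed

text \<open>A second wrong pair shares a vertex with \<open>xy\<close>, leaving \<open>n\<^sup>3\<close> choices for the rest of the set, or it
is disjoint from \<open>xy\<close>, leaving only \<open>n\<^sup>2\<close>.\<close>

lemma card_bad_over:
  assumes "finite V" "x \<in> V" "y \<in> V" "x \<noteq> y" and sym: "\<And>x y. E x y = E y x" and irr: "\<And>x. \<not> E x x"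
  shows "card (bad_over V E cl x y) \<le>
    (wdeg V E cl x (cl x) + wdeg V E cl y (cl y)) * card V ^ 3 + card (wrong V E cl) * card V ^ 2"
proof -
  let ?A = "\<lambda>z. {u \<in> V - {x, y}. (z, u) \<in> wrong V E cl}"
  let ?I = "{p \<in> wrong V E cl. fst p \<notin> {x, y} \<and> snd p \<notin> {x, y}}"
  let ?U = "(\<Union>u\<in>?A x. six_over V {x, y, u}) \<union> (\<Union>u\<in>?A y. six_over V {x, y, u}) \<union>
      (\<Union>p\<in>?I. six_over V {x, y, fst p, snd p})"
  have "bad_over V E cl x y \<subseteq> ?U"
  proof
    fix S assume "S \<in> bad_over V E cl x y"
    then obtain p q where S: "S \<subseteq> V" "card S = 6" "x \<in> S" "y \<in> S"
      and pq: "(p, q) \<in> wrong V E cl" "p \<in> S" "q \<in> S" "{p, q} \<noteq> {x, y}"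
      unfolding bad_over_def by blast
    have qp: "(q, p) \<in> wrong V E cl" using wrong_sym[OF sym pq(1)] .
    have "p \<noteq> q" using wrong_neq[OF irr pq(1)] .
    have "p \<in> V" "q \<in> V" using pq S by auto
    have six: "S \<in> six_over V T" if "T \<subseteq> S" for T using S that by (simp add: six_over_def)
    consider "p = x" "q \<notin> {x, y}" | "p = y" "q \<notin> {x, y}" | "q = x" "p \<notin> {x, y}" | "q = y" "p \<notin> {x, y}"
      | "p \<notin> {x, y}" "q \<notin> {x, y}"
      using pq(4) \<open>p \<noteq> q\<close> by (auto simp: insert_commute)
    then show "S \<in> ?U"
    proof cases
      case 1
      then have "q \<in> ?A x" "S \<in> six_over V {x, y, q}" using pq six S \<open>q \<in> V\<close> by auto
      then show ?thesis by blast
    next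
      case 2
      then have "q \<in> ?A y" "S \<in> six_over V {x, y, q}" using pq six S \<open>q \<in> V\<close> by auto
      then show ?thesis by blast
    next
      case 3
      then have "p \<in> ?A x" "S \<in> six_over V {x, y, p}" using pq qp six S \<open>p \<in> V\<close> by auto
      then show ?thesis by blast
    next
      case 4
      then have "p \<in> ?A y" "S \<in> six_over V {x, y, p}" using pq qp six S \<open>p \<in> V\<close> by auto
      then show ?thesis by blast
    next
      case 5
      have "(p, q) \<in> ?I" using 5 pq by simp
      moreover have "S \<in> six_over V {x, y, fst (p, q), snd (p, q)}" using six S pq by simp
      ultimately show ?thesis by blast
    qed
  qed
  then have "card (bad_over V E cl x y) \<le> card ?U"
    by (rule card_mono[rotated]) (simp add: finite_six_over finite_wrong assms(1))
  also have "\<dots> \<le> card (\<Union>u\<in>?A x. six_over V {x, y, u}) + card (\<Union>u\<in>?A y. six_over V {x, y, u}) +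
      card (\<Union>p\<in>?I. six_over V {x, y, fst p, snd p})"
    using card_Un_le[of "(\<Union>u\<in>?A x. six_over V {x, y, u}) \<union> (\<Union>u\<in>?A y. six_over V {x, y, u})"
        "(\<Union>p\<in>?I. six_over V {x, y, fst p, snd p})"]
      card_Un_le[of "(\<Union>u\<in>?A x. six_over V {x, y, u})" "(\<Union>u\<in>?A y. six_over V {x, y, u})"] by linarith
  also have "card (\<Union>u\<in>?A x. six_over V {x, y, u}) \<le> card (?A x) * card V ^ (6 - 3)"
    by (rule card_UN_six_over) (use assms in auto)
  also have "card (\<Union>u\<in>?A y. six_over V {x, y, u}) \<le> card (?A y) * card V ^ (6 - 3)"
    by (rule card_UN_six_over) (use assms in auto)
  also have "card (\<Union>p\<in>?I. six_over V {x, y, fst p, snd p}) \<le> card ?I * card V ^ (6 - 4)"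
  proof (rule card_UN_six_over[OF assms(1)])
    show "finite ?I" using finite_wrong[OF assms(1)] by simp
    fix p assume p: "p \<in> ?I"
    obtain u w where uw: "p = (u, w)" by (cases p)
    have "u \<noteq> w" "u \<in> V" "w \<in> V" "u \<notin> {x, y}" "w \<notin> {x, y}"
      using p wrong_neq[of E u w V cl] irr unfolding uw by (auto simp: wrong_def)
    then show "{x, y, fst p, snd p} \<subseteq> V \<and> card {x, y, fst p, snd p} = 4"
      using assms(2-4) by (auto simp: uw)
  qed simp
  also have "card (?A x) \<le> wdeg V E cl x (cl x)"
    unfolding wdeg_def by (rule card_mono) (use assms(1) in \<open>auto simp: wrong_def\<close>)
  also have "card (?A y) \<le> wdeg V E cl y (cl y)"
    unfolding wdeg_def by (rule card_mono) (use assms(1) in \<open>auto simp: wrong_def\<close>)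
  also have "card ?I \<le> card (wrong V E cl)"
    by (rule card_mono) (simp_all add: finite_wrong assms(1))
  finally show ?thesis by (simp add: algebra_simps)
qed

definition correct :: "('a \<Rightarrow> 'a \<Rightarrow> bool) \<Rightarrow> ('a \<Rightarrow> nat) \<Rightarrow> ('a \<Rightarrow> 'a \<Rightarrow> bool) \<Rightarrow> 'a \<Rightarrow> 'a \<Rightarrow> bool" where
  "correct E cl R u v \<longleftrightarrow> (if R u v then blow cl u v else E u v)"

lemma copies_split:
  assumes "finite V"
  shows "card (copies V E) = card {S \<in> copies V E. T \<subseteq> S} + card {S \<in> copies V E. \<not> T \<subseteq> S}"
proof -
  have "copies V E = {S \<in> copies V E. T \<subseteq> S} \<union> {S \<in> copies V E. \<not> T \<subseteq> S}" by blast
  moreover have "card ({S \<in> copies V E. T \<subseteq> S} \<union> {S \<in> copies V E. \<not> T \<subseteq> S}) =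
      card {S \<in> copies V E. T \<subseteq> S} + card {S \<in> copies V E. \<not> T \<subseteq> S}"
    by (rule card_Un_disjoint) (use finite_copies[OF assms] in auto)
  ultimately show ?thesis by simp
qed

lemma copies_outside_eq:
  assumes "\<And>u v S. \<not> T \<subseteq> S \<Longrightarrow> u \<in> S \<Longrightarrow> v \<in> S \<Longrightarrow> E u v = F u v"
  shows "{S \<in> copies V E. \<not> T \<subseteq> S} = {S \<in> copies V F. \<not> T \<subseteq> S}"
  using copies_cong[of _ E F V] assms by blast

text \<open>Only sets containing both \<open>x\<close> and \<open>y\<close> change their status. Among these, every copy before the correction has a second
wrong pair, and every copy of the blowup without a second wrong pair is a copy after
it.\<close>

lemma edge_gain:
  assumes "finite V" and cl: "cl ` V \<subseteq> {0, 1, 2}" and sym: "\<And>x y. E x y = E y x" and irr: "\<And>x. \<not> E x x"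
    and xy: "(x, y) \<in> wrong V E cl"
  defines "E' \<equiv> correct E cl (\<lambda>u v. {u, v} = {x, y})"
  shows "card (copies V E) + card {S \<in> copies V (blow cl). {x, y} \<subseteq> S} \<le>
    card (copies V E') + 2 * card (bad_over V E cl x y)"
proof -
  have fin_bad: "finite (bad_over V E cl x y)"
    by (rule finite_subset[of _ "Pow V"]) (use assms(1) in \<open>auto simp: bad_over_def\<close>)
  have out: "{S \<in> copies V E. \<not> {x, y} \<subseteq> S} = {S \<in> copies V E'. \<not> {x, y} \<subseteq> S}"
    by (rule copies_outside_eq) (auto simp: E'_def correct_def doubleton_eq_iff)
  have "{S \<in> copies V E. {x, y} \<subseteq> S} \<subseteq> bad_over V E cl x y"
  proof
    fix S assume S: "S \<in> {S \<in> copies V E. {x, y} \<subseteq> S}"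
    then obtain a b c d e f where abc: "S = {a, b, c, d, e, f}" "S \<subseteq> V" "card S = 6"
        and sq: "labelled_copy E a b c d e f"
      unfolding copies_def mem_Collect_eq by (elim conjE exE) (rule that)
    show "S \<in> bad_over V E cl x y"
    proof (rule ccontr)
      assume nb: "S \<notin> bad_over V E cl x y"
      have ok: "E p q = blow cl p q" if "p \<in> S" "q \<in> S" "{p, q} \<noteq> {x, y}" for p q
      proof (rule ccontr)
        assume "E p q \<noteq> blow cl p q"
        then have "(p, q) \<in> wrong V E cl" using that abc(2) by (auto simp: wrong_def)
        then have "S \<in> bad_over V E cl x y"
          unfolding bad_over_def mem_Collect_eq using S abc(2,3) that by (intro conjI exI[of _ p] exI[of _ q]) auto
        then show False using nb by contradiction
      qed
      have wr: "E x y \<noteq> blow cl x y" using xy by (simp add: wrong_def)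
      have "x \<noteq> y" using wrong_neq[OF irr xy] .
      have mem: "x \<in> {a, b, c, d, e, f}" "y \<in> {a, b, c, d, e, f}" using S abc(1) by auto
      have dist: "distinct [a, b, c, d, e, f]" using distinct_if_card_6[OF abc(3)[unfolded abc(1)]] .
      have *: "E u v = blow cl u v" if "u = a \<and> v \<in> {b, c, d, e, f} \<or> u = b \<and> v \<in> {c, d, e, f} \<or>
          u = c \<and> v \<in> {d, e, f} \<or> u = d \<and> v \<in> {e, f} \<or> u = e \<and> v = f" for u v
      proof (rule labelled_copy_not_one_wrong_pair[OF sq dist _ _ that sym])
        show "cl e \<in> {0, 1, 2}" using abc(1,2) cl by blast
        fix p q p' q' assume sub: "{p, q, p', q'} \<subseteq> {a, b, c, d, e, f}" "{p, q} \<noteq> {p', q'}"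
        then have "{p, q} \<noteq> {x, y} \<or> {p', q'} \<noteq> {x, y}" by blast
        then show "E p q = blow cl p q \<or> E p' q' = blow cl p' q'"
          using ok[of p q] ok[of p' q'] sub(1) unfolding abc(1)[symmetric] by blast
      qed
      have "E y x \<noteq> blow cl y x" using wr sym[of x y] part_edge_commute[of "cl x" "cl y"] by simp
      moreover have "E x y = blow cl x y \<or> E y x = blow cl y x"
        using mem \<open>x \<noteq> y\<close> *[of x y] *[of y x] by (elim insertE emptyE; simp)
      ultimately show False using wr by blast
    qed
  qed
  then have a: "card {S \<in> copies V E. {x, y} \<subseteq> S} \<le> card (bad_over V E cl x y)"
    by (rule card_mono[OF fin_bad])
  have "{S \<in> copies V (blow cl). {x, y} \<subseteq> S} \<subseteq> {S \<in> copies V E'. {x, y} \<subseteq> S} \<union> bad_over V E cl x y"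
  proof
    fix S assume S: "S \<in> {S \<in> copies V (blow cl). {x, y} \<subseteq> S}"
    show "S \<in> {S \<in> copies V E'. {x, y} \<subseteq> S} \<union> bad_over V E cl x y"
    proof (cases "S \<in> bad_over V E cl x y")
      case False
      have SV: "S \<subseteq> V" "card S = 6" using S by (auto simp: copies_def)
      have "blow cl u v = E' u v" if "u \<in> S" "v \<in> S" for u v
      proof (cases "{u, v} = {x, y}")
        case False
        have "(u, v) \<notin> wrong V E cl"
        proof
          assume "(u, v) \<in> wrong V E cl"
          then have "S \<in> bad_over V E cl x y"
            unfolding bad_over_def mem_Collect_eq using S SV that False
            by (intro conjI exI[of _ u] exI[of _ v]) auto
          then show False using \<open>S \<notin> bad_over V E cl x y\<close> by contradiction
        qed
        moreover have "u \<in> V" "v \<in> V" using that SV by auto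
        ultimately show ?thesis using False by (simp add: wrong_def E'_def correct_def)
      qed (simp add: E'_def correct_def)
      then have "S \<in> copies V E'" using S copies_cong[of S "blow cl" E' V] by blast
      then show ?thesis using S by simp
    qed simp
  qed
  then have "card {S \<in> copies V (blow cl). {x, y} \<subseteq> S} \<le>
      card ({S \<in> copies V E'. {x, y} \<subseteq> S} \<union> bad_over V E cl x y)"
    by (rule card_mono[rotated]) (use fin_bad finite_copies[OF assms(1)] in auto)
  also have "\<dots> \<le> card {S \<in> copies V E'. {x, y} \<subseteq> S} + card (bad_over V E cl x y)"
    by (rule card_Un_le)
  finally show ?thesis
    using a out copies_split[OF assms(1), of E "{x, y}"] copies_split[OF assms(1), of E' "{x, y}"] by simp
qed

section \<open>Correcting all pairs at a vertex\<close>

definition one_subsets :: "'a set \<Rightarrow> 'a set set" where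
  "one_subsets X = (\<lambda>x. {x}) ` X"

lemma card_one_subsets: "card (one_subsets X) = card X"
  unfolding one_subsets_def by (rule card_image) simp

lemma finite_one_subsets: "finite X \<Longrightarrow> finite (one_subsets X)"
  by (simp add: one_subsets_def)

lemma one_subsetsI: "x \<in> X \<Longrightarrow> {x} \<in> one_subsets X"
  by (simp add: one_subsets_def)

definition nbrs :: "'a set \<Rightarrow> ('a \<Rightarrow> 'a \<Rightarrow> bool) \<Rightarrow> ('a \<Rightarrow> nat) \<Rightarrow> 'a \<Rightarrow> nat \<Rightarrow> 'a set" where
  "nbrs V E cl v i = {u \<in> V - {v}. cl u = i \<and> E v u}"

definition nonnbrs :: "'a set \<Rightarrow> ('a \<Rightarrow> 'a \<Rightarrow> bool) \<Rightarrow> ('a \<Rightarrow> nat) \<Rightarrow> 'a \<Rightarrow> nat \<Rightarrow> 'a set" where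
  "nonnbrs V E cl v i = {u \<in> V - {v}. cl u = i \<and> \<not> E v u}"

text \<open>What a copy through \<open>v\<close> can look like outside \<open>v\<close> when \<open>v\<close> is attached arbitrarily to a blowup: \<open>v\<close> is
isolated, or it is in the 4-cycle opposite to a vertex of part 1, or opposite to one of part 2.\<close>

definition vertex_family where
  "vertex_family V E cl v =
     join3 (one_subsets (nonnbrs V E cl v 0)) (two_subsets (nonnbrs V E cl v 1)) (two_subsets (nonnbrs V E cl v 2)) \<union>
     join3 (two_subsets (nonnbrs V E cl v 0)) (one_subsets (nonnbrs V E cl v 1)) (two_subsets (nbrs V E cl v 2)) \<union>
     join3 (two_subsets (nonnbrs V E cl v 0)) (two_subsets (nbrs V E cl v 1)) (one_subsets (nonnbrs V E cl v 2))"

lemma rest_isolated: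
  assumes "labelled_copy E a b c d v f" and rest: "\<And>p q. p \<in> {a, b, c, d, f} \<Longrightarrow> q \<in> {a, b, c, d, f} \<Longrightarrow> E p q = blow cl p q"
    and sym: "\<And>x y. E x y = E y x" and V: "{a, b, c, d, f} \<subseteq> V" and cl: "cl f \<in> {0, 1, 2}"
    and dist: "distinct [a, b, c, d, v, f]"
  shows "{a, b, c, d, f} \<in> vertex_family V E cl v"
proof -
  have E: "E a b" "E a d" "E c b" "E c d" "\<not> E a f" "\<not> E b f" "\<not> E v a" "\<not> E v b" "\<not> E v c" "\<not> E v d" "\<not> E v f"
    using assms(1) sym[of v] by (simp_all add: labelled_copy_def)
  have bl: "part_edge (cl a) (cl b)" "part_edge (cl a) (cl d)" "part_edge (cl c) (cl b)" "part_edge (cl c) (cl d)"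
    "\<not> part_edge (cl a) (cl f)" "\<not> part_edge (cl b) (cl f)"
    using rest[of a b] rest[of a d] rest[of c b] rest[of c d] rest[of a f] rest[of b f] E by simp_all
  have ne: "a \<noteq> c" "b \<noteq> d" "a \<noteq> v" "b \<noteq> v" "c \<noteq> v" "d \<noteq> v" "f \<noteq> v" using dist by auto
  consider "cl a = 1" "cl b = 2" | "cl a = 2" "cl b = 1"
    using bl(1) by (auto simp: part_edge_def)
  then show ?thesis
  proof cases
    case 1
    then have "cl c = 1" "cl d = 2" "cl f = 0" using bl cl by (simp_all add: part_edge_simps)
    then have "{f} \<union> {a, c} \<union> {b, d} \<in> vertex_family V E cl v"
      unfolding vertex_family_def using 1 ne V E
      by (intro UnI1 join3I one_subsetsI two_subsetsI) (simp_all add: nonnbrs_def)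
    moreover have "{f} \<union> {a, c} \<union> {b, d} = {a, b, c, d, f}" by blast
    ultimately show ?thesis by simp
  next
    case 2
    then have "cl c = 2" "cl d = 1" "cl f = 0" using bl cl by (simp_all add: part_edge_simps)
    then have "{f} \<union> {b, d} \<union> {a, c} \<in> vertex_family V E cl v"
      unfolding vertex_family_def using 2 ne V E
      by (intro UnI1 join3I one_subsetsI two_subsetsI) (simp_all add: nonnbrs_def)
    moreover have "{f} \<union> {b, d} \<union> {a, c} = {a, b, c, d, f}" by blast
    ultimately show ?thesis by simp
  qed
qed

lemma rest_in_square:
  assumes "labelled_copy E v b c d e f" and rest: "\<And>p q. p \<in> {b, c, d, e, f} \<Longrightarrow> q \<in> {b, c, d, e, f} \<Longrightarrow> E p q = blow cl p q"
    and V: "{b, c, d, e, f} \<subseteq> V" and cl: "cl e \<in> {0, 1, 2}" "cl f \<in> {0, 1, 2}"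
    and dist: "distinct [v, b, c, d, e, f]"
  shows "{b, c, d, e, f} \<in> vertex_family V E cl v"
proof -
  have E: "E c b" "E c d" "\<not> E b e" "\<not> E c e" "\<not> E b f" "\<not> E c f" "E v b" "E v d" "\<not> E v c" "\<not> E v e" "\<not> E v f"
    using assms(1) by (simp_all add: labelled_copy_def)
  have bl: "part_edge (cl c) (cl b)" "part_edge (cl c) (cl d)"
    "\<not> part_edge (cl b) (cl e)" "\<not> part_edge (cl c) (cl e)" "\<not> part_edge (cl b) (cl f)" "\<not> part_edge (cl c) (cl f)"
    using rest[of c b] rest[of c d] rest[of b e] rest[of c e] rest[of b f] rest[of c f] E by simp_all
  have ne: "b \<noteq> d" "e \<noteq> f" "b \<noteq> v" "c \<noteq> v" "d \<noteq> v" "e \<noteq> v" "f \<noteq> v" using dist by auto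
  consider "cl c = 1" "cl b = 2" | "cl c = 2" "cl b = 1"
    using bl(1) by (auto simp: part_edge_def)
  then show ?thesis
  proof cases
    case 1
    then have "cl d = 2" "cl e = 0" "cl f = 0" using bl cl by (simp_all add: part_edge_simps)
    then have "{e, f} \<union> {c} \<union> {b, d} \<in> vertex_family V E cl v"
      unfolding vertex_family_def using 1 ne V E
      by (intro UnI1[OF UnI2] join3I one_subsetsI two_subsetsI) (simp_all add: nonnbrs_def nbrs_def)
    moreover have "{e, f} \<union> {c} \<union> {b, d} = {b, c, d, e, f}" by blast
    ultimately show ?thesis by simp
  next
    case 2
    then have "cl d = 1" "cl e = 0" "cl f = 0" using bl cl by (simp_all add: part_edge_simps)
    then have "{e, f} \<union> {b, d} \<union> {c} \<in> vertex_family V E cl v"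
      unfolding vertex_family_def using 2 ne V E
      by (intro UnI2 join3I one_subsetsI two_subsetsI) (simp_all add: nonnbrs_def nbrs_def)
    moreover have "{e, f} \<union> {b, d} \<union> {c} = {b, c, d, e, f}" by blast
    ultimately show ?thesis by simp
  qed
qed

lemma labelled_copy_symmetries:
  assumes "\<And>x y. E x y = E y x"
  shows "labelled_copy E a b c d e f \<Longrightarrow> labelled_copy E c b a d e f"
    "labelled_copy E a b c d e f \<Longrightarrow> labelled_copy E b a d c e f"
    "labelled_copy E a b c d e f \<Longrightarrow> labelled_copy E d a b c e f"
    "labelled_copy E a b c d e f \<Longrightarrow> labelled_copy E a b c d f e"
  unfolding labelled_copy_def using assms by blast+

lemma copy_minus_vertex:
  assumes cl: "cl ` V \<subseteq> {0, 1, 2}" and sym: "\<And>x y. E x y = E y x"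
    and S: "S \<in> copies V E" "v \<in> S" "S \<notin> bad_at V E cl v"
  shows "S - {v} \<in> vertex_family V E cl v"
proof -
  obtain a b c d e f where abc: "S = {a, b, c, d, e, f}" "S \<subseteq> V" "card S = 6"
      and sq: "labelled_copy E a b c d e f"
    using S(1) unfolding copies_def mem_Collect_eq by (elim conjE exE) (rule that)
  have dist: "distinct [a, b, c, d, e, f]" using distinct_if_card_6[OF abc(3)[unfolded abc(1)]] .
  have ok: "E p q = blow cl p q" if "p \<in> S - {v}" "q \<in> S - {v}" for p q
  proof (rule ccontr)
    assume "E p q \<noteq> blow cl p q"
    then have "(p, q) \<in> wrong V E cl" using that abc(2) by (auto simp: wrong_def)
    then have "S \<in> bad_at V E cl v"
      unfolding bad_at_def mem_Collect_eq using S abc(2,3) that by (intro conjI exI[of _ p] exI[of _ q]) auto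
    then show False using S(3) by contradiction
  qed
  have clS: "cl p \<in> {0, 1, 2}" if "p \<in> S" for p using cl abc(2) that by blast
  have square: "S - {v} \<in> vertex_family V E cl v"
    if "labelled_copy E v b' c' d' e' f'" "S = {v, b', c', d', e', f'}" for b' c' d' e' f'
  proof -
    have d: "distinct [v, b', c', d', e', f']" using distinct_if_card_6[OF abc(3)[unfolded that(2)]] .
    have minus: "S - {v} = {b', c', d', e', f'}" using d unfolding that(2) by auto
    have sub: "{b', c', d', e', f'} \<subseteq> V" using abc(2) minus by blast
    have mem: "e' \<in> S" "f' \<in> S" using that(2) by simp_all
    show ?thesis unfolding minus
      by (rule rest_in_square[OF that(1) ok[unfolded minus] sub clS[OF mem(1)] clS[OF mem(2)] d])
  qed
  have isolated: "S - {v} \<in> vertex_family V E cl v"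
    if "labelled_copy E a' b' c' d' v f'" "S = {a', b', c', d', v, f'}" for a' b' c' d' f'
  proof -
    have d: "distinct [a', b', c', d', v, f']" using distinct_if_card_6[OF abc(3)[unfolded that(2)]] .
    have minus: "S - {v} = {a', b', c', d', f'}" using d unfolding that(2) by auto
    have sub: "{a', b', c', d', f'} \<subseteq> V" using abc(2) minus by blast
    have mem: "f' \<in> S" using that(2) by simp
    show ?thesis unfolding minus
      by (rule rest_isolated[OF that(1) ok[unfolded minus] sym sub clS[OF mem] d])
  qed
  note sy = labelled_copy_symmetries[of E, OF sym]
  have "v = a \<or> v = b \<or> v = c \<or> v = d \<or> v = e \<or> v = f" using S(2) abc(1) by auto
  then show ?thesis
  proof (elim disjE)
    assume "v = a" then show ?thesis using square[of b c d e f] sq abc(1) by simp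
  next
    assume "v = b" then show ?thesis using square[of a d c e f] sy(2)[OF sq] abc(1) by (simp add: insert_commute)
  next
    assume "v = c" then show ?thesis using square[of b a d e f] sy(1)[OF sq] abc(1) by (simp add: insert_commute)
  next
    assume "v = d" then show ?thesis using square[of a b c e f] sy(3)[OF sq] abc(1) by (simp add: insert_commute)
  next
    assume "v = e" then show ?thesis using isolated[of a b c d f] sq abc(1) by simp
  next
    assume "v = f" then show ?thesis using isolated[of a b c d e] sy(4)[OF sq] abc(1) by (simp add: insert_commute)
  qed
qed

lemma card_vertex_family:
  assumes "finite V"
  shows "card (vertex_family V E cl v) \<le>
    card (nonnbrs V E cl v 0) * (card (nonnbrs V E cl v 1) choose 2) * (card (nonnbrs V E cl v 2) choose 2) +
    (card (nonnbrs V E cl v 0) choose 2) * card (nonnbrs V E cl v 1) * (card (nbrs V E cl v 2) choose 2) +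
    (card (nonnbrs V E cl v 0) choose 2) * (card (nbrs V E cl v 1) choose 2) * card (nonnbrs V E cl v 2)"
    (is "_ \<le> ?x + ?y + ?z")
proof -
  have fin: "finite (nbrs V E cl v i)" "finite (nonnbrs V E cl v i)" for i
    using assms by (simp_all add: nbrs_def nonnbrs_def)
  let ?X = "join3 (one_subsets (nonnbrs V E cl v 0)) (two_subsets (nonnbrs V E cl v 1)) (two_subsets (nonnbrs V E cl v 2))"
  let ?Y = "join3 (two_subsets (nonnbrs V E cl v 0)) (one_subsets (nonnbrs V E cl v 1)) (two_subsets (nbrs V E cl v 2))"
  let ?Z = "join3 (two_subsets (nonnbrs V E cl v 0)) (two_subsets (nbrs V E cl v 1)) (one_subsets (nonnbrs V E cl v 2))"
  have "card ?X \<le> ?x" "card ?Y \<le> ?y" "card ?Z \<le> ?z"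
    by (rule order.trans[OF card_join3_le];
        simp add: finite_two_subsets finite_one_subsets fin card_one_subsets card_two_subsets)+
  then show ?thesis
    unfolding vertex_family_def using card_Un_le[of "?X \<union> ?Y" ?Z] card_Un_le[of ?X ?Y] by linarith
qed

text \<open>As in \<open>edge_gain\<close>, but for the sets containing \<open>v\<close>. The copies through \<open>v\<close> before the correction are
bounded by \<open>vertex_family\<close> instead of being excluded.\<close>

lemma vertex_gain:
  assumes "finite V" and cl: "cl ` V \<subseteq> {0, 1, 2}" and sym: "\<And>x y. E x y = E y x" and irr: "\<And>x. \<not> E x x"
    and v: "v \<in> V"
  defines "E' \<equiv> correct E cl (\<lambda>p q. p = v \<or> q = v)"
  shows "card (copies V E) + card {S \<in> copies V (blow cl). {v} \<subseteq> S} \<le>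
    card (copies V E') + card (vertex_family V E cl v) + 2 * card (bad_at V E cl v)"
proof -
  have fin_bad: "finite (bad_at V E cl v)"
    by (rule finite_subset[of _ "Pow V"]) (use assms(1) in \<open>auto simp: bad_at_def\<close>)
  have fin_fam: "finite (vertex_family V E cl v)"
    unfolding vertex_family_def join3_def
    by (intro finite_UnI finite_imageI finite_cartesian_product finite_one_subsets finite_two_subsets)
       (use assms(1) in \<open>simp_all add: nbrs_def nonnbrs_def\<close>)
  have out: "{S \<in> copies V E. \<not> {v} \<subseteq> S} = {S \<in> copies V E'. \<not> {v} \<subseteq> S}"
    by (rule copies_outside_eq) (auto simp: E'_def correct_def)
  have "{S \<in> copies V E. {v} \<subseteq> S} \<subseteq>
      {S \<in> copies V E. v \<in> S \<and> S \<notin> bad_at V E cl v} \<union> bad_at V E cl v" by blast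
  then have "card {S \<in> copies V E. {v} \<subseteq> S} \<le>
      card ({S \<in> copies V E. v \<in> S \<and> S \<notin> bad_at V E cl v} \<union> bad_at V E cl v)"
    by (rule card_mono[rotated]) (use fin_bad finite_copies[OF assms(1)] in auto)
  also have "\<dots> \<le> card {S \<in> copies V E. v \<in> S \<and> S \<notin> bad_at V E cl v} + card (bad_at V E cl v)"
    by (rule card_Un_le)
  also have "card {S \<in> copies V E. v \<in> S \<and> S \<notin> bad_at V E cl v} \<le> card (vertex_family V E cl v)"
  proof (rule card_inj_on_le[of "\<lambda>S. S - {v}"])
    show "inj_on (\<lambda>S. S - {v}) {S \<in> copies V E. v \<in> S \<and> S \<notin> bad_at V E cl v}"
      by (rule inj_on_inverseI[of _ "\<lambda>R. R \<union> {v}"]) blast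
    show "(\<lambda>S. S - {v}) ` {S \<in> copies V E. v \<in> S \<and> S \<notin> bad_at V E cl v} \<subseteq> vertex_family V E cl v"
      using copy_minus_vertex[of cl V E _ v, OF cl sym] by blast
  qed (rule fin_fam)
  finally have a: "card {S \<in> copies V E. {v} \<subseteq> S} \<le> card (vertex_family V E cl v) + card (bad_at V E cl v)"
    by simp
  have "{S \<in> copies V (blow cl). {v} \<subseteq> S} \<subseteq> {S \<in> copies V E'. {v} \<subseteq> S} \<union> bad_at V E cl v"
  proof
    fix S assume S: "S \<in> {S \<in> copies V (blow cl). {v} \<subseteq> S}"
    show "S \<in> {S \<in> copies V E'. {v} \<subseteq> S} \<union> bad_at V E cl v"
    proof (cases "S \<in> bad_at V E cl v")
      case nb: False
      have SV: "S \<subseteq> V" "card S = 6" using S by (auto simp: copies_def)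
      have "blow cl p q = E' p q" if "p \<in> S" "q \<in> S" for p q
      proof (cases "p = v \<or> q = v")
        case False
        have "(p, q) \<notin> wrong V E cl"
        proof
          assume "(p, q) \<in> wrong V E cl"
          then have "S \<in> bad_at V E cl v"
            unfolding bad_at_def mem_Collect_eq using S SV that False
            by (intro conjI exI[of _ p] exI[of _ q]) auto
          then show False using nb by contradiction
        qed
        moreover have "p \<in> V" "q \<in> V" using that SV by auto
        ultimately show ?thesis using False by (simp add: wrong_def E'_def correct_def)
      qed (simp add: E'_def correct_def)
      then have "S \<in> copies V E'" using S copies_cong[of S "blow cl" E' V] by blast
      then show ?thesis using S by simp
    qed simp
  qed
  then have "card {S \<in> copies V (blow cl). {v} \<subseteq> S} \<le>
      card ({S \<in> copies V E'. {v} \<subseteq> S} \<union> bad_at V E cl v)"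
    by (rule card_mono[rotated]) (use fin_bad finite_copies[OF assms(1)] in auto)
  also have "\<dots> \<le> card {S \<in> copies V E'. {v} \<subseteq> S} + card (bad_at V E cl v)"
    by (rule card_Un_le)
  finally show ?thesis
    using a out copies_split[OF assms(1), of E "{v}"] copies_split[OF assms(1), of E' "{v}"] by simp
qed

section \<open>The neighbourhood of a vertex outside its part\<close>

lemma real_choose_two: "real (k choose 2) = real k * (real k - 1) / 2"
  by (induction k) (simp_all add: numeral_2_eq_2 field_simps)

text \<open>The left-hand side is the normalised number of copies through a vertex with no neighbours in part 0
that misses proportions \<open>a\<close> and \<open>b\<close> of the parts 1 and 2. It is 1 only at \<open>(1,1)\<close>, \<open>(1,0)\<close> and
\<open>(0,1)\<close>, the attachments of the vertices of the three parts; \<open>h\<close> measures the distance to these points.\<close>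

lemma profile_bound2:
  fixes a b h :: real
  assumes a: "0 \<le> a" "a \<le> 1" and b: "0 \<le> b" "b \<le> 1"
    and h: "h \<le> (1 - a) + (1 - b)" "h \<le> (1 - a) + b" "h \<le> a + (1 - b)"
  shows "a\<^sup>2 * b\<^sup>2 + a * (1 - b)\<^sup>2 + b * (1 - a)\<^sup>2 \<le> 1 - h / 4"
proof -
  have ab: "0 \<le> a * b" "a * b \<le> 1" using a b by (auto intro: mult_le_one)
  have "1 - (a\<^sup>2 * b\<^sup>2 + a * (1 - b)\<^sup>2 + b * (1 - a)\<^sup>2) =
      (1 - a) * (1 - b) + a * b * (2 - a - b) + a * b * (1 - a * b)"
    by (simp add: algebra_simps power2_eq_square)
  then have *: "(1 - a) * (1 - b) + a * b * (2 - a - b) \<le> 1 - (a\<^sup>2 * b\<^sup>2 + a * (1 - b)\<^sup>2 + b * (1 - a)\<^sup>2)"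
    using mult_nonneg_nonneg[OF ab(1), of "1 - a * b"] ab(2) by simp
  define X Y where "X = (1 - a) * (1 - b)" and "Y = a * b * (2 - a - b)"
  have nn: "0 \<le> X" "0 \<le> Y"
    unfolding X_def Y_def using a b ab by (auto intro!: mult_nonneg_nonneg)
  have "h / 4 \<le> X + Y"
  proof -
    consider "1 / 2 \<le> a" "1 / 2 \<le> b" | "a \<le> 1 / 2" "b \<le> 1 / 2" | "1 / 2 \<le> a" "b \<le> 1 / 2" | "a \<le> 1 / 2" "1 / 2 \<le> b"
      by linarith
    then show ?thesis
    proof cases
      case 1
      have "1 / 2 * (1 / 2) \<le> a * b" using 1 by (intro mult_mono) auto
      then have "1 / 4 * (2 - a - b) \<le> Y" unfolding Y_def using a b by (intro mult_right_mono) auto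
      then show ?thesis using nn h by (simp add: field_simps)
    next
      case 2
      have "1 / 2 * (1 / 2) \<le> X" unfolding X_def using 2 by (intro mult_mono) auto
      then show ?thesis using nn h by linarith
    next
      case 3
      have "(1 - a) * (1 / 2) \<le> X" unfolding X_def using 3 a by (intro mult_left_mono) auto
      moreover have "(1 / 2 * b) * (1 / 2) \<le> Y"
        unfolding Y_def using 3 a b by (intro mult_mono) auto
      ultimately show ?thesis using h a by (simp add: field_simps)
    next
      case 4
      have "(1 / 2) * (1 - b) \<le> X" unfolding X_def using 4 b by (intro mult_right_mono) auto
      moreover have "(a * (1 / 2)) * (1 / 2) \<le> Y"
        unfolding Y_def using 4 a b by (intro mult_mono) auto
      ultimately show ?thesis using h b by (simp add: field_simps)
    qed
  qed
  then show ?thesis using * unfolding X_def Y_def by linarith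
qed

text \<open>If many neighbours are in part 0, then the factor \<open>s\<close> alone is small enough. Otherwise the
distance is due to the other two parts.\<close>

lemma profile_bound3:
  fixes s a b d :: real
  assumes s: "0 \<le> s" "s \<le> 1" and a: "0 \<le> a" "a \<le> 1" and b: "0 \<le> b" "b \<le> 1" and "0 \<le> d"
    and d: "d \<le> (1 - s) + (1 - a) + (1 - b)" "d \<le> (1 - s) + (1 - a) + b" "d \<le> (1 - s) + a + (1 - b)"
  shows "s * a\<^sup>2 * b\<^sup>2 + s\<^sup>2 * a * (1 - b)\<^sup>2 + s\<^sup>2 * b * (1 - a)\<^sup>2 \<le> 1 - d / 8"
proof -
  let ?P = "a\<^sup>2 * b\<^sup>2 + a * (1 - b)\<^sup>2 + b * (1 - a)\<^sup>2"
  have P0: "0 \<le> ?P" using a b by (intro add_nonneg_nonneg mult_nonneg_nonneg) auto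
  have P1: "?P \<le> 1" using profile_bound2[of a b 0] a b by auto
  have s2: "s\<^sup>2 \<le> s" using s by (simp add: power2_eq_square mult_left_le)
  have "s * a\<^sup>2 * b\<^sup>2 + s\<^sup>2 * a * (1 - b)\<^sup>2 + s\<^sup>2 * b * (1 - a)\<^sup>2 =
      s * (a\<^sup>2 * b\<^sup>2) + s\<^sup>2 * (a * (1 - b)\<^sup>2 + b * (1 - a)\<^sup>2)"
    by (simp add: algebra_simps)
  also have "\<dots> \<le> s * (a\<^sup>2 * b\<^sup>2) + s * (a * (1 - b)\<^sup>2 + b * (1 - a)\<^sup>2)"
    using s2 a b by (intro add_left_mono mult_right_mono add_nonneg_nonneg mult_nonneg_nonneg) auto
  also have "\<dots> = s * ?P" by (simp add: algebra_simps)
  also have "s * ?P \<le> 1 - d / 8"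
  proof (cases "d / 2 \<le> 1 - s")
    case True
    have "s * ?P \<le> s * 1" using P1 s by (intro mult_left_mono) auto
    then show ?thesis using True \<open>0 \<le> d\<close> by linarith
  next
    case False
    have "?P \<le> 1 - (d / 2) / 4" by (rule profile_bound2[OF a b]) (use False d in linarith)+
    moreover have "s * ?P \<le> 1 * ?P" using P0 s by (intro mult_right_mono) auto
    ultimately show ?thesis by simp
  qed
  finally show ?thesis .
qed

text \<open>The bound \<open>profile_bound3\<close> before normalisation: \<open>u i\<close> and \<open>p i\<close> are the numbers of non-neighbours and
neighbours in part \<open>i\<close>, which has size at most \<open>\<sigma>\<close>, and \<open>g\<close> bounds from below the number of wrong
pairs at the vertex whichever part it is assigned to.\<close>

lemma profile_bound:
  fixes u0 u1 u2 p0 p1 p2 \<sigma> g :: real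
  assumes "0 < \<sigma>" "0 \<le> g" and nn: "0 \<le> u0" "0 \<le> u1" "0 \<le> u2" "0 \<le> p0" "0 \<le> p1" "0 \<le> p2"
    and up: "u0 + p0 \<le> \<sigma>" "u1 + p1 \<le> \<sigma>" "u2 + p2 \<le> \<sigma>"
    and g: "g \<le> p0 + p1 + p2" "g \<le> p0 + p1 + u2" "g \<le> p0 + u1 + p2"
  shows "u0 * u1\<^sup>2 * u2\<^sup>2 + u0\<^sup>2 * u1 * p2\<^sup>2 + u0\<^sup>2 * p1\<^sup>2 * u2 \<le> \<sigma> ^ 5 * (1 - g / (8 * \<sigma>))"
proof -
  define s a b where "s = u0 / \<sigma>" "a = u1 / \<sigma>" "b = u2 / \<sigma>"
  have u: "u0 = \<sigma> * s" "u1 = \<sigma> * a" "u2 = \<sigma> * b" using assms(1) by (simp_all add: s_a_b_def)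
  have p: "p0 \<le> \<sigma> * (1 - s)" "p1 \<le> \<sigma> * (1 - a)" "p2 \<le> \<sigma> * (1 - b)"
    using up unfolding u by (simp_all add: algebra_simps)
  have rng: "0 \<le> s" "s \<le> 1" "0 \<le> a" "a \<le> 1" "0 \<le> b" "b \<le> 1"
    using nn up assms(1) by (auto simp: s_a_b_def)
  have "u0 * u1\<^sup>2 * u2\<^sup>2 + u0\<^sup>2 * u1 * p2\<^sup>2 + u0\<^sup>2 * p1\<^sup>2 * u2 \<le>
      u0 * u1\<^sup>2 * u2\<^sup>2 + u0\<^sup>2 * u1 * (\<sigma> * (1 - b))\<^sup>2 + u0\<^sup>2 * (\<sigma> * (1 - a))\<^sup>2 * u2"
    using p nn by (intro add_mono mult_mono power_mono mult_nonneg_nonneg) auto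
  also have "\<dots> = \<sigma> ^ 5 * (s * a\<^sup>2 * b\<^sup>2 + s\<^sup>2 * a * (1 - b)\<^sup>2 + s\<^sup>2 * b * (1 - a)\<^sup>2)"
    unfolding u by (simp add: algebra_simps eval_nat_numeral)
  also have "\<dots> \<le> \<sigma> ^ 5 * (1 - (g / \<sigma>) / 8)"
  proof (intro mult_left_mono profile_bound3 rng)
    have "g \<le> ((1 - s) + (1 - a) + (1 - b)) * \<sigma>"
      using g(1) p by (simp add: algebra_simps)
    then show "g / \<sigma> \<le> (1 - s) + (1 - a) + (1 - b)"
      by (simp only: pos_divide_le_eq[OF assms(1)])
    have "g \<le> ((1 - s) + (1 - a) + b) * \<sigma>"
      using g(2) p u by (simp add: algebra_simps)
    then show "g / \<sigma> \<le> (1 - s) + (1 - a) + b"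
      by (simp only: pos_divide_le_eq[OF assms(1)])
    have "g \<le> ((1 - s) + a + (1 - b)) * \<sigma>"
      using g(3) p u by (simp add: algebra_simps)
    then show "g / \<sigma> \<le> (1 - s) + a + (1 - b)"
      by (simp only: pos_divide_le_eq[OF assms(1)])
  qed (use assms(1,2) in auto)
  finally show ?thesis by (simp add: field_simps)
qed

lemma cell_split: "finite V \<Longrightarrow> card (nonnbrs V E cl v i) + card (nbrs V E cl v i) \<le> card (cell V cl i)"
  by (subst card_Un_disjoint[symmetric]) (auto simp: nonnbrs_def nbrs_def cell_def intro!: card_mono)

lemma wdeg_nbrs:
  assumes "finite V" and cl: "cl ` V \<subseteq> {0, 1, 2}"
  shows "wdeg V E cl v 0 = card (nbrs V E cl v 0) + card (nbrs V E cl v 1) + card (nbrs V E cl v 2)"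
    "wdeg V E cl v 1 = card (nbrs V E cl v 0) + card (nbrs V E cl v 1) + card (nonnbrs V E cl v 2)"
    "wdeg V E cl v 2 = card (nbrs V E cl v 0) + card (nonnbrs V E cl v 1) + card (nbrs V E cl v 2)"
proof -
  have fin: "finite (nbrs V E cl v i)" "finite (nonnbrs V E cl v i)" for i
    using assms by (simp_all add: nbrs_def nonnbrs_def)
  have c3: "card (A \<union> B \<union> C) = card A + card B + card C"
    if "finite A" "finite B" "finite C" "A \<inter> B = {}" "A \<inter> C = {}" "B \<inter> C = {}" for A B C :: "'a set"
  proof -
    have "(A \<union> B) \<inter> C = {}" using that by blast
    then show ?thesis using that by (simp add: card_Un_disjoint)
  qed
  have clV: "cl u = 0 \<or> cl u = 1 \<or> cl u = 2" if "u \<in> V" for u using cl that by blast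
  have "{u \<in> V - {v}. E v u \<noteq> part_edge 0 (cl u)} = nbrs V E cl v 0 \<union> nbrs V E cl v 1 \<union> nbrs V E cl v 2"
    using clV by (auto simp: nbrs_def part_edge_simps)
  moreover have "{u \<in> V - {v}. E v u \<noteq> part_edge 1 (cl u)} = nbrs V E cl v 0 \<union> nbrs V E cl v 1 \<union> nonnbrs V E cl v 2"
    using clV by (auto simp: nbrs_def nonnbrs_def part_edge_simps)
  moreover have "{u \<in> V - {v}. E v u \<noteq> part_edge 2 (cl u)} = nbrs V E cl v 0 \<union> nonnbrs V E cl v 1 \<union> nbrs V E cl v 2"
    using clV by (auto simp: nbrs_def nonnbrs_def part_edge_simps)
  moreover have "nbrs V E cl v 0 \<inter> nbrs V E cl v 1 = {}" "nbrs V E cl v 0 \<inter> nbrs V E cl v 2 = {}"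
    "nbrs V E cl v 1 \<inter> nbrs V E cl v 2 = {}" "nbrs V E cl v 0 \<inter> nonnbrs V E cl v 2 = {}"
    "nbrs V E cl v 1 \<inter> nonnbrs V E cl v 2 = {}" "nbrs V E cl v 0 \<inter> nonnbrs V E cl v 1 = {}"
    "nonnbrs V E cl v 1 \<inter> nbrs V E cl v 2 = {}"
    by (auto simp: nbrs_def nonnbrs_def)
  ultimately show "wdeg V E cl v 0 = card (nbrs V E cl v 0) + card (nbrs V E cl v 1) + card (nbrs V E cl v 2)"
    "wdeg V E cl v 1 = card (nbrs V E cl v 0) + card (nbrs V E cl v 1) + card (nonnbrs V E cl v 2)"
    "wdeg V E cl v 2 = card (nbrs V E cl v 0) + card (nonnbrs V E cl v 1) + card (nbrs V E cl v 2)"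
    unfolding wdeg_def by (simp_all only: c3 fin)
qed

lemma vertex_family_bound:
  fixes \<sigma> g :: real
  assumes "finite V" and cl: "cl ` V \<subseteq> {0, 1, 2}" and "0 < \<sigma>" "0 \<le> g"
    and size: "\<And>i. i \<in> {0, 1, 2} \<Longrightarrow> real (card (cell V cl i)) \<le> \<sigma>"
    and deg: "\<And>j. j \<in> {0, 1, 2} \<Longrightarrow> g \<le> real (wdeg V E cl v j)"
  shows "real (card (vertex_family V E cl v)) \<le> \<sigma> ^ 5 * (1 - g / (8 * \<sigma>)) / 4"
proof -
  define u p where "u i = real (card (nonnbrs V E cl v i))" and "p i = real (card (nbrs V E cl v i))" for i
  have nn: "0 \<le> u i" "0 \<le> p i" for i by (simp_all add: u_def p_def)
  have up: "u i + p i \<le> \<sigma>" if "i \<in> {0, 1, 2}" for i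
    using cell_split[OF assms(1), of E cl v i] size[OF that] unfolding u_def p_def by linarith
  have ch: "real (k choose 2) \<le> (real k)\<^sup>2 / 2" for k
    by (simp add: real_choose_two power2_eq_square algebra_simps)
  have "real (card (vertex_family V E cl v)) \<le>
      real (card (nonnbrs V E cl v 0) * (card (nonnbrs V E cl v 1) choose 2) * (card (nonnbrs V E cl v 2) choose 2) +
      (card (nonnbrs V E cl v 0) choose 2) * card (nonnbrs V E cl v 1) * (card (nbrs V E cl v 2) choose 2) +
      (card (nonnbrs V E cl v 0) choose 2) * (card (nbrs V E cl v 1) choose 2) * card (nonnbrs V E cl v 2))"
    by (rule of_nat_mono) (rule card_vertex_family[OF assms(1)])
  also have "\<dots> \<le> u 0 * ((u 1)\<^sup>2 / 2) * ((u 2)\<^sup>2 / 2) + ((u 0)\<^sup>2 / 2) * u 1 * ((p 2)\<^sup>2 / 2) +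
      ((u 0)\<^sup>2 / 2) * ((p 1)\<^sup>2 / 2) * u 2"
    unfolding of_nat_add of_nat_mult u_def p_def by (intro add_mono mult_mono ch) auto
  also have "\<dots> = (u 0 * (u 1)\<^sup>2 * (u 2)\<^sup>2 + (u 0)\<^sup>2 * u 1 * (p 2)\<^sup>2 + (u 0)\<^sup>2 * (p 1)\<^sup>2 * u 2) / 4"
    by (simp add: field_simps)
  also have "\<dots> \<le> \<sigma> ^ 5 * (1 - g / (8 * \<sigma>)) / 4"
  proof (intro divide_right_mono profile_bound[where ?p0.0 = "p 0"] assms(3,4) nn up)
    show "g \<le> p 0 + p 1 + p 2" "g \<le> p 0 + p 1 + u 2" "g \<le> p 0 + u 1 + p 2"
      using deg[of 0] deg[of 1] deg[of 2] wdeg_nbrs[OF assms(1) cl, of E v] by (simp_all add: u_def p_def)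
  qed auto
  finally show ?thesis .
qed

lemma two_subsets_over:
  fixes m :: real
  assumes "finite X" "0 \<le> m" "m \<le> real (card X) - 1"
  shows "T \<inter> X = {} \<Longrightarrow> m\<^sup>2 / 2 \<le> real (card {P \<in> two_subsets X. T \<inter> X \<subseteq> P})"
    "T \<inter> X = {x} \<Longrightarrow> m \<le> real (card {P \<in> two_subsets X. T \<inter> X \<subseteq> P})"
    "T \<inter> X = {x, y} \<Longrightarrow> x \<noteq> y \<Longrightarrow> 1 \<le> real (card {P \<in> two_subsets X. T \<inter> X \<subseteq> P})"
proof -
  assume "T \<inter> X = {}"
  moreover have "m * m \<le> real (card X) * (real (card X) - 1)" using assms by (intro mult_mono) auto
  ultimately show "m\<^sup>2 / 2 \<le> real (card {P \<in> two_subsets X. T \<inter> X \<subseteq> P})"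
    using assms by (simp add: card_two_subsets real_choose_two power2_eq_square)
next
  assume T: "T \<inter> X = {x}"
  then have "x \<in> X" by blast
  then have "card X \<ge> 1" using assms(1) by (metis One_nat_def Suc_leI card_gt_0_iff empty_iff)
  then show "m \<le> real (card {P \<in> two_subsets X. T \<inter> X \<subseteq> P})"
    using assms card_two_subsets_containing[OF assms(1) \<open>x \<in> X\<close>] by (simp add: T of_nat_diff)
next
  assume T: "T \<inter> X = {x, y}" "x \<noteq> y"
  then have "{x, y} \<in> {P \<in> two_subsets X. T \<inter> X \<subseteq> P}" by (auto intro!: two_subsetsI)
  then have "card {P \<in> two_subsets X. T \<inter> X \<subseteq> P} > 0"
    using finite_two_subsets[OF assms(1)] by (auto simp: card_gt_0_iff)
  then show "1 \<le> real (card {P \<in> two_subsets X. T \<inter> X \<subseteq> P})" by simp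
qed

lemma blow_copies_over_vertex:
  fixes m :: real
  assumes "finite V" and cl: "cl ` V \<subseteq> {0, 1, 2}" and "v \<in> V" "0 \<le> m"
    and size: "\<And>i. i \<in> {0, 1, 2} \<Longrightarrow> m \<le> real (card (cell V cl i)) - 1"
  shows "m ^ 5 / 4 \<le> real (card {S \<in> copies V (blow cl). {v} \<subseteq> S})"
proof -
  define c where "c i = real (card {P \<in> two_subsets (cell V cl i). {v} \<inter> cell V cl i \<subseteq> P})" for i
  define b where "b i = (if cl v = i then m else m\<^sup>2 / 2)" for i
  have le: "b i \<le> c i" if "i \<in> {0, 1, 2}" for i
  proof (cases "cl v = i")
    case True
    then have "{v} \<inter> cell V cl i = {v}" using assms(3) by (auto simp: cell_def)
    then show ?thesis using two_subsets_over(2)[OF finite_cell[OF assms(1)] assms(4) size[OF that], of "{v}" v] True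
      by (simp add: b_def c_def)
  next
    case False
    then have "{v} \<inter> cell V cl i = {}" by (auto simp: cell_def)
    then show ?thesis using two_subsets_over(1)[OF finite_cell[OF assms(1)] assms(4) size[OF that], of "{v}"] False
      by (simp add: b_def c_def)
  qed
  have b0: "0 \<le> b i" for i using assms(4) by (simp add: b_def)
  have "cl v = 0 \<or> cl v = 1 \<or> cl v = 2" using cl assms(3) by blast
  then have "m ^ 5 / 4 = b 0 * b 1 * b 2" by (elim disjE) (simp_all add: b_def eval_nat_numeral)
  also have "\<dots> \<le> c 0 * c 1 * c 2"
    using le b0 order.trans[OF b0 le] by (intro mult_mono mult_nonneg_nonneg) auto
  also have "\<dots> = real (card {S \<in> copies V (blow cl). {v} \<subseteq> S})"
    using assms(3) by (subst card_supersets_join3[OF assms(1) cl]) (simp_all add: c_def)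
  finally show ?thesis .
qed

lemma blow_copies_over_pair:
  fixes m :: real
  assumes "finite V" and cl: "cl ` V \<subseteq> {0, 1, 2}" and "x \<in> V" "y \<in> V" "x \<noteq> y" "0 \<le> m"
    and size: "\<And>i. i \<in> {0, 1, 2} \<Longrightarrow> m \<le> real (card (cell V cl i)) - 1"
  shows "m ^ 4 / 4 \<le> real (card {S \<in> copies V (blow cl). {x, y} \<subseteq> S})"
proof -
  define c where "c i = real (card {P \<in> two_subsets (cell V cl i). {x, y} \<inter> cell V cl i \<subseteq> P})" for i
  define b where "b i = (if cl x = i then if cl y = i then 1 else m else if cl y = i then m else m\<^sup>2 / 2)" for i
  have le: "b i \<le> c i" if "i \<in> {0, 1, 2}" for i
  proof -
    note over = two_subsets_over[OF finite_cell[OF assms(1)] assms(6) size[OF that], of "{x, y}"]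
    have int: "{x, y} \<inter> cell V cl i = (if cl x = i then {x} else {}) \<union> (if cl y = i then {y} else {})"
      using assms(3,4) by (auto simp: cell_def)
    show ?thesis
    proof (cases "cl x = i"; cases "cl y = i")
      assume "cl x = i" "cl y = i"
      then show ?thesis using over(3)[of x y] int assms(5) by (simp add: b_def c_def insert_commute)
    next
      assume "cl x = i" "cl y \<noteq> i"
      then show ?thesis using over(2)[of x] int by (simp add: b_def c_def)
    next
      assume "cl x \<noteq> i" "cl y = i"
      then show ?thesis using over(2)[of y] int by (simp add: b_def c_def)
    next
      assume "cl x \<noteq> i" "cl y \<noteq> i"
      then show ?thesis using over(1) int by (simp add: b_def c_def)
    qed
  qed
  have b0: "0 \<le> b i" for i using assms(6) by (simp add: b_def)
  have "cl x = 0 \<or> cl x = 1 \<or> cl x = 2" "cl y = 0 \<or> cl y = 1 \<or> cl y = 2" using cl assms(3,4) by blast+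
  then have "m ^ 4 / 4 \<le> b 0 * b 1 * b 2"
    by (elim disjE) (simp_all add: b_def eval_nat_numeral assms(6) mult_nonneg_nonneg)
  also have "\<dots> \<le> c 0 * c 1 * c 2"
    using le b0 order.trans[OF b0 le] by (intro mult_mono mult_nonneg_nonneg) auto
  also have "\<dots> = real (card {S \<in> copies V (blow cl). {x, y} \<subseteq> S})"
    using assms(3,4) by (subst card_supersets_join3[OF assms(1) cl]) (simp_all add: c_def)
  finally show ?thesis .
qed

text \<open>The property that every vertex is in its best class survives corrections: a corrected pair at \<open>v\<close> was wrong for
the present class of \<open>v\<close>, so the count for that class drops by at least as much as the count for any other.\<close>

lemma wdeg_correct:
  assumes "finite V" and opt: "wdeg V E cl v (cl v) \<le> wdeg V E cl v j"
  shows "wdeg V (correct E cl R) cl v (cl v) \<le> wdeg V (correct E cl R) cl v j"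
proof -
  define A where "A i = {u \<in> V - {v}. E v u \<noteq> part_edge i (cl u)}" for i
  define K where "K = {u \<in> A (cl v). R v u}"
  have fin: "finite (A i)" "finite K" for i using assms(1) by (simp_all add: A_def K_def)
  have "{u \<in> V - {v}. correct E cl R v u \<noteq> part_edge (cl v) (cl u)} = A (cl v) - K"
    by (auto simp: A_def K_def correct_def)
  then have "wdeg V (correct E cl R) cl v (cl v) = card (A (cl v)) - card K"
    unfolding wdeg_def by (simp add: card_Diff_subset fin K_def)
  also have "\<dots> \<le> card (A j) - card K" using opt unfolding wdeg_def A_def by (rule diff_le_mono)
  also have "\<dots> \<le> card (A j - K)" by (rule diff_card_le_card_Diff) (rule fin)
  also have "\<dots> \<le> wdeg V (correct E cl R) cl v j"
    unfolding wdeg_def by (rule card_mono) (use assms(1) in \<open>auto simp: A_def K_def correct_def\<close>)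
  finally show ?thesis .
qed

lemma wrong_correct: "wrong V (correct E cl R) cl = {p \<in> wrong V E cl. \<not> R (fst p) (snd p)}"
  by (auto simp: wrong_def correct_def)

lemma correct_sym:
  assumes "\<And>x y. E x y = E y x" "\<And>x y. R x y = R y x"
  shows "correct E cl R x y = correct E cl R y x"
  using assms part_edge_commute[of "cl x" "cl y"] by (simp add: correct_def)

lemma correct_irrefl: "(\<And>x. \<not> E x x) \<Longrightarrow> \<not> correct E cl R x x"
  by (simp add: correct_def part_edge_irrefl)

section \<open>Local stability\<close>

text \<open>Induction on the number of wrong pairs, correcting a vertex in at least \<open>n/2000\<close> wrong pairs if there
is one, and a single pair otherwise. The threshold has to be so small that the sets counted by
\<open>bad_over\<close> are negligible against the new copies; the deviation of the part sizes and the number of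
wrong pairs then have to be small against the deficit from \<open>profile_bound\<close> at this threshold.\<close>

theorem local_stability:
  fixes E :: "'a \<Rightarrow> 'a \<Rightarrow> bool"
  assumes finV: "finite V" and cl: "cl ` V \<subseteq> {0, 1, 2}"
    and sym: "\<And>x y. E x y = E y x" and irr: "\<And>x. \<not> E x x"
    and n: "n = real (card V)" "10 ^ 6 \<le> n"
    and size: "\<And>i. i \<in> {0, 1, 2} \<Longrightarrow> (1 / 3 - 1 / 10 ^ 6) * n \<le> real (card (cell V cl i))"
      "\<And>i. i \<in> {0, 1, 2} \<Longrightarrow> real (card (cell V cl i)) \<le> (1 / 3 + 1 / 10 ^ 6) * n"
    and few: "real (card (wrong V E cl)) \<le> n\<^sup>2 / 10 ^ 8"
    and opt: "\<And>v j. v \<in> V \<Longrightarrow> j \<in> {0, 1, 2} \<Longrightarrow> wdeg V E cl v (cl v) \<le> wdeg V E cl v j"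
  shows "real (card (copies V E)) + real (card (wrong V E cl)) * n ^ 4 / (2 * 10 ^ 7) \<le> real (card (copies V (blow cl)))"
  using sym irr few opt
proof (induction "card (wrong V E cl)" arbitrary: E rule: less_induct)
  case less
  note sym = less.prems(1) and irr = less.prems(2) and few = less.prems(3) and opt = less.prems(4)
  define w where "w = real (card (wrong V E cl))"
  define m where "m = (1 / 3 - 2 / 10 ^ 6) * n"
  define \<sigma> where "\<sigma> = (1 / 3 + 1 / 10 ^ 6) * n"
  have n0: "0 < n" using n(2) by (rule less_le_trans[rotated]) simp
  have m0: "0 \<le> m" using n0 by (simp add: m_def)
  have m_size: "m \<le> real (card (cell V cl i)) - 1" if "i \<in> {0, 1, 2}" for i
  proof -
    have "m + 1 \<le> (1 / 3 - 1 / 10 ^ 6) * n" using n(2) by (simp add: m_def algebra_simps)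
    then show ?thesis using size(1)[OF that] by linarith
  qed
  have fin: "finite (wrong V E cl)" by (rule finite_wrong[OF finV])
  show ?case
  proof (cases "wrong V E cl = {}")
    case True
    have "copies V E = copies V (blow cl)"
    proof (intro set_eqI)
      fix S
      show "S \<in> copies V E \<longleftrightarrow> S \<in> copies V (blow cl)"
      proof (cases "S \<subseteq> V")
        case SV: True
        show ?thesis by (rule copies_cong) (use True SV in \<open>auto simp: wrong_def\<close>)
      qed (simp add: copies_def)
    qed
    then show ?thesis using True by simp
  next
    case nonempty: False
    show ?thesis
    proof (cases "\<exists>v\<in>V. n / 2000 \<le> real (wdeg V E cl v (cl v))")
      case True
      then obtain v where v: "v \<in> V" "n / 2000 \<le> real (wdeg V E cl v (cl v))" by blast
      define R where "R = (\<lambda>p q. p = v \<or> q = v)"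
      define E' where "E' = correct E cl R"
      have W': "wrong V E' cl = {p \<in> wrong V E cl. \<not> R (fst p) (snd p)}"
        unfolding E'_def by (rule wrong_correct)
      have removed: "{p \<in> wrong V E cl. R (fst p) (snd p)} \<subseteq> Pair v ` V \<union> (\<lambda>u. (u, v)) ` V"
        by (auto simp: R_def wrong_def)
      have "card {p \<in> wrong V E cl. R (fst p) (snd p)} \<le> card (Pair v ` V \<union> (\<lambda>u. (u, v)) ` V)"
        by (rule card_mono[OF _ removed]) (use finV in simp)
      also have "\<dots> \<le> card (Pair v ` V) + card ((\<lambda>u. (u, v)) ` V)" by (rule card_Un_le)
      also have "\<dots> \<le> card V + card V" by (intro add_mono card_image_le finV)
      finally have rem_le: "real (card {p \<in> wrong V E cl. R (fst p) (snd p)}) \<le> 2 * n"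
        using n(1) by simp
      have split: "card (wrong V E cl) = card (wrong V E' cl) + card {p \<in> wrong V E cl. R (fst p) (snd p)}"
        unfolding W' by (subst card_Un_disjoint[symmetric]) (use fin in \<open>auto intro!: arg_cong[where f = card]\<close>)
      have "wdeg V E cl v (cl v) > 0" using v n0 by (intro Suc_leI gr0I) auto
      then obtain u where u: "u \<in> V" "u \<noteq> v" "E v u \<noteq> blow cl v u"
        unfolding wdeg_def by (auto simp: card_gt_0_iff)
      then have "(v, u) \<in> {p \<in> wrong V E cl. R (fst p) (snd p)}"
        using v(1) by (simp add: wrong_def R_def)
      then have "card {p \<in> wrong V E cl. R (fst p) (snd p)} > 0"
        using fin by (auto simp: card_gt_0_iff)
      then have smaller: "card (wrong V E' cl) < card (wrong V E cl)" using split by simp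
      have IH: "real (card (copies V E')) + real (card (wrong V E' cl)) * n ^ 4 / (2 * 10 ^ 7) \<le> real (card (copies V (blow cl)))"
      proof (rule less.hyps[OF smaller])
        show "E' x y = E' y x" for x y unfolding E'_def by (rule correct_sym) (auto simp: sym R_def)
        show "\<not> E' x x" for x unfolding E'_def by (rule correct_irrefl) (rule irr)
        show "real (card (wrong V E' cl)) \<le> n\<^sup>2 / 10 ^ 8" using few smaller by linarith
        show "wdeg V E' cl x (cl x) \<le> wdeg V E' cl x j" if "x \<in> V" "j \<in> {0, 1, 2}" for x j
          unfolding E'_def by (rule wdeg_correct[OF finV opt[OF that]])
      qed
      have gain: "real (card (copies V E)) + real (card {S \<in> copies V (blow cl). {v} \<subseteq> S}) \<le>
          real (card (copies V E')) + real (card (vertex_family V E cl v)) + 2 * real (card (bad_at V E cl v))"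
        using of_nat_mono[OF vertex_gain[of V cl E v, OF finV cl sym irr v(1)]]
        unfolding E'_def R_def by simp
      have deg: "n / 2000 \<le> real (wdeg V E cl v j)" if "j \<in> {0, 1, 2}" for j
        using v opt[OF v(1) that] by linarith
      have "real (card (vertex_family V E cl v)) \<le> \<sigma> ^ 5 * (1 - (n / 2000) / (8 * \<sigma>)) / 4"
        by (rule vertex_family_bound[OF finV cl _ _ _ deg]) (use size n0 in \<open>auto simp: \<sigma>_def\<close>)
      (* The degree bound n/2000 is divided by 8 sigma, and sigma is less than 7n/20. *)
      also have "\<dots> \<le> \<sigma> ^ 5 * (1 - 1 / 5600) / 4"
        using n0 by (intro divide_right_mono mult_left_mono) (auto simp: \<sigma>_def field_simps)
      finally have fam: "real (card (vertex_family V E cl v)) \<le> \<sigma> ^ 5 * (1 - 1 / 5600) / 4" .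
      have "real (card (bad_at V E cl v)) \<le> real (card (wrong V E cl)) * n ^ 3"
        using of_nat_mono[OF card_bad_at[of V v E cl, OF finV v(1) irr]] n(1) by simp
      also have "\<dots> \<le> n\<^sup>2 / 10 ^ 8 * n ^ 3" using few n0 by (intro mult_right_mono) auto
      finally have bad: "real (card (bad_at V E cl v)) \<le> n ^ 5 / 10 ^ 8" by (simp add: eval_nat_numeral)
      have over: "m ^ 5 / 4 \<le> real (card {S \<in> copies V (blow cl). {v} \<subseteq> S})"
        by (rule blow_copies_over_vertex[OF finV cl v(1) m0 m_size])
      have num: "n ^ 5 / 10 ^ 7 \<le> m ^ 5 / 4 - \<sigma> ^ 5 * (1 - 1 / 5600) / 4 - 2 * (n ^ 5 / 10 ^ 8)"
      proof -
        define p q :: real where "p = (1 / 3 - 2 / 10 ^ 6) ^ 5" and "q = (1 / 3 + 1 / 10 ^ 6) ^ 5"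
        (* The relative deficit 1/5600 exceeds the relative error of about 45/10^6 from the part sizes. *)
        have "1 / 10 ^ 7 \<le> p / 4 - q * (1 - 1 / 5600) / 4 - 2 / 10 ^ 8"
          by (simp add: p_def q_def power_divide)
        then have "1 / 10 ^ 7 * n ^ 5 \<le> (p / 4 - q * (1 - 1 / 5600) / 4 - 2 / 10 ^ 8) * n ^ 5"
          using n0 by (intro mult_right_mono) auto
        moreover have "m ^ 5 = p * n ^ 5" "\<sigma> ^ 5 = q * n ^ 5"
          by (simp_all only: m_def \<sigma>_def p_def q_def power_mult_distrib)
        ultimately show ?thesis by (simp add: algebra_simps)
      qed
      have "real (card (wrong V E cl)) * n ^ 4 / (2 * 10 ^ 7) \<le>
          real (card (wrong V E' cl)) * n ^ 4 / (2 * 10 ^ 7) + n ^ 5 / 10 ^ 7"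
      proof -
        have "real (card (wrong V E cl)) \<le> real (card (wrong V E' cl)) + 2 * n"
          using split rem_le by linarith
        then have "real (card (wrong V E cl)) * n ^ 4 \<le> (real (card (wrong V E' cl)) + 2 * n) * n ^ 4"
          using n0 by (intro mult_right_mono) auto
        then show ?thesis by (simp add: field_simps eval_nat_numeral)
      qed
      then show ?thesis using IH gain fam bad over num by linarith
    next
      case False
      obtain x y where xy: "(x, y) \<in> wrong V E cl" using nonempty by auto
      have xyV: "x \<in> V" "y \<in> V" "x \<noteq> y" using xy wrong_neq[OF irr xy] by (auto simp: wrong_def)
      define R where "R = (\<lambda>p q. {p, q} = {x, y})"
      define E' where "E' = correct E cl R"
      have yx: "(y, x) \<in> wrong V E cl" by (rule wrong_sym[OF sym xy])
      have W': "wrong V E' cl = wrong V E cl - {(x, y), (y, x)}"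
        unfolding E'_def wrong_correct by (auto simp: R_def doubleton_eq_iff)
      have two: "card {(x, y), (y, x)} = 2" using xyV by simp
      have "card (wrong V E' cl) = card (wrong V E cl) - 2"
        unfolding W' using xy yx two by (subst card_Diff_subset) auto
      moreover have "2 \<le> card (wrong V E cl)"
        using card_mono[OF fin, of "{(x, y), (y, x)}"] xy yx two by simp
      ultimately have split: "card (wrong V E cl) = card (wrong V E' cl) + 2" by simp
      then have smaller: "card (wrong V E' cl) < card (wrong V E cl)" by simp
      have IH: "real (card (copies V E')) + real (card (wrong V E' cl)) * n ^ 4 / (2 * 10 ^ 7) \<le> real (card (copies V (blow cl)))"
      proof (rule less.hyps[OF smaller])
        show "E' p q = E' q p" for p q unfolding E'_def by (rule correct_sym) (auto simp: sym R_def insert_commute)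
        show "\<not> E' p p" for p unfolding E'_def by (rule correct_irrefl) (rule irr)
        show "real (card (wrong V E' cl)) \<le> n\<^sup>2 / 10 ^ 8" using few smaller by linarith
        show "wdeg V E' cl p (cl p) \<le> wdeg V E' cl p j" if "p \<in> V" "j \<in> {0, 1, 2}" for p j
          unfolding E'_def by (rule wdeg_correct[OF finV opt[OF that]])
      qed
      have gain: "real (card (copies V E)) + real (card {S \<in> copies V (blow cl). {x, y} \<subseteq> S}) \<le>
          real (card (copies V E')) + 2 * real (card (bad_over V E cl x y))"
        using of_nat_mono[OF edge_gain[of V cl E x y, OF finV cl sym irr xy]]
        unfolding E'_def R_def by simp
      have over: "m ^ 4 / 4 \<le> real (card {S \<in> copies V (blow cl). {x, y} \<subseteq> S})"
        by (rule blow_copies_over_pair[OF finV cl xyV m0 m_size])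
      have "real (card (bad_over V E cl x y)) \<le>
          (real (wdeg V E cl x (cl x)) + real (wdeg V E cl y (cl y))) * n ^ 3 + real (card (wrong V E cl)) * n\<^sup>2"
        using of_nat_mono[OF card_bad_over[of V x y E cl, OF finV xyV sym irr]] n(1) by simp
      also have "\<dots> \<le> (n / 2000 + n / 2000) * n ^ 3 + n\<^sup>2 / 10 ^ 8 * n\<^sup>2"
        using False xyV few n0 by (intro add_mono mult_right_mono) (auto intro: less_imp_le simp: not_le)
      finally have bad: "real (card (bad_over V E cl x y)) \<le> n ^ 4 * (1 / 1000 + 1 / 10 ^ 8)"
        by (simp add: eval_nat_numeral algebra_simps)
      have num: "n ^ 4 / 10 ^ 7 \<le> m ^ 4 / 4 - 2 * (n ^ 4 * (1 / 1000 + 1 / 10 ^ 8))"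
      proof -
        define p :: real where "p = (1 / 3 - 2 / 10 ^ 6) ^ 4"
        (* A pair is in about n^4/324 or more copies of the blowup, against twice about n^4/1000 bad sets. *)
        have "1 / 10 ^ 7 \<le> p / 4 - 2 * (1 / 1000 + 1 / 10 ^ 8)"
          by (simp add: p_def power_divide)
        then have "1 / 10 ^ 7 * n ^ 4 \<le> (p / 4 - 2 * (1 / 1000 + 1 / 10 ^ 8)) * n ^ 4"
          using n0 by (intro mult_right_mono) auto
        moreover have "m ^ 4 = p * n ^ 4"
          by (simp only: m_def p_def power_mult_distrib)
        ultimately show ?thesis by (simp add: algebra_simps)
      qed
      have "real (card (wrong V E cl)) * n ^ 4 / (2 * 10 ^ 7) =
          real (card (wrong V E' cl)) * n ^ 4 / (2 * 10 ^ 7) + n ^ 4 / 10 ^ 7"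
        unfolding split by (simp add: field_simps)
      then show ?thesis using IH gain bad over num by linarith
    qed
  qed
qed

section \<open>Graphs, densities and edit distance\<close>

definition adj :: "'a ugraph \<Rightarrow> 'a \<Rightarrow> 'a \<Rightarrow> bool" where
  "adj G u v \<longleftrightarrow> {u, v} \<in> edges G"

lemma adj_commute: "adj G u v = adj G v u"
  by (simp add: adj_def insert_commute)

lemma adj_irrefl: "simple_graph G \<Longrightarrow> \<not> adj G u u"
  by (auto simp: adj_def simple_graph_def)

lemma is_iso_inverse:
  assumes "is_iso f F G"
  shows "is_iso (inv_into (verts F) f) G F"
proof -
  have bij: "bij_betw f (verts F) (verts G)"
    and edge: "\<And>x y. x \<in> verts F \<Longrightarrow> y \<in> verts F \<Longrightarrow> {x, y} \<in> edges F \<longleftrightarrow> {f x, f y} \<in> edges G"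
    using assms by (auto simp: is_iso_def)
  have inv: "inv_into (verts F) f x \<in> verts F \<and> f (inv_into (verts F) f x) = x" if "x \<in> verts G" for x
    using bij that by (metis bij_betw_imp_surj_on f_inv_into_f inv_into_into)
  show ?thesis
    unfolding is_iso_def using bij_betw_inv_into[OF bij] inv edge by auto
qed

lemma isomorphic_commute: "isomorphic F G \<longleftrightarrow> isomorphic G F"
  unfolding isomorphic_def by (intro iffI; elim exE; intro exI; erule is_iso_inverse)

lemma F14_edge: "{i, j} \<in> edges F14 \<longleftrightarrow> (i = 0 \<or> i = 1) \<and> (j = 2 \<or> j = 5) \<or> (j = 0 \<or> j = 1) \<and> (i = 2 \<or> i = 5)"
  by (auto simp: F14_def nat_graph_def doubleton_eq_iff)
lemma less6: "(i::nat) < 6 \<Longrightarrow> i = 0 \<or> i = 1 \<or> i = 2 \<or> i = 3 \<or> i = 4 \<or> i = 5" by linarith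
lemma labelled_copy_edges:
  fixes A :: "'a \<Rightarrow> 'a \<Rightarrow> bool"
  assumes sq: "labelled_copy A a b c d e f" and sym: "\<And>x y. A x y = A y x" and irr: "\<And>x. \<not> A x x"
    and g: "g 0 = a" "g 1 = c" "g 2 = b" "g 3 = e" "g 4 = f" "g 5 = d" and i: "i < 6" and j: "j < (6::nat)"
  shows "A (g i) (g j) \<longleftrightarrow> {i, j} \<in> edges F14"
proof -
  have E: "A a b" "A a d" "A c b" "A c d" "\<not> A a c" "\<not> A b d" "\<not> A a e" "\<not> A b e" "\<not> A c e"
    "\<not> A d e" "\<not> A a f" "\<not> A b f" "\<not> A c f" "\<not> A d f" "\<not> A e f"
    using sq by (simp_all add: labelled_copy_def)
  have E2: "A b a" "A d a" "A b c" "A d c" "\<not> A c a" "\<not> A d b" "\<not> A e a" "\<not> A e b" "\<not> A e c"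
    "\<not> A e d" "\<not> A f a" "\<not> A f b" "\<not> A f c" "\<not> A f d" "\<not> A f e"
    using E sym by blast+
  show ?thesis
    unfolding F14_edge
    using less6[OF i] less6[OF j] by (elim disjE; simp only: g E E2 irr; simp)
qed
text \<open>The vertices 0, 2, 1, 5 of \<open>F14\<close> form the 4-cycle in this cyclic order, and 3 and 4 are isolated.\<close>

lemma copies_iff_isomorphic:
  assumes "S \<subseteq> verts G" "card S = 6" and simple: "simple_graph G"
  shows "isomorphic (induced_subgraph G S) F14 \<longleftrightarrow> S \<in> copies (verts G) (adj G)"
proof
  assume "isomorphic (induced_subgraph G S) F14"
  then obtain g where g: "is_iso g F14 (induced_subgraph G S)"
    unfolding isomorphic_commute[of "induced_subgraph G S"] by (auto simp: isomorphic_def)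
  have bij: "bij_betw g {0..<6} S"
    using g by (simp add: is_iso_def F14_def nat_graph_def induced_subgraph_def)
  have S: "S = {g 0, g 2, g 1, g 5, g 3, g 4}"
  proof -
    have "S = g ` {0..<6}" using bij by (simp add: bij_betw_def)
    also have "{0..<6} = {0, 2, 1, 5, 3, 4 :: nat}" by auto
    finally show ?thesis by simp
  qed
  have adj: "adj G (g i) (g j) \<longleftrightarrow> {i, j} \<in> edges F14" if "i < 6" "j < 6" for i j
  proof -
    have "g i \<in> S" "g j \<in> S" using bij that by (auto simp: bij_betw_def)
    then show ?thesis
      using g that by (auto simp: is_iso_def adj_def induced_subgraph_def F14_def nat_graph_def)
  qed
  have "labelled_copy (adj G) (g 0) (g 2) (g 1) (g 5) (g 3) (g 4)"
    by (simp add: labelled_copy_def adj) (simp add: F14_def nat_graph_def doubleton_eq_iff)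
  then show "S \<in> copies (verts G) (adj G)"
    unfolding copies_def mem_Collect_eq using assms S by (intro conjI exI)
next
  assume "S \<in> copies (verts G) (adj G)"
  then obtain a b c d e f where abc: "S = {a, b, c, d, e, f}" and sq: "labelled_copy (adj G) a b c d e f"
    unfolding copies_def mem_Collect_eq by (elim conjE exE) (rule that)
  have dist: "distinct [a, b, c, d, e, f]" using distinct_if_card_6[OF assms(2)[unfolded abc]] .
  define g where "g = (\<lambda>i. [a, c, b, e, f, d] ! i)"
  have bij: "bij_betw g {0..<6} S"
    unfolding g_def
  proof (rule bij_betw_nth)
    show "distinct [a, c, b, e, f, d]" using dist by auto
    show "S = set [a, c, b, e, f, d]" unfolding abc by auto
  qed (simp add: lessThan_atLeast0 eval_nat_numeral)
  have "{i, j} \<in> edges F14 \<longleftrightarrow> {g i, g j} \<in> edges (induced_subgraph G S)" if "i < 6" "j < 6" for i j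
  proof -
    have "g i \<in> S" "g j \<in> S" using bij that by (auto simp: bij_betw_def)
    then have "{g i, g j} \<in> edges (induced_subgraph G S) \<longleftrightarrow> adj G (g i) (g j)"
      by (simp add: induced_subgraph_def adj_def)
    moreover have "adj G (g i) (g j) \<longleftrightarrow> {i, j} \<in> edges F14"
      by (rule labelled_copy_edges[OF sq adj_commute adj_irrefl[OF simple]]) (use that in \<open>simp_all add: g_def\<close>)
    ultimately show ?thesis by simp
  qed
  then have "is_iso g F14 (induced_subgraph G S)"
    using bij by (simp add: is_iso_def F14_def nat_graph_def induced_subgraph_def)
  then show "isomorphic (induced_subgraph G S) F14"
    unfolding isomorphic_commute[of "induced_subgraph G S"] by (auto simp: isomorphic_def)
qed

lemma ind_density_F14:
  assumes "simple_graph G"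
  shows "ind_density F14 G = real (card (copies (verts G) (adj G))) / real (card (verts G) choose 6)"
proof -
  have six: "card (verts F14) = 6" by (simp add: F14_def nat_graph_def)
  have "{S. S \<subseteq> verts G \<and> card S = 6 \<and> isomorphic (induced_subgraph G S) F14} = copies (verts G) (adj G)"
  proof -
    have "S \<subseteq> verts G \<and> card S = 6" if "S \<in> copies (verts G) (adj G)" for S
      using that by (simp add: copies_def)
    then show ?thesis using copies_iff_isomorphic[OF _ _ assms] by blast
  qed
  then show ?thesis by (simp add: ind_density_def six)
qed

lemma finite_densities: "finite {ind_density F14 G | G :: nat ugraph. simple_graph G \<and> card (verts G) = n}"
proof (rule finite_subset)
  show "{ind_density F14 G | G :: nat ugraph. simple_graph G \<and> card (verts G) = n} \<subseteq>
      (\<lambda>k. real k / real (n choose 6)) ` {..2 ^ n}"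
  proof clarify
    fix G :: "nat ugraph" assume "simple_graph G" "n = card (verts G)"
    then have "card (copies (verts G) (adj G)) \<le> card (Pow (verts G))"
      by (intro card_mono) (auto simp: simple_graph_def copies_def)
    then show "ind_density F14 G \<in> (\<lambda>k. real k / real (card (verts G) choose 6)) ` {..2 ^ card (verts G)}"
      using \<open>simple_graph G\<close> by (auto simp: ind_density_F14 card_Pow simple_graph_def)
  qed
qed simp

lemma density_le_max:
  fixes G :: "nat ugraph"
  assumes "simple_graph G" "card (verts G) = n"
  shows "ind_density F14 G \<le> max_density F14 n"
  unfolding max_density_def by (rule Max_ge[OF finite_densities]) (use assms in blast)

lemma max_density_attained:
  obtains G :: "nat ugraph" where "simple_graph G" "card (verts G) = n" "max_density F14 n = ind_density F14 G"
proof -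
  have "simple_graph (Graph {0..<n} {})" "card (verts (Graph {0..<n} {})) = n"
    by (simp_all add: simple_graph_def)
  then have "{ind_density F14 G | G :: nat ugraph. simple_graph G \<and> card (verts G) = n} \<noteq> {}" by blast
  from Max_in[OF finite_densities this] show thesis using that unfolding max_density_def by blast
qed

lemma blowup_parts_B14:
  assumes "blowup_parts B14 W"
  shows "finite (W 0)" "finite (W 1)" "finite (W 2)"
    "W 0 \<inter> W 1 = {}" "W 0 \<inter> W 2 = {}" "W 1 \<inter> W 2 = {}"
  using assms by (auto simp: blowup_parts_def B14_def nat_graph_def disjoint_family_on_def)

text \<open>The class of a vertex of the blowup; vertices outside \<open>W 1\<close> and \<open>W 2\<close> get class 0, also those outside
the graph.\<close>

definition part_index :: "(nat \<Rightarrow> nat set) \<Rightarrow> nat \<Rightarrow> nat" where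
  "part_index W v = (if v \<in> W 1 then 1 else if v \<in> W 2 then 2 else 0)"

lemma blowup_B14:
  fixes W :: "nat \<Rightarrow> nat set"
  assumes "blowup_parts B14 W"
  defines "G \<equiv> blowup B14 W"
  defines "cl \<equiv> part_index W"
  shows "simple_graph G" "verts G = W 0 \<union> W 1 \<union> W 2" "cell (verts G) cl i = (if i < 3 then W i else {})"
    "u \<in> verts G \<Longrightarrow> v \<in> verts G \<Longrightarrow> adj G u v \<longleftrightarrow> blow cl u v"
proof -
  have three: "{0..<3} = {0, 1, 2 :: nat}" by auto
  have fin: "finite (W 0)" "finite (W 1)" "finite (W 2)"
    and disj: "W 0 \<inter> W 1 = {}" "W 0 \<inter> W 2 = {}" "W 1 \<inter> W 2 = {}"
    by (rule blowup_parts_B14[OF assms(1)])+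
  show V: "verts G = W 0 \<union> W 1 \<union> W 2"
    by (simp add: G_def blowup_def B14_def nat_graph_def three Un_assoc)
  have E: "e \<in> edges G \<longleftrightarrow> (\<exists>x\<in>W 1. \<exists>y\<in>W 2. e = {x, y})" for e
  proof
    assume "e \<in> edges G"
    then obtain x y i j where "e = {x, y}" "x \<in> W i" "y \<in> W j" "{i, j} = {1, 2}"
      by (auto simp: G_def blowup_def B14_def nat_graph_def)
    then show "\<exists>x\<in>W 1. \<exists>y\<in>W 2. e = {x, y}" by (auto simp: doubleton_eq_iff insert_commute)
  next
    assume "\<exists>x\<in>W 1. \<exists>y\<in>W 2. e = {x, y}"
    then obtain x y where xy: "x \<in> W 1" "y \<in> W 2" "e = {x, y}" by blast
    then have "x \<noteq> y" using disj by blast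
    then show "e \<in> edges G" unfolding G_def blowup_def B14_def nat_graph_def ugraph.sel
      using xy three by (intro CollectI exI[of _ x] exI[of _ y] exI[of _ 1] exI[of _ 2]) simp
  qed
  show "simple_graph G"
    unfolding simple_graph_def
  proof (intro conjI ballI)
    show "finite (verts G)" unfolding V using fin by simp
    fix e assume "e \<in> edges G"
    then obtain x y where xy: "x \<in> W 1" "y \<in> W 2" "e = {x, y}" unfolding E by blast
    then show "e \<subseteq> verts G" unfolding V by blast
    have "x \<noteq> y" using xy disj by blast
    then show "card e = 2" using xy by simp
  qed
  show "cell (verts G) cl i = (if i < 3 then W i else {})"
  proof -
    consider "i = 0" | "i = 1" | "i = 2" | "i \<ge> 3" by linarith
    then show ?thesis by cases (use disj in \<open>auto simp: cell_def V cl_def part_index_def\<close>)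
  qed
  assume "u \<in> verts G" "v \<in> verts G"
  then show "adj G u v \<longleftrightarrow> blow cl u v"
    unfolding adj_def E V using disj by (auto simp: cl_def part_index_def part_edge_def doubleton_eq_iff)
qed

lemma copies_agree:
  assumes "\<And>u v. u \<in> V \<Longrightarrow> v \<in> V \<Longrightarrow> E u v = F u v"
  shows "copies V E = copies V F"
proof (intro set_eqI)
  fix S
  have sub: "S \<subseteq> V" if "S \<in> copies V A" for A using that unfolding copies_def by simp
  show "S \<in> copies V E \<longleftrightarrow> S \<in> copies V F"
  proof (cases "S \<subseteq> V")
    case True
    show ?thesis
      by (rule copies_cong) (rule assms; rule subsetD[OF True])
  next
    case False
    then have "S \<notin> copies V E" "S \<notin> copies V F" using sub by auto
    then show ?thesis by simp
  qed
qed

lemma copies_blowup_B14: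
  fixes W :: "nat \<Rightarrow> nat set"
  assumes "blowup_parts B14 W"
  shows "card (copies (verts (blowup B14 W)) (adj (blowup B14 W))) =
      (card (W 0) choose 2) * (card (W 1) choose 2) * (card (W 2) choose 2)"
    "card (verts (blowup B14 W)) = card (W 0) + card (W 1) + card (W 2)"
proof -
  define cl where "cl = part_index W"
  let ?G = "blowup B14 W"
  note b = blowup_B14[OF assms, folded cl_def]
  have fin: "finite (verts ?G)" using b(1) by (simp add: simple_graph_def)
  have "copies (verts ?G) (adj ?G) = copies (verts ?G) (blow cl)"
    by (rule copies_agree) (rule b(4))
  moreover have "cl ` verts ?G \<subseteq> {0, 1, 2}" by (auto simp: cl_def part_index_def)
  ultimately show "card (copies (verts ?G) (adj ?G)) =
      (card (W 0) choose 2) * (card (W 1) choose 2) * (card (W 2) choose 2)"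
    using card_copies_blow[OF fin, of cl] b(3)[of 0] b(3)[of 1] b(3)[of 2] by simp
  show "card (verts ?G) = card (W 0) + card (W 1) + card (W 2)"
  proof -
    note p = blowup_parts_B14[OF assms]
    have "(W 0 \<union> W 1) \<inter> W 2 = {}" using p by blast
    then show ?thesis using p unfolding b(2) by (simp add: card_Un_disjoint)
  qed
qed

text \<open>The blowup given by \<open>cl\<close> on the same vertices is an admissible target.\<close>

lemma edit_distance_le_wrong:
  fixes G :: "nat ugraph"
  assumes G: "simple_graph G" and cl: "cl ` verts G \<subseteq> {0, 1, 2}"
  shows "edit_distance G B14 \<le> card (wrong (verts G) (adj G) cl)"
proof -
  define W where "W = cell (verts G) cl"
  have fin: "finite (verts G)" using G by (simp add: simple_graph_def)
  have parts: "blowup_parts B14 W"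
    using fin by (auto simp: blowup_parts_def W_def cell_def disjoint_family_on_def)
  define H where "H = blowup B14 W"
  note b = blowup_B14[OF parts, folded H_def]
  have V: "verts H = verts G" using cl unfolding b(2) by (auto simp: W_def cell_def)
  have adjH: "adj H u v \<longleftrightarrow> blow cl u v" if "u \<in> verts G" "v \<in> verts G" for u v
  proof -
    have "part_index W z = cl z" if "z \<in> verts G" for z
    proof -
      have "cl z = 0 \<or> cl z = 1 \<or> cl z = 2" using cl that by blast
      then show ?thesis using that by (elim disjE) (simp_all add: part_index_def W_def cell_def)
    qed
    then show ?thesis using b(4)[of u v] that by (simp add: V)
  qed
  have "isomorphic H H" unfolding isomorphic_def is_iso_def by (intro exI[of _ id]) auto
  then have "edit_distance G B14 \<le> card ((edges G - edges H) \<union> (edges H - edges G))"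
    unfolding edit_distance_def
    by (intro Least_le exI[of _ H]) (use b(1) V parts in \<open>auto simp: blowups_def H_def\<close>)
  also have "\<dots> \<le> card ((\<lambda>(u, v). {u, v}) ` wrong (verts G) (adj G) cl)"
  proof (rule card_mono)
    show "finite ((\<lambda>(u, v). {u, v}) ` wrong (verts G) (adj G) cl)"
      using finite_wrong[OF fin] by simp
    show "(edges G - edges H) \<union> (edges H - edges G) \<subseteq> (\<lambda>(u, v). {u, v}) ` wrong (verts G) (adj G) cl"
    proof
      fix e assume e: "e \<in> (edges G - edges H) \<union> (edges H - edges G)"
      then have "e \<subseteq> verts G" "card e = 2" using G b(1) V by (auto simp: simple_graph_def)
      then obtain u v where uv: "e = {u, v}" "u \<in> verts G" "v \<in> verts G"
        by (auto simp: card_2_iff)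
      then have "adj G u v \<noteq> adj H u v" using e by (auto simp: adj_def)
      then have "(u, v) \<in> wrong (verts G) (adj G) cl" using uv adjH by (auto simp: wrong_def)
      then show "e \<in> (\<lambda>(u, v). {u, v}) ` wrong (verts G) (adj G) cl"
        using uv by (intro image_eqI[of _ _ "(u, v)"]) auto
    qed
  qed
  also have "\<dots> \<le> card (wrong (verts G) (adj G) cl)" by (rule card_image_le[OF finite_wrong[OF fin]])
  finally show ?thesis .
qed

section \<open>Limit densities\<close>

lemma real_choose_six:
  "real (m choose 6) = real m * (real m - 1) * (real m - 2) * (real m - 3) * (real m - 4) * (real m - 5) / 720"
  by (simp add: binomial_gbinomial gbinomial_prod_rev eval_nat_numeral fact_reduce)

lemma choose_two_limit:
  assumes "(\<lambda>n. real (s n) / real n) \<longlonglongrightarrow> x"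
  shows "(\<lambda>n. real (s n choose 2) / (real n)\<^sup>2) \<longlonglongrightarrow> x\<^sup>2 / 2"
proof (rule Lim_transform_eventually)
  show "(\<lambda>n. real (s n) / real n * (real (s n) / real n - 1 / real n) / 2) \<longlonglongrightarrow> x\<^sup>2 / 2"
    using tendsto_divide[OF tendsto_mult[OF assms tendsto_diff[OF assms lim_1_over_n]] tendsto_const[of "2::real"]]
    by (simp add: power2_eq_square)
  show "\<forall>\<^sub>F n in sequentially. real (s n) / real n * (real (s n) / real n - 1 / real n) / 2 =
      real (s n choose 2) / (real n)\<^sup>2"
    using eventually_gt_at_top[of 0]
    by eventually_elim (simp add: real_choose_two field_simps power2_eq_square)
qed

lemma choose_six_limit:
  assumes "(\<lambda>n. real (m n) / real n) \<longlonglongrightarrow> 1"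
  shows "(\<lambda>n. real (m n choose 6) / real n ^ 6) \<longlonglongrightarrow> 1 / 720"
proof (rule Lim_transform_eventually)
  let ?q = "\<lambda>n. real (m n) / real n"
  have d: "(\<lambda>n. ?q n - c / real n) \<longlonglongrightarrow> 1" for c
    using tendsto_diff[OF assms lim_const_over_n[of c]] by simp
  show "(\<lambda>n. ?q n * (?q n - 1 / real n) * (?q n - 2 / real n) * (?q n - 3 / real n) *
      (?q n - 4 / real n) * (?q n - 5 / real n) / 720) \<longlonglongrightarrow> 1 / 720"
    using tendsto_divide[OF tendsto_mult[OF tendsto_mult[OF tendsto_mult[OF tendsto_mult[OF
      tendsto_mult[OF assms d[of 1]] d[of 2]] d[of 3]] d[of 4]] d[of 5]] tendsto_const[of "720::real"]] by simp
  show "\<forall>\<^sub>F n in sequentially. ?q n * (?q n - 1 / real n) * (?q n - 2 / real n) * (?q n - 3 / real n) *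
      (?q n - 4 / real n) * (?q n - 5 / real n) / 720 = real (m n choose 6) / real n ^ 6"
    using eventually_gt_at_top[of 0]
  proof eventually_elim
    case (elim n)
    have "?q n - c / real n = (real (m n) - c) / real n" for c by (simp add: diff_divide_distrib)
    moreover have "real n ^ 6 = real n * real n * real n * real n * real n * real n"
      by (simp add: eval_nat_numeral)
    ultimately show ?case by (simp add: real_choose_six)
  qed
qed

lemma verts_B14: "verts B14 = {0, 1, 2}"
  by (auto simp: B14_def nat_graph_def)

lemma simplex_B14:
  assumes "x \<in> prob_simplex (verts B14)"
  shows "0 \<le> x 0" "0 \<le> x 1" "0 \<le> x 2" "x 0 + x 1 + x 2 = 1"
  using assms by (auto simp: prob_simplex_def verts_B14)

lemma has_blowup_density_B14:
  assumes "x \<in> prob_simplex (verts B14)"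
  shows "has_blowup_density F14 B14 x (90 * (x 0 * x 1 * x 2)\<^sup>2)"
  unfolding has_blowup_density_def
proof (intro allI impI, elim conjE)
  fix W :: "nat \<Rightarrow> nat \<Rightarrow> nat set"
  assume parts: "\<forall>n. blowup_parts B14 (W n)"
    and lim: "\<forall>i\<in>verts B14. (\<lambda>n. real (card (W n i)) / real n) \<longlonglongrightarrow> x i"
  have l: "(\<lambda>n. real (card (W n 0)) / real n) \<longlonglongrightarrow> x 0" "(\<lambda>n. real (card (W n 1)) / real n) \<longlonglongrightarrow> x 1"
    "(\<lambda>n. real (card (W n 2)) / real n) \<longlonglongrightarrow> x 2"
    using lim by (simp_all add: verts_B14)
  define m where "m n = card (W n 0) + card (W n 1) + card (W n 2)" for n
  have "(\<lambda>n. real (m n) / real n) \<longlonglongrightarrow> x 0 + x 1 + x 2"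
    using tendsto_add[OF tendsto_add[OF l(1,2)] l(3)] by (simp add: m_def add_divide_distrib)
  then have "(\<lambda>n. real (m n) / real n) \<longlonglongrightarrow> 1" using simplex_B14(4)[OF assms] by simp
  from choose_six_limit[OF this] have den: "(\<lambda>n. real (m n choose 6) / real n ^ 6) \<longlonglongrightarrow> 1 / 720" .
  have num: "(\<lambda>n. real (card (W n 0) choose 2) / (real n)\<^sup>2 * (real (card (W n 1) choose 2) / (real n)\<^sup>2) *
      (real (card (W n 2) choose 2) / (real n)\<^sup>2)) \<longlonglongrightarrow> (x 0)\<^sup>2 / 2 * ((x 1)\<^sup>2 / 2) * ((x 2)\<^sup>2 / 2)"
    by (intro tendsto_mult choose_two_limit l)
  show "(\<lambda>n. ind_density F14 (blowup B14 (W n))) \<longlonglongrightarrow> 90 * (x 0 * x 1 * x 2)\<^sup>2"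
  proof (rule Lim_transform_eventually)
    show "(\<lambda>n. real (card (W n 0) choose 2) / (real n)\<^sup>2 * (real (card (W n 1) choose 2) / (real n)\<^sup>2) *
      (real (card (W n 2) choose 2) / (real n)\<^sup>2) / (real (m n choose 6) / real n ^ 6)) \<longlonglongrightarrow> 90 * (x 0 * x 1 * x 2)\<^sup>2"
    proof -
      have "90 * (x 0 * x 1 * x 2)\<^sup>2 = (x 0)\<^sup>2 / 2 * ((x 1)\<^sup>2 / 2) * ((x 2)\<^sup>2 / 2) / (1 / 720)"
        by (simp add: power_mult_distrib)
      then show ?thesis using tendsto_divide[OF num den] by simp
    qed
    show "\<forall>\<^sub>F n in sequentially. real (card (W n 0) choose 2) / (real n)\<^sup>2 * (real (card (W n 1) choose 2) / (real n)\<^sup>2) *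
      (real (card (W n 2) choose 2) / (real n)\<^sup>2) / (real (m n choose 6) / real n ^ 6) =
      ind_density F14 (blowup B14 (W n))"
      using eventually_gt_at_top[of 0]
    proof eventually_elim
      case (elim n)
      have p: "blowup_parts B14 (W n)" using parts by blast
      have "real n ^ 6 = (real n)\<^sup>2 * (real n)\<^sup>2 * (real n)\<^sup>2" by (simp add: eval_nat_numeral)
      then show ?case
        using elim by (simp add: ind_density_F14[OF blowup_B14(1)[OF p]] copies_blowup_B14[OF p] m_def)
    qed
  qed
qed

lemma nat_floor_limit:
  assumes "0 \<le> (x :: real)"
  shows "(\<lambda>n. real (nat \<lfloor>x * real n\<rfloor>) / real n) \<longlonglongrightarrow> x"
proof (rule tendsto_sandwich)
  show "(\<lambda>n. x - 1 / real n) \<longlonglongrightarrow> x" using tendsto_diff[OF tendsto_const[of x] lim_1_over_n] by simp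
  have fl: "real (nat \<lfloor>x * real n\<rfloor>) \<le> x * real n" "x * real n - 1 \<le> real (nat \<lfloor>x * real n\<rfloor>)" for n
  proof -
    have "real (nat \<lfloor>x * real n\<rfloor>) = of_int \<lfloor>x * real n\<rfloor>" using assms by simp
    then show "real (nat \<lfloor>x * real n\<rfloor>) \<le> x * real n" "x * real n - 1 \<le> real (nat \<lfloor>x * real n\<rfloor>)"
      using of_int_floor_le[of "x * real n"] real_of_int_floor_ge_diff_one[of "x * real n"] by simp_all
  qed
  show "\<forall>\<^sub>F n in sequentially. x - 1 / real n \<le> real (nat \<lfloor>x * real n\<rfloor>) / real n"
    using eventually_gt_at_top[of 0]
  proof eventually_elim
    case (elim n)
    then have "x - 1 / real n = (x * real n - 1) / real n" by (simp add: field_simps)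
    also have "\<dots> \<le> real (nat \<lfloor>x * real n\<rfloor>) / real n" by (intro divide_right_mono fl) simp
    finally show ?case .
  qed
  show "\<forall>\<^sub>F n in sequentially. real (nat \<lfloor>x * real n\<rfloor>) / real n \<le> x"
    using eventually_gt_at_top[of 0]
  proof eventually_elim
    case (elim n)
    have "real (nat \<lfloor>x * real n\<rfloor>) / real n \<le> x * real n / real n" by (intro divide_right_mono fl) simp
    then show ?case using elim by simp
  qed
qed simp

text \<open>A limit over an empty family of blowups would not determine the blowup density. The parts are chosen in
different residue classes modulo 3.\<close>

lemma blowup_sequence_exists:
  assumes "x \<in> prob_simplex (verts B14)"
  shows "\<exists>W :: nat \<Rightarrow> nat \<Rightarrow> nat set. (\<forall>n. blowup_parts B14 (W n)) \<and>
    (\<forall>i\<in>verts B14. (\<lambda>n. real (card (W n i)) / real n) \<longlonglongrightarrow> x i)"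
proof -
  define W :: "nat \<Rightarrow> nat \<Rightarrow> nat set" where "W n i = (\<lambda>k. 3 * k + i) ` {..<nat \<lfloor>x i * real n\<rfloor>}" for n i
  have card: "card (W n i) = nat \<lfloor>x i * real n\<rfloor>" for n i
    unfolding W_def by (subst card_image) (auto simp: inj_on_def)
  have mod3: "v mod 3 = i" if v: "v \<in> W n i" and i: "i \<in> {0, 1, 2}" for v n i
  proof -
    obtain k where "v = 3 * k + i" using v by (auto simp: W_def)
    moreover have "i < 3" using i by auto
    ultimately show ?thesis by simp
  qed
  show ?thesis
  proof (intro exI[of _ W] conjI allI ballI)
    show "blowup_parts B14 (W n)" for n
    proof -
      have "W n i \<inter> W n j = {}" if "i \<in> {0, 1, 2}" "j \<in> {0, 1, 2}" "i \<noteq> j" for i j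
        using mod3[OF _ that(1), of _ n] mod3[OF _ that(2), of _ n] that(3) by blast
      moreover have "finite (W n i)" for i by (simp add: W_def)
      ultimately show ?thesis
        unfolding blowup_parts_def disjoint_family_on_def verts_B14 by blast
    qed
    show "(\<lambda>n. real (card (W n i)) / real n) \<longlonglongrightarrow> x i" if "i \<in> verts B14" for i
      unfolding card using assms that by (intro nat_floor_limit) (simp add: prob_simplex_def)
  qed
qed

lemma blowup_density_B14:
  assumes "x \<in> prob_simplex (verts B14)"
  shows "blowup_density F14 B14 x = 90 * (x 0 * x 1 * x 2)\<^sup>2"
  unfolding blowup_density_def
proof (rule the_equality)
  show "has_blowup_density F14 B14 x (90 * (x 0 * x 1 * x 2)\<^sup>2)" by (rule has_blowup_density_B14[OF assms])
  fix L assume L: "has_blowup_density F14 B14 x L"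
  obtain W :: "nat \<Rightarrow> nat \<Rightarrow> nat set" where W: "\<forall>n. blowup_parts B14 (W n)"
    "\<forall>i\<in>verts B14. (\<lambda>n. real (card (W n i)) / real n) \<longlonglongrightarrow> x i"
    using blowup_sequence_exists[OF assms] by blast
  have "(\<lambda>n. ind_density F14 (blowup B14 (W n))) \<longlonglongrightarrow> L"
    using L W unfolding has_blowup_density_def by blast
  moreover have "(\<lambda>n. ind_density F14 (blowup B14 (W n))) \<longlonglongrightarrow> 90 * (x 0 * x 1 * x 2)\<^sup>2"
    using has_blowup_density_B14[OF assms] W unfolding has_blowup_density_def by blast
  ultimately show "L = 90 * (x 0 * x 1 * x 2)\<^sup>2" by (rule LIMSEQ_unique)
qed

text \<open>The arithmetic-geometric mean inequality for three numbers with its quadratic deficit: replacing \<open>y\<close>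
and \<open>z\<close> by their mean leaves a cubic with a double root at \<open>1/3\<close>.\<close>

lemma product_three_bound:
  fixes x y z :: real
  assumes "0 \<le> x" "0 \<le> y" "0 \<le> z" "x + y + z = 1"
  shows "(x - 1 / 3)\<^sup>2 / 12 \<le> 1 / 27 - x * y * z"
proof -
  have x: "x = 1 - y - z" using assms(4) by linarith
  have "((1 - x) / 2)\<^sup>2 - y * z = ((y - z) / 2)\<^sup>2"
    unfolding x by (simp add: power2_eq_square field_simps)
  moreover have "0 \<le> ((y - z) / 2)\<^sup>2" by simp
  ultimately have "y * z \<le> ((1 - x) / 2)\<^sup>2" by linarith
  then have "x * (y * z) \<le> x * ((1 - x) / 2)\<^sup>2" using assms(1) by (rule mult_left_mono)
  moreover have "1 / 27 - x * ((1 - x) / 2)\<^sup>2 = (x - 1 / 3)\<^sup>2 * ((4 / 3 - x) / 4)"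
    by (simp add: power2_eq_square field_simps)
  ultimately have "(x - 1 / 3)\<^sup>2 * ((4 / 3 - x) / 4) \<le> 1 / 27 - x * y * z"
    by (simp only: mult.assoc)
  moreover have "(x - 1 / 3)\<^sup>2 * (1 / 12) \<le> (x - 1 / 3)\<^sup>2 * ((4 / 3 - x) / 4)"
    using assms by (intro mult_left_mono) auto
  ultimately show ?thesis by (simp only: times_divide_eq_right mult_1_right)
qed

lemma third_eq_if_product:
  fixes x y z :: real
  assumes "0 \<le> x" "0 \<le> y" "0 \<le> z" "x + y + z = 1" "1 / 27 \<le> x * y * z"
  shows "x = 1 / 3" "y = 1 / 3" "z = 1 / 3"
proof -
  have "u = 1 / 3" if "(u - 1 / 3)\<^sup>2 / 12 \<le> 1 / 27 - p" "1 / 27 \<le> p" for u p :: real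
  proof -
    have "(u - 1 / 3)\<^sup>2 \<le> 0" using that by linarith
    then show ?thesis by simp
  qed
  note eq = this[OF product_three_bound]
  show "x = 1 / 3" by (rule eq[of x y z]) (use assms in simp_all)
  show "y = 1 / 3" by (rule eq[of y z x]) (use assms in \<open>simp_all add: ac_simps\<close>)
  show "z = 1 / 3" by (rule eq[of z x y]) (use assms in \<open>simp_all add: ac_simps\<close>)
qed

lemma unique_maximiser_B14:
  "unique_maximiser_up_to_aut F14 B14 (\<lambda>i. if i < 3 then 1 / 3 else 0)"
proof -
  let ?c = "\<lambda>i :: nat. if i < 3 then 1 / 3 else 0 :: real"
  have c: "?c \<in> prob_simplex (verts B14)" by (auto simp: prob_simplex_def verts_B14)
  have dc: "blowup_density F14 B14 ?c = 90 * (1 / 27)\<^sup>2"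
    by (simp add: blowup_density_B14[OF c] power2_eq_square)
  have le: "y 0 * y 1 * y 2 \<le> 1 / 27" "0 \<le> y 0 * y 1 * y 2" if "y \<in> prob_simplex (verts B14)" for y
  proof -
    note s = simplex_B14[OF that]
    have "0 \<le> (y 0 - 1 / 3)\<^sup>2 / 12" by simp
    also note product_three_bound[OF s]
    finally show "y 0 * y 1 * y 2 \<le> 1 / 27" by simp
    show "0 \<le> y 0 * y 1 * y 2" using s by simp
  qed
  have max: "maximiser F14 B14 ?c"
    unfolding maximiser_def dc
  proof (intro conjI ballI c)
    fix y assume y: "y \<in> prob_simplex (verts B14)"
    show "blowup_density F14 B14 y \<le> 90 * (1 / 27)\<^sup>2"
      unfolding blowup_density_B14[OF y] by (intro mult_left_mono power_mono le[OF y]) simp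
  qed
  show ?thesis
    unfolding unique_maximiser_up_to_aut_def
  proof (intro conjI max allI impI)
    fix y assume "maximiser F14 B14 y"
    then have y: "y \<in> prob_simplex (verts B14)" and "blowup_density F14 B14 ?c \<le> blowup_density F14 B14 y"
      using c by (auto simp: maximiser_def)
    then have "(1 / 27)\<^sup>2 \<le> (y 0 * y 1 * y 2)\<^sup>2" unfolding dc blowup_density_B14[OF y] by simp
    then have "1 / 27 \<le> y 0 * y 1 * y 2" by (rule power2_le_imp_le[OF _ le(2)[OF y]])
    from third_eq_if_product[OF simplex_B14[OF y] this]
    have "y 0 = 1 / 3" "y 1 = 1 / 3" "y 2 = 1 / 3" .
    moreover have "automorphism id B14"
      by (simp add: automorphism_def is_iso_def)
    ultimately show "\<exists>f. automorphism f B14 \<and> (\<forall>i\<in>verts B14. y i = ?c (f i))"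
      by (intro exI[of _ id]) (auto simp: verts_B14)
  qed
qed

lemma self_ratio_limit: "(\<lambda>n. real n / real n) \<longlonglongrightarrow> 1"
  by (rule Lim_transform_eventually[OF tendsto_const]) (use eventually_gt_at_top[of 0] in \<open>eventually_elim, simp\<close>)

lemma max_density_upper:
  "max_density F14 n \<le> (4 * real n ^ 6 + 180000 * real n ^ 5) / (23328 * real (n choose 6))"
proof -
  obtain G :: "nat ugraph" where G: "simple_graph G" "card (verts G) = n" "max_density F14 n = ind_density F14 G"
    by (rule max_density_attained)
  have fin: "finite (verts G)" using G(1) by (simp add: simple_graph_def)
  have "0 \<le> (\<Sum>a\<in>verts G. \<Sum>b\<in>verts G. if adj G a b then int (card (wrong (verts G) (adj G) (side (adj G) a b))) else 0)"
    by (intro sum_nonneg) simp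
  then have "0 \<le> (int n)\<^sup>2 * (\<Sum>a\<in>verts G. \<Sum>b\<in>verts G. if adj G a b then int (card (wrong (verts G) (adj G) (side (adj G) a b))) else 0)"
    by simp
  then have "23328 * int (card (copies (verts G) (adj G))) \<le> 4 * int n ^ 6 + 180000 * int n ^ 5"
    using certificate[of "verts G" "adj G", OF fin adj_commute adj_irrefl[OF G(1)]] unfolding G(2) by linarith
  then have "real_of_int (23328 * int (card (copies (verts G) (adj G)))) \<le> real_of_int (4 * int n ^ 6 + 180000 * int n ^ 5)"
    by (simp only: of_int_le_iff)
  then have "23328 * real (card (copies (verts G) (adj G))) \<le> 4 * real n ^ 6 + 180000 * real n ^ 5" by simp
  then have "23328 * real (card (copies (verts G) (adj G))) / (23328 * real (n choose 6)) \<le>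
      (4 * real n ^ 6 + 180000 * real n ^ 5) / (23328 * real (n choose 6))"
    by (rule divide_right_mono) simp
  then show ?thesis by (simp add: G ind_density_F14)
qed

text \<open>The lower bound comes from the blowups whose parts are as equal as possible.\<close>

lemma max_density_limit: "max_density F14 \<longlonglongrightarrow> 10 / 81"
proof (rule tendsto_sandwich)
  define W :: "nat \<Rightarrow> nat \<Rightarrow> nat set" where
    "W n i = (if i = 0 then {0..<n div 3} else if i = 1 then {n div 3..<2 * (n div 3)} else {2 * (n div 3)..<n})" for n i
  let ?c = "\<lambda>i :: nat. if i < 3 then 1 / 3 else 0 :: real"
  have c: "?c \<in> prob_simplex (verts B14)" by (auto simp: prob_simplex_def verts_B14)
  have parts: "blowup_parts B14 (W n)" for n
    unfolding blowup_parts_def disjoint_family_on_def verts_B14 by (auto simp: W_def)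
  have d3: "(\<lambda>n. real (n div 3) / real n) \<longlonglongrightarrow> 1 / 3"
  proof (rule Lim_transform_eventually[OF nat_floor_limit[of "1 / 3"]])
    have "nat \<lfloor>1 / 3 * real n\<rfloor> = n div 3" for n
      using floor_divide_of_nat_eq[of n 3, where 'a = real] by simp
    then show "\<forall>\<^sub>F n in sequentially. real (nat \<lfloor>1 / 3 * real n\<rfloor>) / real n = real (n div 3) / real n" by simp
  qed simp
  have d3': "(\<lambda>n. real (n - 2 * (n div 3)) / real n) \<longlonglongrightarrow> 1 / 3"
  proof (rule Lim_transform_eventually)
    show "(\<lambda>n. real n / real n - 2 * (real (n div 3) / real n)) \<longlonglongrightarrow> 1 / 3"
      using tendsto_diff[OF self_ratio_limit tendsto_mult[OF tendsto_const[of 2] d3]] by simp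
    have "real (n - 2 * (n div 3)) = real n - 2 * real (n div 3)" for n
      by (subst of_nat_diff) auto
    then show "\<forall>\<^sub>F n in sequentially. real n / real n - 2 * (real (n div 3) / real n) = real (n - 2 * (n div 3)) / real n"
      by (simp add: diff_divide_distrib)
  qed
  have "has_blowup_density F14 B14 ?c (90 * (?c 0 * ?c 1 * ?c 2)\<^sup>2)" by (rule has_blowup_density_B14[OF c])
  moreover have "\<forall>i\<in>verts B14. (\<lambda>n. real (card (W n i)) / real n) \<longlonglongrightarrow> ?c i"
    using d3 d3' by (simp add: verts_B14 W_def)
  ultimately have "(\<lambda>n. ind_density F14 (blowup B14 (W n))) \<longlonglongrightarrow> 90 * (?c 0 * ?c 1 * ?c 2)\<^sup>2"
    using parts unfolding has_blowup_density_def by blast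
  then show "(\<lambda>n. ind_density F14 (blowup B14 (W n))) \<longlonglongrightarrow> 10 / 81"
    by (simp add: power2_eq_square)
  show "\<forall>\<^sub>F n in sequentially. ind_density F14 (blowup B14 (W n)) \<le> max_density F14 n"
  proof (intro always_eventually allI density_le_max)
    fix n
    show "simple_graph (blowup B14 (W n))" by (rule blowup_B14(1)[OF parts])
    show "card (verts (blowup B14 (W n))) = n"
      by (simp add: copies_blowup_B14(2)[OF parts] W_def)
  qed
  show "\<forall>\<^sub>F n in sequentially. max_density F14 n \<le> (4 * real n ^ 6 + 180000 * real n ^ 5) / (23328 * real (n choose 6))"
    by (intro always_eventually allI max_density_upper)
  show "(\<lambda>n. (4 * real n ^ 6 + 180000 * real n ^ 5) / (23328 * real (n choose 6))) \<longlonglongrightarrow> 10 / 81"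
  proof (rule Lim_transform_eventually)
    show "(\<lambda>n. (4 + 180000 / real n) / (23328 * (real (n choose 6) / real n ^ 6))) \<longlonglongrightarrow> 10 / 81"
      using tendsto_divide[OF tendsto_add[OF tendsto_const[of 4] lim_const_over_n[of 180000]]
        tendsto_mult[OF tendsto_const[of 23328] choose_six_limit[OF self_ratio_limit]]] by simp
    show "\<forall>\<^sub>F n in sequentially. (4 + 180000 / real n) / (23328 * (real (n choose 6) / real n ^ 6)) =
        (4 * real n ^ 6 + 180000 * real n ^ 5) / (23328 * real (n choose 6))"
      using eventually_gt_at_top[of 0]
    proof eventually_elim
      case (elim n)
      have "4 * real n ^ 6 + 180000 * real n ^ 5 = (4 + 180000 / real n) * real n ^ 6"
        using elim by (simp add: field_simps eval_nat_numeral)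
      then show ?case by simp
    qed
  qed
qed

section \<open>Perfect stability\<close>

text \<open>Both orders of a wrong pair at \<open>v\<close> are counted.\<close>

lemma wrong_split:
  assumes "finite V" "v \<in> V" and sym: "\<And>x y. E x y = E y x" and irr: "\<And>x. \<not> E x x"
  shows "card (wrong V E cl) =
    card {p \<in> wrong V E cl. fst p \<noteq> v \<and> snd p \<noteq> v} + 2 * wdeg V E cl v (cl v)"
proof -
  let ?N = "{u \<in> V - {v}. E v u \<noteq> part_edge (cl v) (cl u)}"
  let ?O = "{p \<in> wrong V E cl. fst p \<noteq> v \<and> snd p \<noteq> v}"
  have fin: "finite ?N" "finite ?O" using assms(1) finite_wrong[OF assms(1)] by simp_all
  have eq: "wrong V E cl = ?O \<union> (Pair v ` ?N \<union> (\<lambda>u. (u, v)) ` ?N)"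
  proof (intro equalityI subsetI)
    fix p assume p: "p \<in> wrong V E cl"
    obtain x y where xy: "p = (x, y)" by (cases p)
    have "x \<noteq> y" using wrong_neq[OF irr p[unfolded xy]] .
    have yx: "(y, x) \<in> wrong V E cl" using wrong_sym[OF sym p[unfolded xy]] .
    consider "x = v" | "y = v" | "x \<noteq> v" "y \<noteq> v" by blast
    then show "p \<in> ?O \<union> (Pair v ` ?N \<union> (\<lambda>u. (u, v)) ` ?N)"
    proof cases
      case 1
      then have "y \<in> ?N" using p \<open>x \<noteq> y\<close> unfolding xy by (auto simp: wrong_def)
      then show ?thesis using 1 xy by blast
    next
      case 2
      then have "x \<in> ?N" using yx \<open>x \<noteq> y\<close> by (auto simp: wrong_def)
      then show ?thesis using 2 xy by blast
    next
      case 3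
      then show ?thesis using p xy by simp
    qed
  next
    fix p assume "p \<in> ?O \<union> (Pair v ` ?N \<union> (\<lambda>u. (u, v)) ` ?N)"
    then consider "p \<in> wrong V E cl" | u where "u \<in> ?N" "p = (v, u)" | u where "u \<in> ?N" "p = (u, v)" by blast
    then show "p \<in> wrong V E cl"
    proof cases
      case (2 u)
      then show ?thesis using assms(2) by (simp add: wrong_def)
    next
      case (3 u)
      then have "(v, u) \<in> wrong V E cl" using assms(2) by (simp add: wrong_def)
      then show ?thesis using wrong_sym[of E v u V cl, OF sym] 3 by simp
    qed simp
  qed
  have a: "card (Pair v ` ?N \<union> (\<lambda>u. (u, v)) ` ?N) = card (Pair v ` ?N) + card ((\<lambda>u. (u, v)) ` ?N)"
    by (rule card_Un_disjoint) (use fin in auto)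
  have b: "card (Pair v ` ?N) = card ?N" "card ((\<lambda>u. (u, v)) ` ?N) = card ?N"
    by (rule card_image, simp add: inj_on_def)+
  have "card (?O \<union> (Pair v ` ?N \<union> (\<lambda>u. (u, v)) ` ?N)) = card ?O + card (Pair v ` ?N \<union> (\<lambda>u. (u, v)) ` ?N)"
    by (rule card_Un_disjoint) (use fin in auto)
  then show ?thesis unfolding eq[symmetric] a b wdeg_def by simp
qed

text \<open>In a partition with the fewest wrong pairs, no vertex can gain by moving to another class.\<close>

lemma optimal_partition_exists:
  fixes E :: "'a \<Rightarrow> 'a \<Rightarrow> bool"
  assumes "finite V" and sym: "\<And>x y. E x y = E y x" and irr: "\<And>x. \<not> E x x"
    and cl0: "cl0 ` V \<subseteq> {0, 1, 2}"
  shows "\<exists>cl. cl ` V \<subseteq> {0, 1, 2} \<and> card (wrong V E cl) \<le> card (wrong V E cl0) \<and>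
    (\<forall>v\<in>V. \<forall>j\<in>{0, 1, 2}. wdeg V E cl v (cl v) \<le> wdeg V E cl v j)"
proof -
  obtain cl where cl: "cl ` V \<subseteq> {0, 1, 2}"
    and min: "\<forall>c. c ` V \<subseteq> {0, 1, 2} \<longrightarrow> card (wrong V E cl) \<le> card (wrong V E c)"
    using ex_has_least_nat[of "\<lambda>c. c ` V \<subseteq> {0, 1, 2}" cl0 "\<lambda>c. card (wrong V E c)"] cl0 by blast
  show ?thesis
  proof (intro exI[of _ cl] conjI ballI cl)
    show "card (wrong V E cl) \<le> card (wrong V E cl0)" using min cl0 by blast
    fix v j assume v: "v \<in> V" and j: "j \<in> {0, 1, 2 :: nat}"
    let ?c = "cl(v := j)"
    have "?c ` V \<subseteq> {0, 1, 2}" using cl j by auto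
    then have "card (wrong V E cl) \<le> card (wrong V E ?c)" using min by blast
    moreover have "{p \<in> wrong V E ?c. fst p \<noteq> v \<and> snd p \<noteq> v} = {p \<in> wrong V E cl. fst p \<noteq> v \<and> snd p \<noteq> v}"
      by (auto simp: wrong_def)
    moreover have "wdeg V E ?c v (?c v) = wdeg V E cl v j"
      unfolding wdeg_def by (intro arg_cong[where f = card]) auto
    ultimately show "wdeg V E cl v (cl v) \<le> wdeg V E cl v j"
      using wrong_split[of V v E cl, OF assms(1) v sym irr] wrong_split[of V v E ?c, OF assms(1) v sym irr] by simp
  qed
qed

lemma copies_le_blow:
  fixes E :: "'a \<Rightarrow> 'a \<Rightarrow> bool"
  assumes "finite V" and irr: "\<And>x. \<not> E x x"
  shows "card (copies V E) \<le> card (copies V (blow cl)) + card (wrong V E cl) * card V ^ 4"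
proof -
  let ?U = "\<Union>p\<in>wrong V E cl. six_over V {fst p, snd p}"
  have "copies V E \<subseteq> copies V (blow cl) \<union> ?U"
  proof
    fix S assume S: "S \<in> copies V E"
    then have SV: "S \<subseteq> V" "card S = 6" by (simp_all add: copies_def)
    show "S \<in> copies V (blow cl) \<union> ?U"
    proof (cases "\<forall>u\<in>S. \<forall>v\<in>S. E u v = blow cl u v")
      case True
      then have "S \<in> copies V (blow cl)" using S copies_cong[of S E "blow cl" V] by blast
      then show ?thesis by simp
    next
      case False
      then obtain u v where uv: "u \<in> S" "v \<in> S" "E u v \<noteq> blow cl u v" by blast
      then have "(u, v) \<in> wrong V E cl" using SV by (auto simp: wrong_def)
      moreover have "S \<in> six_over V {fst (u, v), snd (u, v)}" using uv SV by (simp add: six_over_def)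
      ultimately show ?thesis by blast
    qed
  qed
  then have "card (copies V E) \<le> card (copies V (blow cl) \<union> ?U)"
    by (rule card_mono[rotated]) (simp add: finite_copies finite_six_over finite_wrong assms(1))
  also have "\<dots> \<le> card (copies V (blow cl)) + card ?U" by (rule card_Un_le)
  also have "card ?U \<le> card (wrong V E cl) * card V ^ (6 - 2)"
  proof (rule card_UN_six_over[OF assms(1) finite_wrong[OF assms(1)]])
    fix p assume p: "p \<in> wrong V E cl"
    obtain x y where xy: "p = (x, y)" by (cases p)
    have "x \<noteq> y" using wrong_neq[OF irr p[unfolded xy]] .
    then show "{fst p, snd p} \<subseteq> V \<and> card {fst p, snd p} = 2"
      using p by (auto simp: xy wrong_def)
  qed simp
  finally show ?thesis by simp
qed

lemma card_cells:
  assumes "finite V" "cl ` V \<subseteq> {0, 1, 2}"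
  shows "card (cell V cl 0) + card (cell V cl 1) + card (cell V cl 2) = card V"
proof -
  have "V = (cell V cl 0 \<union> cell V cl 1) \<union> cell V cl 2" using assms(2) by (auto simp: cell_def)
  moreover have "card ((cell V cl 0 \<union> cell V cl 1) \<union> cell V cl 2) =
      card (cell V cl 0) + card (cell V cl 1) + card (cell V cl 2)"
    using assms(1) by (subst card_Un_disjoint; simp add: finite_cell card_Un_disjoint cell_disjoint Int_Un_distrib2)
  ultimately show ?thesis by simp
qed

text \<open>A blowup with nearly the maximum number of copies has nearly equal parts, by \<open>product_three_bound\<close>.\<close>

lemma balanced_cells:
  fixes n :: real
  assumes "finite V" and cl: "cl ` V \<subseteq> {0, 1, 2}" and n: "n = real (card V)" "0 < n"
    and many: "(1 / 5832 - 2 / 10 ^ 16) * n ^ 6 \<le> real (card (copies V (blow cl)))" and i: "i \<in> {0, 1, 2}"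
  shows "\<bar>real (card (cell V cl i)) - n / 3\<bar> \<le> n / 10 ^ 6"
proof -
  define x where "x i = real (card (cell V cl i)) / n" for i
  have nn: "0 \<le> x i" for i using n by (simp add: x_def)
  have sum: "x 0 + x 1 + x 2 = 1"
  proof -
    have "real (card (cell V cl 0)) + real (card (cell V cl 1)) + real (card (cell V cl 2)) = n"
      using card_cells[OF assms(1) cl] n(1) by simp
    then show ?thesis using n(2) by (simp add: x_def add_divide_distrib[symmetric])
  qed
  have ch: "real (card (cell V cl i) choose 2) \<le> (x i * n)\<^sup>2 / 2" for i
    using n(2) by (simp add: real_choose_two x_def power2_eq_square algebra_simps)
  have "real (card (copies V (blow cl))) \<le> (x 0 * n)\<^sup>2 / 2 * ((x 1 * n)\<^sup>2 / 2) * ((x 2 * n)\<^sup>2 / 2)"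
    unfolding card_copies_blow[OF assms(1) cl] of_nat_mult by (intro mult_mono ch) auto
  also have "\<dots> = (x 0 * x 1 * x 2)\<^sup>2 / 8 * n ^ 6" by (simp add: power_mult_distrib eval_nat_numeral)
  finally have "(1 / 5832 - 2 / 10 ^ 16) * n ^ 6 \<le> (x 0 * x 1 * x 2)\<^sup>2 / 8 * n ^ 6" using many by linarith
  then have sq: "1 / 5832 - 2 / 10 ^ 16 \<le> (x 0 * x 1 * x 2)\<^sup>2 / 8" using n(2) by simp
  have "1 / 27 - 1 / (2 * 10 ^ 13) \<le> x 0 * x 1 * x 2"
  proof (rule power2_le_imp_le)
    have "(1 / 27 - 1 / (2 * 10 ^ 13))\<^sup>2 \<le> 8 * (1 / 5832 - 2 / (10 ^ 16 :: real))"
      by (simp add: power2_eq_square)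
    also have "\<dots> \<le> (x 0 * x 1 * x 2)\<^sup>2" using sq by (subst mult.commute) (simp only: pos_le_divide_eq zero_less_numeral)
    finally show "(1 / 27 - 1 / (2 * 10 ^ 13))\<^sup>2 \<le> (x 0 * x 1 * x 2)\<^sup>2" .
  qed (simp add: nn)
  then have def: "1 / 27 - x 0 * x 1 * x 2 \<le> 1 / (2 * 10 ^ 13)" by linarith
  have close: "\<bar>u - 1 / 3\<bar> \<le> 1 / 10 ^ 6" if "(u - 1 / 3)\<^sup>2 / 12 \<le> 1 / (2 * 10 ^ 13)" for u :: real
  proof -
    have "\<bar>u - 1 / 3\<bar>\<^sup>2 \<le> (1 / 10 ^ 6)\<^sup>2" using that by (simp add: power_divide)
    then show ?thesis by (rule power2_le_imp_le) simp
  qed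
  have "\<bar>x i - 1 / 3\<bar> \<le> 1 / 10 ^ 6"
  proof -
    have "(x i - 1 / 3)\<^sup>2 / 12 \<le> 1 / 27 - x 0 * x 1 * x 2"
      using i product_three_bound[of "x 0" "x 1" "x 2"] product_three_bound[of "x 1" "x 2" "x 0"]
        product_three_bound[of "x 2" "x 0" "x 1"] nn sum by (auto simp: ac_simps)
    then show ?thesis using def by (intro close) linarith
  qed
  then have "\<bar>x i - 1 / 3\<bar> * n \<le> 1 / 10 ^ 6 * n" using n(2) by (intro mult_right_mono) auto
  moreover have "\<bar>x i - 1 / 3\<bar> * n = \<bar>(x i - 1 / 3) * n\<bar>" using n(2) by (simp add: abs_mult)
  moreover have "(x i - 1 / 3) * n = real (card (cell V cl i)) - n / 3" using n(2) by (simp add: x_def field_simps)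
  ultimately show ?thesis by simp
qed

lemma choose_six_le: "real (n choose 6) \<le> real n ^ 6"
proof (cases "6 \<le> n")
  case True
  then have "n choose 6 \<le> n ^ 6" by (rule binomial_le_pow)
  then show ?thesis by (metis of_nat_le_iff of_nat_power)
qed (simp add: binomial_eq_0)

lemma blow_copies_le_max:
  fixes V :: "nat set"
  assumes "finite V" and cl: "cl ` V \<subseteq> {0, 1, 2}" and "6 \<le> card V"
  shows "real (card (copies V (blow cl))) \<le> max_density F14 (card V) * real (card V choose 6)"
proof -
  have parts: "blowup_parts B14 (cell V cl)"
    using assms(1) by (auto simp: blowup_parts_def cell_def disjoint_family_on_def)
  let ?H = "blowup B14 (cell V cl)"
  have card: "card (verts ?H) = card V" using copies_blowup_B14(2)[OF parts] card_cells[OF assms(1) cl] by simp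
  have simple: "simple_graph ?H" by (rule blowup_B14(1)[OF parts])
  have pos: "0 < real (card V choose 6)" using assms(3) by simp
  have "ind_density F14 ?H \<le> max_density F14 (card V)" by (rule density_le_max[OF simple card])
  then have "real (card (copies (verts ?H) (adj ?H))) / real (card V choose 6) \<le> max_density F14 (card V)"
    by (simp only: ind_density_F14[OF simple] card)
  then have "real (card (copies (verts ?H) (adj ?H))) \<le> max_density F14 (card V) * real (card V choose 6)"
    using pos by (simp only: pos_divide_le_eq)
  moreover have "card (copies (verts ?H) (adj ?H)) = card (copies V (blow cl))"
    by (simp only: copies_blowup_B14(1)[OF parts] card_copies_blow[OF assms(1) cl])
  ultimately show ?thesis by simp
qed

text \<open>The partition from \<open>near_extremal_partition\<close> is replaced by one with the fewest wrong pairs. Its blowup has almost as many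
copies, so its parts are balanced and \<open>local_stability\<close> applies.\<close>

lemma near_extremal_stable:
  fixes G :: "nat ugraph"
  assumes G: "simple_graph G" and n: "n = real (card (verts G))" "10 ^ 25 \<le> n"
    and near: "(4 - 1 / 10 ^ 19) * n ^ 6 \<le> 23328 * real (card (copies (verts G) (adj G)))"
  shows "real (edit_distance G B14) \<le>
    2 * 10 ^ 7 * (max_density F14 (card (verts G)) - ind_density F14 G) * n\<^sup>2"
proof -
  let ?V = "verts G" and ?E = "adj G"
  have fin: "finite ?V" using G by (simp add: simple_graph_def)
  have n0: "0 < n" using n(2) by (rule less_le_trans[rotated]) simp
  have "\<exists>cl. range cl \<subseteq> {0, 1, 2} \<and>
      real (card (wrong ?V ?E cl)) \<le> 486 * (1 / 10 ^ 19 * n\<^sup>2 + 180000 * n)"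
    unfolding n(1)
    by (rule near_extremal_partition[of ?V ?E, OF fin adj_commute adj_irrefl[OF G], folded n(1), OF n0 _ _ near, unfolded n(1)])
       simp_all
  then obtain cl0 where cl0: "range cl0 \<subseteq> {0, 1, 2}"
    "real (card (wrong ?V ?E cl0)) \<le> 486 * (1 / 10 ^ 19 * n\<^sup>2 + 180000 * n)"
    by (elim exE conjE)
  have "cl0 ` ?V \<subseteq> {0, 1, 2}" by (rule order.trans[OF image_mono[OF subset_UNIV] cl0(1)])
  from optimal_partition_exists[of ?V ?E cl0, OF fin adj_commute adj_irrefl[OF G] this]
  obtain cl where cl: "cl ` ?V \<subseteq> {0, 1, 2}" and le0: "card (wrong ?V ?E cl) \<le> card (wrong ?V ?E cl0)"
    and opt': "\<forall>v\<in>?V. \<forall>j\<in>{0, 1, 2}. wdeg ?V ?E cl v (cl v) \<le> wdeg ?V ?E cl v j"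
    by (elim exE conjE)
  have opt: "wdeg ?V ?E cl v (cl v) \<le> wdeg ?V ?E cl v j" if "v \<in> ?V" "j \<in> {0, 1, 2}" for v j
    using opt'[rule_format, OF that] .
  have "486 * (1 / 10 ^ 19 * n\<^sup>2 + 180000 * n) \<le> n\<^sup>2 / 10 ^ 16"
  proof -
    have "10 ^ 25 * n \<le> n\<^sup>2"
      unfolding power2_eq_square using n(2) n0 by (intro mult_right_mono) auto
    then have "n \<le> n\<^sup>2 / 10 ^ 25" by simp
    then have "486 * (1 / 10 ^ 19 * n\<^sup>2 + 180000 * n) \<le> 486 * (1 / 10 ^ 19 * n\<^sup>2 + 180000 * (n\<^sup>2 / 10 ^ 25))"
      by (intro mult_left_mono add_left_mono) simp_all
    also have "\<dots> = (486 / 10 ^ 19 + 486 * 180000 / 10 ^ 25) * n\<^sup>2" by (simp add: algebra_simps)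
    also have "\<dots> \<le> 1 / 10 ^ 16 * n\<^sup>2" by (rule mult_right_mono) simp_all
    finally show ?thesis by simp
  qed
  then have few: "real (card (wrong ?V ?E cl)) \<le> n\<^sup>2 / 10 ^ 16" using cl0(2) le0 by linarith
  have "real (card (copies ?V ?E)) \<le> real (card (copies ?V (blow cl))) + real (card (wrong ?V ?E cl)) * n ^ 4"
    using of_nat_mono[OF copies_le_blow[of ?V ?E cl, OF fin adj_irrefl[OF G]]] n(1) by simp
  also have "real (card (wrong ?V ?E cl)) * n ^ 4 \<le> n\<^sup>2 / 10 ^ 16 * n ^ 4"
    using few n0 by (intro mult_right_mono) auto
  also have "n\<^sup>2 / 10 ^ 16 * n ^ 4 = n ^ 6 / 10 ^ 16" by (simp add: eval_nat_numeral)
  finally have "real (card (copies ?V ?E)) - n ^ 6 / 10 ^ 16 \<le> real (card (copies ?V (blow cl)))" by simp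
  moreover have "(1 / 5832 - 2 / 10 ^ 16) * n ^ 6 \<le> real (card (copies ?V ?E)) - n ^ 6 / 10 ^ 16"
  proof -
    have "0 \<le> n ^ 6" using n0 by simp
    then show ?thesis using near by (simp add: left_diff_distrib)
  qed
  ultimately have many: "(1 / 5832 - 2 / 10 ^ 16) * n ^ 6 \<le> real (card (copies ?V (blow cl)))" by linarith
  have "real (card (copies ?V ?E)) + real (card (wrong ?V ?E cl)) * n ^ 4 / (2 * 10 ^ 7) \<le> real (card (copies ?V (blow cl)))"
  proof (rule local_stability[OF fin cl adj_commute adj_irrefl[OF G] n(1)])
    show "10 ^ 6 \<le> n" using n(2) by simp
    have third: "(1 / 3 - 1 / 10 ^ 6) * n = n / 3 - n / 10 ^ 6" "(1 / 3 + 1 / 10 ^ 6) * n = n / 3 + n / 10 ^ 6"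
      by (simp_all add: left_diff_distrib distrib_right)
    have bal: "n / 3 - n / 10 ^ 6 \<le> real (card (cell ?V cl i))" "real (card (cell ?V cl i)) \<le> n / 3 + n / 10 ^ 6"
      if "i \<in> {0, 1, 2}" for i
      using abs_le_D1[OF balanced_cells[OF fin cl n(1) n0 many that]]
        abs_le_D2[OF balanced_cells[OF fin cl n(1) n0 many that]] by linarith+
    show "(1 / 3 - 1 / 10 ^ 6) * n \<le> real (card (cell ?V cl i))" if "i \<in> {0, 1, 2}" for i
      unfolding third by (rule bal(1)[OF that])
    show "real (card (cell ?V cl i)) \<le> (1 / 3 + 1 / 10 ^ 6) * n" if "i \<in> {0, 1, 2}" for i
      unfolding third by (rule bal(2)[OF that])
    show "real (card (wrong ?V ?E cl)) \<le> n\<^sup>2 / 10 ^ 8" using few by (rule order.trans) (intro divide_left_mono; simp)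
  qed (rule opt)
  also have "\<dots> \<le> max_density F14 (card ?V) * real (card ?V choose 6)"
  proof (rule blow_copies_le_max[OF fin cl])
    have "real 6 \<le> real (card ?V)" using n by simp
    then show "6 \<le> card ?V" by linarith
  qed
  also have "real (card (copies ?V ?E)) = ind_density F14 G * real (card ?V choose 6)"
  proof -
    have "real 6 \<le> real (card ?V)" using n by simp
    then have "6 \<le> card ?V" by linarith
    then show ?thesis by (simp add: ind_density_F14[OF G])
  qed
  finally have "real (card (wrong ?V ?E cl)) * n ^ 4 / (2 * 10 ^ 7) \<le>
      (max_density F14 (card ?V) - ind_density F14 G) * real (card ?V choose 6)"
    by (simp add: left_diff_distrib)
  also have "\<dots> \<le> (max_density F14 (card ?V) - ind_density F14 G) * n ^ 6"
    unfolding n(1) using density_le_max[OF G refl] by (intro mult_left_mono choose_six_le) simp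
  also have "\<dots> = (max_density F14 (card ?V) - ind_density F14 G) * n\<^sup>2 * n ^ 4"
    by (simp add: eval_nat_numeral)
  finally have "real (card (wrong ?V ?E cl)) / (2 * 10 ^ 7) * n ^ 4 \<le>
      (max_density F14 (card ?V) - ind_density F14 G) * n\<^sup>2 * n ^ 4" by simp
  then have "real (card (wrong ?V ?E cl)) / (2 * 10 ^ 7) \<le> (max_density F14 (card ?V) - ind_density F14 G) * n\<^sup>2"
    using n0 by (simp only: mult_le_cancel_right_pos zero_less_power)
  then have "real (card (wrong ?V ?E cl)) \<le> 2 * 10 ^ 7 * (max_density F14 (card ?V) - ind_density F14 G) * n\<^sup>2"
    by (simp add: algebra_simps)
  then show ?thesis using edit_distance_le_wrong[OF G cl] by linarith
qed

text \<open>If the deficit of the density is at least the constant \<open>d\<close>, the trivial bound \<open>n\<^sup>2\<close> on the edit distance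
suffices. Otherwise the graph is nearly extremal, because the maximum density converges to \<open>10/81\<close>.\<close>

lemma perfectly_stable_F14: "perfectly_stable F14 B14"
proof -
  define d :: real where "d = 1 / 10 ^ 21"
  have "(\<lambda>n. 23328 * (max_density F14 n - d) * (real (n choose 6) / real n ^ 6)) \<longlonglongrightarrow> 23328 * (10 / 81 - d) * (1 / 720)"
    by (intro tendsto_mult tendsto_diff tendsto_const max_density_limit choose_six_limit self_ratio_limit)
  moreover have "4 - 1 / 10 ^ 19 < 23328 * (10 / 81 - d) * (1 / 720)" by (simp add: d_def)
  ultimately have "\<forall>\<^sub>F n in sequentially. 4 - 1 / 10 ^ 19 < 23328 * (max_density F14 n - d) * (real (n choose 6) / real n ^ 6)"
    by (rule order_tendstoD(1))
  then obtain N where N: "\<And>n. N \<le> n \<Longrightarrow> 4 - 1 / 10 ^ 19 < 23328 * (max_density F14 n - d) * (real (n choose 6) / real n ^ 6)"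
    unfolding eventually_sequentially by blast
  define C :: real where "C = max (10 ^ 25) (real N)"
  have C: "10 ^ 25 \<le> C" "real N \<le> C" by (simp_all add: C_def)
  show ?thesis
    unfolding perfectly_stable_def
  proof (intro exI[of _ C] conjI allI impI, goal_cases)
    case 1
    show ?case using C(1) by (rule less_le_trans[rotated]) simp
  next
    case (2 G n)
    then have G: "simple_graph G" and n: "card (verts G) = n" "C \<le> real n" by auto
    define D where "D = max_density F14 n - ind_density F14 G"
    have D0: "0 \<le> D" using density_le_max[OF G n(1)] by (simp add: D_def)
    have "10 ^ 25 \<le> real n" using C(1) n(2) by linarith
    then have n0: "0 < real n" by (rule less_le_trans[rotated]) simp
    have fin: "finite (verts G)" using G by (simp add: simple_graph_def)
    have "real (edit_distance G B14) \<le> C * D * (real n)\<^sup>2"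
    proof (cases "d \<le> D")
      case True
      have "card (wrong (verts G) (adj G) (\<lambda>_. 0)) \<le> card (verts G \<times> verts G)"
        by (rule card_mono) (use fin in \<open>auto simp: wrong_def\<close>)
      then have "edit_distance G B14 \<le> n * n"
        using edit_distance_le_wrong[OF G, of "\<lambda>_. 0"] n(1) by (simp add: card_cartesian_product image_subset_iff)
      then have "real (edit_distance G B14) \<le> real (n * n)" by (rule of_nat_mono)
      then have "real (edit_distance G B14) \<le> 1 * (real n)\<^sup>2" by (simp add: power2_eq_square)
      also have "1 * (real n)\<^sup>2 \<le> (C * D) * (real n)\<^sup>2"
      proof (rule mult_right_mono)
        (* The trivial bound only needs C d >= 1. *)
        have "1 \<le> 10 ^ 25 * d" by (simp add: d_def)
        also have "\<dots> \<le> C * D" using C(1) True D0 by (intro mult_mono) (auto simp: d_def)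
        finally show "1 \<le> C * D" .
      qed simp
      finally show ?thesis .
    next
      case False
      have "N \<le> n" using C(2) n(2) by linarith
      have c6: "0 < real (n choose 6)"
      proof -
        have "real 6 \<le> real n" using C(1) n(2) by simp
        then show ?thesis by simp
      qed
      have "max_density F14 n - d \<le> ind_density F14 G" using False by (simp add: D_def)
      then have "23328 * (max_density F14 n - d) * (real (n choose 6) / real n ^ 6) \<le>
          23328 * ind_density F14 G * (real (n choose 6) / real n ^ 6)"
        by (intro mult_right_mono) auto
      then have "4 - 1 / 10 ^ 19 \<le> 23328 * ind_density F14 G * (real (n choose 6) / real n ^ 6)"
        using N[OF \<open>N \<le> n\<close>] by linarith
      also have "\<dots> = 23328 * real (card (copies (verts G) (adj G))) / real n ^ 6"
        using c6 by (simp add: ind_density_F14[OF G] n(1))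
      finally have "(4 - 1 / 10 ^ 19) * real n ^ 6 \<le> 23328 * real (card (copies (verts G) (adj G)))"
        using n0 by (simp only: pos_le_divide_eq zero_less_power)
      then have "real (edit_distance G B14) \<le> 2 * 10 ^ 7 * D * (real n)\<^sup>2"
        using near_extremal_stable[OF G, of "real n"] n C(1) by (simp add: D_def)
      also have "\<dots> \<le> C * D * (real n)\<^sup>2"
        using C(1) D0 by (intro mult_right_mono) auto
      finally show ?thesis .
    qed
    then show ?case by (simp add: D_def)
  qed
qed

theorem theorem3p7:
  "convergent (max_density F14) \<and> inducibility F14 = 10 / 81 \<and>
   perfectly_stable F14 B14 \<and>
   (\<forall>x\<in>prob_simplex (verts B14). has_blowup_density F14 B14 x (blowup_density F14 B14 x)) \<and>
   unique_maximiser_up_to_aut F14 B14 (\<lambda>i. if i < 3 then 1 / 3 else 0)"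
proof (intro conjI ballI)
  show "convergent (max_density F14)" using max_density_limit by (rule convergentI)
  show "inducibility F14 = 10 / 81" unfolding inducibility_def using max_density_limit by (rule limI)
  show "perfectly_stable F14 B14" by (rule perfectly_stable_F14)
  show "has_blowup_density F14 B14 x (blowup_density F14 B14 x)" if "x \<in> prob_simplex (verts B14)" for x
    unfolding blowup_density_B14[OF that] by (rule has_blowup_density_B14[OF that])
  show "unique_maximiser_up_to_aut F14 B14 (\<lambda>i. if i < 3 then 1 / 3 else 0)" by (rule unique_maximiser_B14)
qed

end
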